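(* Let $\mu$ be a locally finite Borel measure on $\mathbb{R}^2$ with full support, and let $G$ be a group of orientation-preserving homeomorphisms of $\mathbb{R}^2$, each of which preserves $\mu$. Suppose that $G$ has uniformly bounded orbits, i.e. there is a constant $k$ such that $\|gx - hx\| \leq k$ for all $g, h \in G$ and all $x \in \mathbb{R}^2$. Then $G$ has a global fixed point.
   Context: $\|\cdot\|$ is the Euclidean norm on $\mathbb{R}^2$. A measure on $\mathbb{R}^2$ is locally finite if every point has a neighborhood of finite measure, and has full support if every nonempty open set has positive measure. A global fixed point for $G$ is a point $x \in \mathbb{R}^2$ such that $gx = x$ for all $g \in G$. *)

theory Defs
  imports
    "HOL-Analysis.Analysis"
    "HOL-Complex_Analysis.Winding_Numbers"
    "HOL-Algebra.Bij"
begin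

definition complex_of_plane :: "real^2 \<Rightarrow> complex" where
  "complex_of_plane v = Complex (v $ 1) (v $ 2)"

definition plane_winding_number :: "(real \<Rightarrow> real^2) \<Rightarrow> real^2 \<Rightarrow> complex" where
  "plane_winding_number \<gamma> p = winding_number (complex_of_plane \<circ> \<gamma>) (complex_of_plane p)"

text \<open>
  A self-homeomorphism of the plane sends the generator of the first homology of the
  complement of any point p to plus or minus the generator for the image of p; it preserves
  orientation when the sign is plus. Since the winding number about p identifies that
  homology group with the integers, this says that winding numbers of loops are preserved.
\<close>

definition orientation_preserving_homeo :: "(real^2 \<Rightarrow> real^2) \<Rightarrow> bool" where
  "orientation_preserving_homeo f \<longleftrightarrow>
     (\<exists>f'. homeomorphism UNIV UNIV f f') \<and>
     (\<forall>\<gamma> p. path \<gamma> \<and> pathfinish \<gamma> = pathstart \<gamma> \<and> p \<notin> path_image \<gamma> \<longrightarrow>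
        plane_winding_number (f \<circ> \<gamma>) (f p) = plane_winding_number \<gamma> p)"

definition locally_finite_measure :: "'a::topological_space measure \<Rightarrow> bool" where
  "locally_finite_measure M \<longleftrightarrow> (\<forall>x. \<exists>U. open U \<and> x \<in> U \<and> emeasure M U < \<infinity>)"

definition full_support :: "'a::topological_space measure \<Rightarrow> bool" where
  "full_support M \<longleftrightarrow> (\<forall>U. open U \<and> U \<noteq> {} \<longrightarrow> emeasure M U > 0)"

definition preserves_measure :: "'a measure \<Rightarrow> ('a \<Rightarrow> 'a) \<Rightarrow> bool" where
  "preserves_measure M f \<longleftrightarrow> f \<in> measurable M M \<and> distr M M f = M"

end

(*
Transfer the action to the complex plane. Since all displacements are at most k, the component
W of 0 in the interior of the intersection of all g(D), for D a disc of radius 100 k, is a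
G-invariant bounded simply connected domain. Through a Riemann map phi of the unit disc onto W
the group acts on the disc, and by length-area estimates this action extends to the circle
(Caratheodory's theory of prime ends).

Three radial arms of W at angles of 120 degrees, thickened near their feet, have G-orbits
("tentacles") that are connected, invariant and far apart, and each of them is avoided by a
connected set joining the other two. Their traces on the circle are therefore three invariant,
disjoint and pairwise unlinked closed sets. The gap between the first two is unique, so its end
point e on the side of the first trace is fixed by every element of G.

Around the fixed prime end e there are crosscuts c of W of arbitrarily small diameter. If g(c) is disjoint from c, then the piece of W cut off by c and its image under g or
its inverse are properly nested, which is impossible because they have the same finite measure
and nonempty open sets have positive measure. So g(c) meets c for all sufficiently small c, and
a limit point of the crosscuts is fixed by all of G.
*)
theory Submission
  imports Defs "HOL-Complex_Analysis.Complex_Analysis"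
begin

section \<open>The length-area inequality\<close>

text \<open>The obstacle is the boundary of W: it can be so wild that phi has no continuous
  extension to the circle. Only the conjugated maps extend, so nothing is read off from boundary
  points of W; all work near the circle is done with crosscuts whose images under phi are short.
  Such crosscuts exist by an area argument: near a boundary point the image area tends to 0, and
  among many parallel lines one must then have a short image. The gain of the circle is an order.
  Fixed points of single maps differ from map to map, whereas the last point of a trace before a gap
  is determined by invariant data and hence is common to all of G. The radii only have to be large
  against k. A disc of radius 99k survives in W, feet at distance 50k lie well inside it, and errors
  of 3k do not disturb the 120 degree position of the arms. The balls at the feet have radius 2k,
  more than the displacement, so that the translates of an arm hang together.\<close>

definition plane_of_complex :: "complex \<Rightarrow> real^2" where
  "plane_of_complex z = (\<chi> i. if i = 1 then Re z else Im z)"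

lemma plane_of_complex_nth [simp]: "plane_of_complex z $ 1 = Re z" "plane_of_complex z $ 2 = Im z"
  by (auto simp: plane_of_complex_def)

lemma Re_Im_complex_of_plane [simp]: "Re (complex_of_plane v) = v $ 1" "Im (complex_of_plane v) = v $ 2"
  by (auto simp: complex_of_plane_def)

lemma complex_of_plane_of_complex [simp]: "complex_of_plane (plane_of_complex z) = z"
  by (simp add: complex_eq_iff)

lemma plane_of_complex_of_plane [simp]: "plane_of_complex (complex_of_plane v) = v"
  by (simp add: vec_eq_iff forall_2)

lemma norm_complex_of_plane [simp]: "norm (complex_of_plane v) = norm v"
  by (simp add: cmod_def norm_vec_def L2_set_def UNIV_2)

lemma linear_complex_of_plane: "linear complex_of_plane"
  by (rule linearI) (auto simp: complex_eq_iff)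

lemma linear_plane_of_complex: "linear plane_of_complex"
  by (rule linearI) (auto simp: vec_eq_iff forall_2)

lemma bounded_linear_complex_of_plane: "bounded_linear complex_of_plane"
  using linear_complex_of_plane linear_conv_bounded_linear by blast

lemma bounded_linear_plane_of_complex: "bounded_linear plane_of_complex"
  using linear_plane_of_complex linear_conv_bounded_linear by blast

lemma continuous_on_complex_of_plane [continuous_intros]:
  "continuous_on S f \<Longrightarrow> continuous_on S (\<lambda>x. complex_of_plane (f x))"
  by (rule bounded_linear.continuous_on[OF bounded_linear_complex_of_plane])

lemma continuous_on_plane_of_complex [continuous_intros]:
  "continuous_on S f \<Longrightarrow> continuous_on S (\<lambda>x. plane_of_complex (f x))"
  by (rule bounded_linear.continuous_on[OF bounded_linear_plane_of_complex])

lemma borel_measurable_plane_of_complex [measurable]: "plane_of_complex \<in> borel_measurable borel"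
  by (intro borel_measurable_continuous_onI continuous_intros)

lemma borel_measurable_complex_of_plane [measurable]: "complex_of_plane \<in> borel_measurable borel"
  by (intro borel_measurable_continuous_onI continuous_intros)

lemma plane_of_complex_image: "plane_of_complex ` S = complex_of_plane -` S"
  by (metis (no_types, lifting) bij_betw_def bij_vimage_eq_inv_image complex_of_plane_of_complex inj_on_def inv_equality plane_of_complex_of_plane surj_def)

section \<open>Lebesgue measure under the identification of \<open>complex\<close> with
  \<open>real^2\<close>\<close>

lemma lborel_plane_eq: "lborel = distr (lborel :: complex measure) borel plane_of_complex"
proof (rule lborel_eqI)
  fix l u :: "real^2"
  assume lu: "\<And>b. b \<in> Basis \<Longrightarrow> l \<bullet> b \<le> u \<bullet> b"
  have lu1: "l $ i \<le> u $ i" for i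
    using lu[of "axis i 1"] by (simp add: inner_axis axis_in_Basis_iff)
  have 1: "plane_of_complex -` box l u = box (complex_of_plane l) (complex_of_plane u)"
    by (auto simp: box_def Basis_vec_def Basis_complex_def inner_axis forall_2)
  have "emeasure lborel (box l u) = ennreal (\<Prod>b\<in>Basis. (u - l) \<bullet> b)"
    using lu by (simp add: emeasure_lborel_box)
  moreover have "(\<Prod>b\<in>Basis. (u - l) \<bullet> b) = (u$1 - l$1) * (u$2 - l$2)"
  proof -
    have B: "(Basis :: (real^2) set) = {axis 1 1, axis 2 1}"
      by (auto simp: Basis_vec_def) (metis exhaust_2)+
    have "axis 1 1 \<noteq> (axis 2 1 :: real^2)"
      by (simp add: axis_eq_axis)
    then show ?thesis
      unfolding B by (subst prod.insert) (auto simp: inner_axis)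
  qed
  ultimately show "emeasure (distr (lborel :: complex measure) borel plane_of_complex) (box l u)
      = ennreal (\<Prod>b\<in>Basis. (u - l) \<bullet> b)"
    using lu1
    by (simp add: emeasure_distr emeasure_lborel_box_eq Basis_complex_def 1)
qed simp

lemma borel_measurable_Complex [measurable]:
  assumes [measurable]: "f \<in> borel_measurable M" "g \<in> borel_measurable M"
  shows "(\<lambda>x. Complex (f x) (g x)) \<in> borel_measurable M"
  unfolding Complex_eq by measurable

lemma lborel_complex_eq_pair:
  "(lborel :: complex measure) = distr (lborel \<Otimes>\<^sub>M lborel) borel (\<lambda>(x,y). Complex x y)"
proof (rule lborel_eqI)
  fix l u :: complex
  assume lu: "\<And>b. b \<in> Basis \<Longrightarrow> l \<bullet> b \<le> u \<bullet> b"
  have lu1: "Re l \<le> Re u" "Im l \<le> Im u"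
    using lu[of 1] lu[of \<i>] by (auto simp: Basis_complex_def)
  have "(\<lambda>(x,y). Complex x y) -` box l u = box (Re l) (Re u) \<times> box (Im l) (Im u)"
    by (auto simp: box_def Basis_complex_def)
  then show "emeasure (distr (lborel \<Otimes>\<^sub>M lborel) borel (\<lambda>(x,y). Complex x y)) (box l u)
      = ennreal (\<Prod>b\<in>Basis. (u - l) \<bullet> b)"
    using lu1
    by (simp add: emeasure_distr lborel.emeasure_pair_measure_Times Basis_complex_def space_pair_measure ennreal_mult)
qed simp

lemma nn_integral_lborel_complex:
  assumes [measurable]: "F \<in> borel_measurable borel"
  shows "(\<integral>\<^sup>+z. F z \<partial>(lborel :: complex measure)) = (\<integral>\<^sup>+y. \<integral>\<^sup>+x. F (Complex x y) \<partial>lborel \<partial>lborel)"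
proof -
  have "(\<integral>\<^sup>+z. F z \<partial>(lborel :: complex measure)) = (\<integral>\<^sup>+p. F (Complex (fst p) (snd p)) \<partial>(lborel \<Otimes>\<^sub>M lborel))"
    by (subst lborel_complex_eq_pair, subst nn_integral_distr) (auto simp: split_beta)
  also have "\<dots> = (\<integral>\<^sup>+y. \<integral>\<^sup>+x. F (Complex x y) \<partial>lborel \<partial>lborel)"
    by (subst lborel_pair.nn_integral_snd[symmetric]) (auto simp: split_beta)
  finally show ?thesis .
qed

lemma emeasure_lborel_plane: 
  assumes "S \<in> sets borel"
  shows "emeasure lborel (plane_of_complex ` S) = emeasure lborel S"
proof -
  have [measurable]: "S \<in> sets borel" by fact
  have m: "complex_of_plane -` S \<in> sets borel"
    using measurable_sets[OF borel_measurable_complex_of_plane, of S] assms by simp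
  have "emeasure lborel (plane_of_complex ` S) = emeasure lborel (plane_of_complex -` (complex_of_plane -` S))"
    using m by (subst lborel_plane_eq) (simp add: plane_of_complex_image emeasure_distr)
  then show ?thesis by (simp add: vimage_def)
qed

text \<open>Multiplication by f'(z), read as a real 2x2 matrix, has determinant |f'(z)|^2, so this
  is the change of variables formula for injective maps. The detour through \<open>real^2\<close> is
  made for \<open>det\<close> and \<open>matrix\<close>; a bounded image makes the integral
  finite.\<close>

lemma area_injective_holomorphic:
  assumes hol: "f holomorphic_on Z" and Z: "open Z" and inj: "inj_on f Z" and bd: "bounded (f ` Z)"
  shows "(\<integral>\<^sup>+z. ennreal ((norm (deriv f z))\<^sup>2) * indicator Z z \<partial>lborel) = emeasure lborel (f ` Z)"
proof -
  let ?P = plane_of_complex and ?C = complex_of_plane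
  define F where "F = ?P \<circ> f \<circ> ?C"
  define Z2 where "Z2 = ?P ` Z"
  define F' where "F' = (\<lambda>v h. ?P (deriv f (?C v) * ?C h))"
  have Z2: "open Z2"
    unfolding Z2_def plane_of_complex_image by (intro open_vimage Z continuous_intros)
  have fZ: "open (f ` Z)"
    using open_mapping_thm3[OF hol Z inj] by simp
  have FZ2: "F ` Z2 = ?P ` (f ` Z)" by (auto simp: F_def Z2_def image_iff)
  have oFZ: "open (F ` Z2)"
    unfolding FZ2 unfolding plane_of_complex_image[of "f ` Z"] by (intro open_vimage fZ continuous_intros)
  have bFZ: "bounded (F ` Z2)"
    unfolding FZ2 by (intro bounded_linear_image bd bounded_linear_plane_of_complex)
  have lm: "F ` Z2 \<in> lmeasurable"
    using oFZ bFZ by (simp add: lmeasurable_open)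
  have der: "(F has_derivative F' v) (at v within Z2)" if "v \<in> Z2" for v
  proof -
    have "?C v \<in> Z" using that by (auto simp: Z2_def)
    then have "(f has_field_derivative deriv f (?C v)) (at (?C v))"
      using hol Z holomorphic_derivI by blast
    then have 1: "(f has_derivative (\<lambda>h. deriv f (?C v) * h)) (at (?C v))"
      by (simp add: has_field_derivative_def)
    have C: "(?C has_derivative ?C) (at v within Z2)"
      using bounded_linear_complex_of_plane bounded_linear_imp_has_derivative by blast
    have "((\<lambda>v. ?P (f (?C v))) has_derivative (\<lambda>h. ?P (deriv f (?C v) * ?C h))) (at v within Z2)"
      by (intro bounded_linear.has_derivative[OF bounded_linear_plane_of_complex]
            has_derivative_compose[OF C 1])
    then show ?thesis by (simp add: F_def F'_def o_def)
  qed
  have injF: "inj_on F Z2"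
    using inj unfolding F_def Z2_def inj_on_def
    by (auto dest!: arg_cong[where f = ?C])
  have det: "\<bar>det (matrix (F' v))\<bar> = (norm (deriv f (?C v)))\<^sup>2" for v
  proof -
    have c: "?C (axis 1 1) = 1" "?C (axis 2 1) = \<i>"
      by (auto simp: complex_eq_iff axis_def)
    show ?thesis
      unfolding cmod_power2 by (simp add: det_2 matrix_def F'_def c axis_def power2_eq_square)
  qed
  have [measurable]: "Z2 \<in> sets borel" "Z \<in> sets borel" using Z2 Z by auto
  have S: "Z2 \<in> sets lebesgue" by simp
  have int: "(\<lambda>v. (norm (deriv f (?C v)))\<^sup>2) integrable_on Z2"
    using measurable_differentiable_image_eq[OF S der injF] lm by (simp add: det)
  have eq: "measure lebesgue (F ` Z2) = integral Z2 (\<lambda>v. (norm (deriv f (?C v)))\<^sup>2)"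
    using measure_differentiable_image_eq[OF S der injF] int by (simp add: det)
  have "deriv f holomorphic_on Z" using hol Z by (rule holomorphic_deriv)
  then have cont: "continuous_on Z (deriv f)" by (rule holomorphic_on_imp_continuous_on)
  have m[measurable]: "(\<lambda>z. ennreal ((norm (deriv f z))\<^sup>2) * indicator Z z) \<in> borel_measurable borel"
  proof -
    have "(\<lambda>z. indicator Z z *\<^sub>R deriv f z) \<in> borel_measurable borel"
      using cont by (intro borel_measurable_continuous_on_indicator) auto
    then have "(\<lambda>z. ennreal ((norm (indicator Z z *\<^sub>R deriv f z))\<^sup>2)) \<in> borel_measurable borel"
      by measurable
    also have "(\<lambda>z. ennreal ((norm (indicator Z z *\<^sub>R deriv f z))\<^sup>2)) = (\<lambda>z. ennreal ((norm (deriv f z))\<^sup>2) * indicator Z z)"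
      by (auto simp: indicator_def)
    finally show ?thesis .
  qed
  have "emeasure lborel (f ` Z) = emeasure lborel (F ` Z2)"
    unfolding FZ2 using fZ by (subst emeasure_lborel_plane) auto
  also have "\<dots> = emeasure lebesgue (F ` Z2)"
    using oFZ by simp
  also have "\<dots> = ennreal (integral Z2 (\<lambda>v. (norm (deriv f (?C v)))\<^sup>2))"
    using lm eq by (simp add: emeasure_eq_measure2)
  also have "\<dots> = (\<integral>\<^sup>+v. ennreal ((norm (deriv f (?C v)))\<^sup>2) * indicator Z2 v \<partial>lborel)"
  proof -
    have "((\<lambda>v. (norm (deriv f (?C v)))\<^sup>2) has_integral integral Z2 (\<lambda>v. (norm (deriv f (?C v)))\<^sup>2)) Z2"
      using int by blast
    from nn_integral_has_integral_lebesgue'[OF _ this] show ?thesis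
      by simp
  qed
  also have "\<dots> = (\<integral>\<^sup>+z. ennreal ((norm (deriv f z))\<^sup>2) * indicator Z z \<partial>lborel)"
  proof -
    have "indicator Z2 (?P z) = (indicator Z z :: ennreal)" for z
      by (auto simp: Z2_def plane_of_complex_image indicator_def)
    moreover have "(\<lambda>v. ennreal ((norm (deriv f (?C v)))\<^sup>2) * indicator Z2 v) = 
       (\<lambda>z. ennreal ((norm (deriv f z))\<^sup>2) * indicator Z z) \<circ> ?C"
      by (auto simp: Z2_def plane_of_complex_image indicator_def)
    ultimately show ?thesis
      by (subst lborel_plane_eq, subst nn_integral_distr) (simp_all add: o_def)
  qed
  finally show ?thesis by simp
qed

text \<open>Each of the segments has an image of length at least \<open>m\<close>, so integrating
  |f'| over all heights gives at least \<open>(d - c) * m\<close>. In place of Cauchy-Schwarz, the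
  pointwise bound t <= a t^2 + 1/a separates the two areas; the weight \<open>a\<close> is tuned in
  each application.\<close>

lemma length_area:
  assumes hol: "f holomorphic_on Z" and Z: "open Z" and inj: "inj_on f Z" and bd: "bounded (f ` Z)"
    and cd: "c \<le> d" and m: "0 \<le> m" and a: "0 < a"
    and seg: "\<And>y. y \<in> {c<..<d} \<Longrightarrow> \<exists>x1 x2. x1 \<le> x2 \<and> (\<forall>x\<in>{x1..x2}. Complex x y \<in> Z)
                 \<and> m \<le> norm (f (Complex x2 y) - f (Complex x1 y))"
  shows "ennreal ((d - c) * m) \<le> ennreal a * emeasure lborel (f ` Z) + ennreal (1/a) * emeasure lborel Z"
proof -
  define g where "g = (\<lambda>z. ennreal (norm (deriv f z)) * indicator Z z)"
  have cont: "continuous_on Z (deriv f)" 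
    using holomorphic_deriv[OF hol Z] by (rule holomorphic_on_imp_continuous_on)
  have [measurable]: "Z \<in> sets borel" using Z by auto
  have "(\<lambda>z. indicator Z z *\<^sub>R deriv f z) \<in> borel_measurable borel"
    using cont by (intro borel_measurable_continuous_on_indicator) auto
  then have m1: "(\<lambda>z. ennreal (norm (indicator Z z *\<^sub>R deriv f z))) \<in> borel_measurable borel"
     and m2: "(\<lambda>z. ennreal ((norm (indicator Z z *\<^sub>R deriv f z))\<^sup>2)) \<in> borel_measurable borel"
    by measurable
  have gm[measurable]: "g \<in> borel_measurable borel"
    using m1 by (rule back_subst[of "\<lambda>h. h \<in> borel_measurable borel"]) (auto simp: g_def indicator_def)
  have m2'[measurable]: "(\<lambda>z. ennreal ((norm (deriv f z))\<^sup>2) * indicator Z z) \<in> borel_measurable borel"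
    using m2 by (rule back_subst[of "\<lambda>h. h \<in> borel_measurable borel"]) (auto simp: indicator_def)
  have line: "ennreal m \<le> (\<integral>\<^sup>+x. g (Complex x y) \<partial>lborel)" if y: "y \<in> {c<..<d}" for y
  proof -
    obtain x1 x2 where x: "x1 \<le> x2" "\<And>x. x \<in> {x1..x2} \<Longrightarrow> Complex x y \<in> Z"
      "m \<le> norm (f (Complex x2 y) - f (Complex x1 y))"
      using seg[OF y] by blast
    have der: "((\<lambda>x. f (Complex x y)) has_vector_derivative deriv f (Complex x y)) (at x within {x1..x2})"
      if "x \<in> {x1..x2}" for x
    proof -
      have "(f has_field_derivative deriv f (Complex x y)) (at (Complex x y) within Z)"
        using x(2)[OF that] hol Z by (metis holomorphic_derivI has_field_derivative_at_within)
      then have 1: "(f has_field_derivative deriv f (Complex x y)) (at (Complex x y) within (\<lambda>x. Complex x y) ` {x1..x2})"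
        by (rule DERIV_subset) (use x(2) in auto)
      have 2: "((\<lambda>x. Complex x y) has_vector_derivative 1) (at x within {x1..x2})"
        unfolding Complex_eq by (auto intro!: derivative_eq_intros)
      show ?thesis
        using field_vector_diff_chain_within[OF 2 1] by (simp add: o_def)
    qed
    have I: "((\<lambda>x. deriv f (Complex x y)) has_integral f (Complex x2 y) - f (Complex x1 y)) {x1..x2}"
      using x(1) der by (rule fundamental_theorem_of_calculus)
    have cc: "continuous_on {x1..x2} (\<lambda>x. deriv f (Complex x y))"
      by (rule continuous_on_compose2[OF cont]) (auto simp: Complex_eq intro!: continuous_intros x(2)[unfolded Complex_eq])
    have i2: "(\<lambda>x. norm (deriv f (Complex x y))) integrable_on {x1..x2}"
      by (intro integrable_continuous_interval continuous_intros cc)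
    have "norm (f (Complex x2 y) - f (Complex x1 y)) \<le> integral {x1..x2} (\<lambda>x. norm (deriv f (Complex x y)))"
      using integral_norm_bound_integral[OF has_integral_integrable[OF I] i2] I by (simp add: integral_unique)
    then have "ennreal m \<le> ennreal (integral {x1..x2} (\<lambda>x. norm (deriv f (Complex x y))))"
      using x(3) by (intro ennreal_leI) simp
    also have "\<dots> = (\<integral>\<^sup>+x. ennreal (norm (deriv f (Complex x y))) * indicator {x1..x2} x \<partial>lborel)"
      by (rule nn_integral_has_integral_lebesgue'[symmetric]) (use i2 in auto)
    also have "\<dots> \<le> (\<integral>\<^sup>+x. g (Complex x y) \<partial>lborel)"
      by (rule nn_integral_mono) (auto simp: g_def indicator_def x(2))
    finally show ?thesis .
  qed
  have "ennreal ((d - c) * m) = (\<integral>\<^sup>+y. ennreal m * indicator {c<..<d} y \<partial>lborel)"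
    using cd m by (simp add: nn_integral_cmult_indicator ennreal_mult' mult.commute)
  also have "\<dots> \<le> (\<integral>\<^sup>+y. \<integral>\<^sup>+x. g (Complex x y) \<partial>lborel \<partial>lborel)"
    by (rule nn_integral_mono) (use line in \<open>auto simp: indicator_def\<close>)
  also have "\<dots> = (\<integral>\<^sup>+z. g z \<partial>lborel)"
    by (rule nn_integral_lborel_complex[symmetric]) simp
  also have "\<dots> \<le> (\<integral>\<^sup>+z. ennreal a * (ennreal ((norm (deriv f z))\<^sup>2) * indicator Z z) + ennreal (1/a) * indicator Z z \<partial>lborel)"
  proof (rule nn_integral_mono)
    fix z
    have "t \<le> a * t\<^sup>2 + 1/a" for t :: real
    proof -
      have "0 \<le> (a * t - 1)\<^sup>2 + 1 + (a*t)\<^sup>2" by simp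
      then have "2 * (a * t) \<le> 2 * (a * t)\<^sup>2 + 2" by (simp add: power2_diff)
      moreover have "a * (a * t\<^sup>2 + 1/a) = (a * t)\<^sup>2 + 1"
        using a by (simp add: power2_eq_square field_simps)
      ultimately have "a * t \<le> a * (a * t\<^sup>2 + 1/a)" by linarith
      then show ?thesis using a by (simp only: mult_le_cancel_left_pos)
    qed
    then have "ennreal (norm (deriv f z)) \<le> ennreal (a * (norm (deriv f z))\<^sup>2 + 1/a)"
      by (intro ennreal_leI) simp
    then show "g z \<le> ennreal a * (ennreal ((norm (deriv f z))\<^sup>2) * indicator Z z) + ennreal (1/a) * indicator Z z"
      using a by (auto simp: g_def indicator_def ennreal_mult ennreal_plus)
  qed
  also have "\<dots> = ennreal a * emeasure lborel (f ` Z) + ennreal (1/a) * emeasure lborel Z"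
    by (simp add: nn_integral_add nn_integral_cmult area_injective_holomorphic[OF hol Z inj bd] nn_integral_cmult_indicator)
  finally show ?thesis .
qed

section \<open>Short crosscuts\<close>

lemma ennreal_linear_combination:
  "0 \<le> a \<Longrightarrow> 0 \<le> x \<Longrightarrow> 0 \<le> b \<Longrightarrow> 0 \<le> y \<Longrightarrow>
    ennreal a * ennreal x + ennreal b * ennreal y = ennreal (a * x + b * y)"
  by (simp add: ennreal_mult ennreal_plus)

text \<open>Contrapositive of \<open>length_area\<close>. Since \<open>I\<close> may be open, a line
  may run up to the circle without touching it; the bound is therefore one for all pairs of points
  on the line.\<close>

lemma exists_short_line:
  assumes "f holomorphic_on Z" "open Z" "inj_on f Z" "bounded (f ` Z)"
    and "c \<le> d" "0 \<le> m" "0 < a"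
    and small: "ennreal a * emeasure lborel (f ` Z) + ennreal (1/a) * emeasure lborel Z < ennreal ((d - c) * m)"
    and I: "is_interval I" and IZ: "\<And>x y. x \<in> I \<Longrightarrow> y \<in> {c<..<d} \<Longrightarrow> Complex x y \<in> Z"
  shows "\<exists>y\<in>{c<..<d}. \<forall>x1\<in>I. \<forall>x2\<in>I. norm (f (Complex x2 y) - f (Complex x1 y)) \<le> m"
proof (rule ccontr)
  assume "\<not> ?thesis"
  then have bad: "\<exists>x1\<in>I. \<exists>x2\<in>I. m \<le> norm (f (Complex x2 y) - f (Complex x1 y))" if "y \<in> {c<..<d}" for y
    using that by (meson linorder_linear)
  have "\<exists>x1 x2. x1 \<le> x2 \<and> (\<forall>x\<in>{x1..x2}. Complex x y \<in> Z)
                 \<and> m \<le> norm (f (Complex x2 y) - f (Complex x1 y))" if y: "y \<in> {c<..<d}" for y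
  proof -
    obtain x1 x2 where x: "x1 \<in> I" "x2 \<in> I" "m \<le> norm (f (Complex x2 y) - f (Complex x1 y))"
      using bad[OF y] by blast
    show ?thesis
    proof (cases "x1 \<le> x2")
      case True
      have "x \<in> I" if "x \<in> {x1..x2}" for x
        using mem_is_interval_1_I[OF I x(1,2)] that by auto
      then show ?thesis using x IZ[OF _ y] True by blast
    next
      case False
      have "x \<in> I" if "x \<in> {x2..x1}" for x
        using mem_is_interval_1_I[OF I x(2,1)] that by auto
      moreover have "m \<le> norm (f (Complex x1 y) - f (Complex x2 y))"
        using x(3) by (simp add: norm_minus_commute)
      ultimately show ?thesis using IZ[OF _ y] False by (intro exI[of _ x2] exI[of _ x1]) simp
    qed
  qed
  from length_area[OF assms(1-7) this] small show False by simp
qed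

text \<open>Continuity of measure from above. It supplies small image areas near a boundary point,
  where no bound on the derivative is available.\<close>

lemma tendsto_emeasure_image_decseq:
  fixes Q :: "nat \<Rightarrow> complex set"
  assumes hol: "f holomorphic_on Z" and inj: "inj_on f Z" and bd: "bounded (f ` Z)"
    and Q: "\<And>n. open (Q n)" "\<And>n. Q n \<subseteq> Z" "decseq Q" "(\<Inter>n. Q n) = {}"
  shows "(\<lambda>n. emeasure lborel (f ` Q n)) \<longlonglongrightarrow> 0"
proof -
  have op: "open (f ` Q n)" for n
    using open_mapping_thm3[OF holomorphic_on_subset[OF hol] Q(1) inj_on_subset[OF inj]] Q(2) by blast
  have "bounded (f ` Q n)" for n
    by (rule bounded_subset[OF bd]) (use Q(2) in blast)
  then have fin: "emeasure lborel (f ` Q n) < \<infinity>" for n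
    by (rule emeasure_bounded_finite)
  have emp: "(\<Inter>n. f ` Q n) = {}"
    using image_INT[OF inj, of UNIV Q] Q(2,4) by auto
  have "decseq (\<lambda>n. f ` Q n)"
    using Q(3) by (auto simp: decseq_def)
  then have "(\<lambda>n. emeasure lborel (f ` Q n)) \<longlonglongrightarrow> emeasure lborel (\<Inter>n. f ` Q n)"
    by (intro Lim_emeasure_decseq) (use op fin less_top in \<open>auto simp: less_top\<close>)
  then show ?thesis by (simp add: emp)
qed

text \<open>In prime end language \<open>N\<close> is the side of the crosscut \<open>c\<close> that belongs to the boundary point
  \<open>\<zeta>\<close>; the end points of \<open>c\<close> on the circle are not part of it.\<close>

definition crosscut_at :: "complex \<Rightarrow> real \<Rightarrow> complex set \<Rightarrow> complex set \<Rightarrow> bool" where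
  "crosscut_at \<zeta> r N c \<longleftrightarrow>
     open N \<and> connected N \<and> connected c \<and> c \<noteq> {} \<and>
     N \<subseteq> ball 0 1 \<inter> ball \<zeta> r \<and> c \<subseteq> ball 0 1 \<inter> ball \<zeta> r \<and> N \<inter> c = {} \<and>
     open (ball 0 1 - (N \<union> c)) \<and> connected (ball 0 1 - N) \<and>
     c \<subseteq> closure N \<and> c \<subseteq> closure (ball 0 1 - (N \<union> c)) \<and>
     (\<exists>\<rho>>0. ball 0 1 \<inter> ball \<zeta> \<rho> \<subseteq> N)"

text \<open>In the coordinate \<open>s\<close> the punctured disc is covered by the half-plane Re s
  < 0, and \<zeta> sits at s = 0. The crosscut consists of three sides of the rectangle
  \<open>B\<close>; the fourth lies on Re s = 0, that is on the circle, and is left out.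
  \<open>R \<le> pi\<close> makes \<open>exp\<close> injective on the rectangle.\<close>

lemma crosscut_at_polar_rectangle:
  fixes \<zeta> :: complex
  assumes \<zeta>: "norm \<zeta> = 1" and x0: "0 < x0" and y: "y1 < 0" "0 < y2"
    and R: "R \<le> pi" "\<And>s::complex. norm s < R \<Longrightarrow> norm (exp s - 1) < r"
    and small: "x0 < R/2" "-y1 < R/2" "y2 < R/2"
  defines "B \<equiv> box (Complex (-x0) y1) (Complex 0 y2)"
  defines "P \<equiv> {s. -x0 \<le> Re s \<and> Re s < 0 \<and> y1 \<le> Im s \<and> Im s \<le> y2} - B"
  shows "crosscut_at \<zeta> r ((\<lambda>s. \<zeta> * exp s) ` B) ((\<lambda>s. \<zeta> * exp s) ` P)"
proof -
  define E where "E = (\<lambda>s. \<zeta> * exp s)"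
  define C where "C = {s. -x0 \<le> Re s \<and> Re s < 0 \<and> y1 \<le> Im s \<and> Im s \<le> y2}"
  define CC where "CC = cbox (Complex (-x0) y1) (Complex 0 y2)"
  have z0: "\<zeta> \<noteq> 0" using \<zeta> by auto
  have Beq: "B = {s. -x0 < Re s \<and> Re s < 0 \<and> y1 < Im s \<and> Im s < y2}"
    by (auto simp: B_def in_box_complex_iff)
  have CCeq: "CC = {s. -x0 \<le> Re s \<and> Re s \<le> 0 \<and> y1 \<le> Im s \<and> Im s \<le> y2}"
    by (auto simp: CC_def in_cbox_complex_iff)
  have BC: "B \<subseteq> C" "C \<subseteq> CC" "P = C - B" by (auto simp: Beq C_def CCeq P_def)
  have CCR: "CC \<subseteq> ball 0 R"
  proof
    fix s assume "s \<in> CC"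
    then have "\<bar>Re s\<bar> < R/2" "\<bar>Im s\<bar> < R/2" using small y by (auto simp: CCeq)
    then show "s \<in> ball 0 R" using cmod_le[of s] by simp
  qed
  have CCpi: "CC \<subseteq> ball 0 pi" using CCR R(1) by fastforce
  have inj: "inj_on E (ball 0 pi)"
    using inj_on_exp_pi[of 0] z0 by (auto simp: inj_on_def E_def)
  have cont: "continuous_on S E" for S unfolding E_def by (intro continuous_intros)
  have nE: "norm (E s) = exp (Re s)" for s by (simp add: E_def norm_mult \<zeta>)
  have ED: "E s \<in> ball 0 1 \<longleftrightarrow> Re s < 0" for s by (simp add: nE)
  have Er: "E s \<in> ball \<zeta> r" if "norm s < R" for s
  proof -
    have "E s - \<zeta> = \<zeta> * (exp s - 1)" by (simp add: E_def algebra_simps)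
    then have "norm (E s - \<zeta>) < r" using R(2)[OF that] by (simp add: norm_mult \<zeta>)
    then show ?thesis by (simp add: dist_norm norm_minus_commute)
  qed
  have NC: "E ` B \<union> E ` P = E ` C" using BC by auto
  have disj: "E ` B \<inter> E ` P = {}"
    using inj_on_image_Int[OF inj, of B P] BC CCpi by blast
  have opN: "open (E ` B)"
  proof (rule open_mapping_thm3)
    show "E holomorphic_on B" unfolding E_def by (intro holomorphic_intros)
    show "open B" unfolding B_def by (rule open_box)
    show "inj_on E B" using inj_on_subset[OF inj] BC CCpi by blast
  qed
  have conN: "connected (E ` B)"
    by (intro connected_continuous_image cont convex_connected) (simp add: B_def convex_box)
  have conP: "connected P"
  proof -
    define P1 where "P1 = {s. Re s = -x0 \<and> y1 \<le> Im s \<and> Im s \<le> y2}"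
    define P2 where "P2 = {s. -x0 \<le> Re s \<and> Re s < 0 \<and> Im s = y1}"
    define P3 where "P3 = {s. -x0 \<le> Re s \<and> Re s < 0 \<and> Im s = y2}"
    have i: "is_interval P1" "is_interval P2" "is_interval P3"
      by (auto simp: P1_def P2_def P3_def is_interval_def Basis_complex_def)
    have "P = P1 \<union> P2 \<union> P3" using x0 y by (auto simp: BC(3) Beq C_def P1_def P2_def P3_def)
    moreover have "connected (P1 \<union> P2 \<union> P3)"
    proof (intro connected_Un is_interval_connected i)
      have "Complex (-x0) y1 \<in> P1 \<inter> P2" "Complex (-x0) y2 \<in> (P1 \<union> P2) \<inter> P3"
        using x0 y by (auto simp: P1_def P2_def P3_def)
      then show "P1 \<inter> P2 \<noteq> {}" "(P1 \<union> P2) \<inter> P3 \<noteq> {}" by blast+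
    qed
    ultimately show ?thesis by simp
  qed
  have opM: "open (ball 0 1 - E ` C)"
  proof -
    have "ball 0 1 - E ` C = ball 0 1 - E ` CC"
    proof -
      have "s \<in> C" if "s \<in> CC" "E s \<in> ball 0 1" for s
        using that ED[of s] by (auto simp: C_def CCeq)
      then show ?thesis using BC(2) by blast
    qed
    moreover have "compact (E ` CC)"
      by (intro compact_continuous_image cont) (simp add: CC_def)
    ultimately show ?thesis by (simp add: open_Diff compact_imp_closed)
  qed
  \<comment> \<open>Starlike with centre 0: moving outwards along a radius adds a positive real to
    \<open>s\<close>, which cannot leave the rectangle before the circle is reached. A segment from
    0 that met the image of \<open>B\<close> would thus end in it.\<close>
  have conM: "connected (ball 0 1 - E ` B)"
  proof (rule starlike_imp_connected)
    have "closed_segment 0 z \<subseteq> ball 0 1 - E ` B" if z: "z \<in> ball 0 1 - E ` B" for z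
    proof
      fix w assume "w \<in> closed_segment 0 z"
      then obtain t where t: "0 \<le> t" "t \<le> 1" "w = of_real t * z"
        by (auto simp: closed_segment_def scaleR_conv_of_real)
      have "norm w < 1"
        using t z mult_left_le_one_le[of "norm z" t] by (simp add: norm_mult)
      moreover have "w \<notin> E ` B"
      proof
        assume "w \<in> E ` B"
        then obtain s where s: "s \<in> B" "w = E s" by auto
        then have "t \<noteq> 0" using t z0 by (auto simp: E_def)
        then have t0: "0 < t" using t by simp
        then have "exp (of_real (ln t)) = (of_real t :: complex)"
          by (metis exp_ln of_real_exp)
        then have zE: "z = E (s - of_real (ln t))"
          using s(2) t t0 by (simp add: E_def exp_diff field_simps)
        have "ln t \<le> 0" using t t0 by simp
        then have "s - of_real (ln t) \<in> B"
          using s(1) ED[of "s - of_real (ln t)"] z zE by (auto simp: Beq)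
        then show False using z zE by auto
      qed
      ultimately show "w \<in> ball 0 1 - E ` B" by simp
    qed
    moreover have "0 \<in> ball 0 1 - E ` B" using z0 by (auto simp: E_def)
    ultimately show "starlike (ball 0 1 - E ` B)" unfolding starlike_def by blast
  qed
  have cN: "E ` P \<subseteq> closure (E ` B)"
  proof -
    have "B \<noteq> {}" using x0 y by (auto simp: B_def box_ne_empty Basis_complex_def)
    then have "closure B = CC" unfolding B_def CC_def by (rule closure_box)
    then have "P \<subseteq> closure B" using BC by auto
    moreover have "E ` closure B \<subseteq> closure (E ` B)"
      by (rule image_closure_subset) (auto intro: cont closure_subset[THEN subsetD])
    ultimately show ?thesis by blast
  qed
  have cM: "E ` P \<subseteq> closure (ball 0 1 - E ` C)"
  proof (rule image_subsetI)
    fix s assume s: "s \<in> P"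
    have sR: "norm s < R" using s BC CCR by auto
    \<comment> \<open>\<open>v\<close> points out of the rectangle through the side on which
      \<open>s\<close> lies, and never to the right, so that the shifted points stay in the
      disc.\<close>
    obtain v :: complex where v: "norm v = 1" "Re v \<le> 0" "\<And>t. 0 < t \<Longrightarrow> s + of_real t * v \<notin> C"
    proof -
      consider "Re s = -x0" | "Im s = y1" | "Im s = y2"
        using s by (force simp: BC(3) C_def Beq)
      then show ?thesis
      proof cases
        case 1 then show ?thesis by (intro that[of "-1"]) (auto simp: C_def)
      next
        case 2 then show ?thesis by (intro that[of "-\<i>"]) (auto simp: C_def)
      next
        case 3 then show ?thesis by (intro that[of "\<i>"]) (auto simp: C_def)
      qed
    qed
    have ev: "eventually (\<lambda>t. E (s + of_real t * v) \<in> ball 0 1 - E ` C) (at_right 0)"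
    proof -
      have "eventually (\<lambda>t::real. t < R - norm s) (at_right 0)"
        using eventually_at_right_real[of 0 "R - norm s"] sR by (auto elim: eventually_mono)
      then show ?thesis using eventually_at_right_less[of "0::real"]
      proof eventually_elim
        case (elim t)
        have "norm (s + of_real t * v) < R"
          using norm_triangle_ineq[of s "of_real t * v"] elim v(1) by (simp add: norm_mult)
        then have "s + of_real t * v \<in> ball 0 pi" using R(1) by simp
        then have "E (s + of_real t * v) \<notin> E ` C"
          using v(3)[OF elim(2)] inj_on_image_mem_iff[OF inj, of _ C] BC(2) CCpi by blast
        moreover have "Re s < 0" using s by (auto simp: P_def)
        then have "Re (s + of_real t * v) < 0"
          using elim v(2) by (simp add: mult_nonneg_nonpos add_neg_nonpos)
        ultimately show ?case using ED by blast
      qed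
    qed
    have "((\<lambda>t. E (s + of_real t * v)) \<longlongrightarrow> E (s + of_real 0 * v)) (at_right 0)"
      unfolding E_def by (intro tendsto_intros)
    then have lim: "((\<lambda>t. E (s + of_real t * v)) \<longlongrightarrow> E s) (at_right 0)" by simp
    have "eventually (\<lambda>t. E (s + of_real t * v) \<in> closure (ball 0 1 - E ` C)) (at_right 0)"
      using ev by (rule eventually_mono) (rule closure_subset[THEN subsetD])
    then show "E s \<in> closure (ball 0 1 - E ` C)"
      by (rule Lim_in_closed_set[OF closed_closure _ _ lim]) simp
  qed
  have "\<exists>\<rho>>0. ball 0 1 \<inter> ball \<zeta> \<rho> \<subseteq> E ` B"
  proof -
    define e where "e = min x0 (min (-y1) y2)"
    have e: "0 < e" using x0 y by (auto simp: e_def)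
    have "continuous (at 1) Ln" by (simp add: continuous_at_Ln)
    then obtain \<rho> where rho: "\<rho> > 0" "\<And>u. dist u 1 < \<rho> \<Longrightarrow> dist (Ln u) (Ln 1) < e"
      using e unfolding continuous_at_eps_delta by blast
    have "z \<in> E ` B" if z: "z \<in> ball 0 1 \<inter> ball \<zeta> (min \<rho> 1)" for z
    proof -
      have nz: "z \<noteq> 0" using z \<zeta> by (auto simp: dist_norm)
      have "dist (z/\<zeta>) 1 = norm ((z - \<zeta>)/\<zeta>)" using z0 by (simp add: dist_norm diff_divide_distrib)
      also have "\<dots> < \<rho>" using z \<zeta> by (simp add: norm_divide dist_norm norm_minus_commute)
      finally have L: "norm (Ln (z/\<zeta>)) < e" using rho(2) by force
      have zE: "z = E (Ln (z/\<zeta>))" using nz z0 by (simp add: E_def)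
      have "Ln (z/\<zeta>) \<in> B"
        using abs_Re_le_cmod[of "Ln (z/\<zeta>)"] abs_Im_le_cmod[of "Ln (z/\<zeta>)"] L ED[of "Ln (z/\<zeta>)"] zE z 
        unfolding Beq e_def by (auto simp: abs_le_iff)
      then show ?thesis using zE by blast
    qed
    then show ?thesis using rho(1) by (intro exI[of _ "min \<rho> 1"]) auto
  qed
  moreover have "P \<noteq> {}"
  proof -
    have "Complex (-x0) 0 \<in> P" using x0 y by (auto simp: BC(3) C_def Beq)
    then show ?thesis by blast
  qed
  moreover have "E ` C \<subseteq> ball 0 1 \<inter> ball \<zeta> r"
    using ED Er BC(2) CCR by (fastforce simp: C_def)
  then have "E ` B \<subseteq> ball 0 1 \<inter> ball \<zeta> r" "E ` P \<subseteq> ball 0 1 \<inter> ball \<zeta> r" using NC by blast+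
  ultimately show ?thesis
    using opN conN conP opM conM cN cM disj NC connected_continuous_image[OF cont conP]
    unfolding crosscut_at_def E_def[symmetric] NC by simp
qed

lemma emeasure_lborel_complex_box:
  assumes "Re l \<le> Re u" "Im l \<le> Im u"
  shows "emeasure lborel (box l u) = ennreal ((Re u - Re l) * (Im u - Im l))"
  using assms by (simp add: emeasure_lborel_box_eq Basis_complex_def)

text \<open>Logarithmic polar coordinates at \<zeta>: radii become horizontal and circular arcs
  vertical lines, as suits \<open>length_area\<close>. The half-strip has height 2 pi and is open,
  so it covers the disc except for the radius opposite to \<zeta>, and \<open>exp\<close> is
  injective on it.\<close>

lemma log_polar_map:
  assumes hol: "\<phi> holomorphic_on ball 0 1" and inj: "inj_on \<phi> (ball 0 1)" and bd: "bounded (\<phi> ` ball 0 1)"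
    and \<zeta>: "norm \<zeta> = 1"
  defines "X \<equiv> {s. Re s < 0 \<and> \<bar>Im s\<bar> < pi}"
  shows "(\<lambda>s. \<phi> (\<zeta> * exp s)) holomorphic_on X" "inj_on (\<lambda>s. \<phi> (\<zeta> * exp s)) X"
    "bounded ((\<lambda>s. \<phi> (\<zeta> * exp s)) ` X)"
proof -
  have im: "(\<lambda>s. \<zeta> * exp s) ` X \<subseteq> ball 0 1"
    by (auto simp: X_def norm_mult \<zeta>)
  have "(\<phi> \<circ> (\<lambda>s. \<zeta> * exp s)) holomorphic_on X"
    by (rule holomorphic_on_compose_gen[OF _ hol im]) (intro holomorphic_intros)
  then show "(\<lambda>s. \<phi> (\<zeta> * exp s)) holomorphic_on X" by (simp add: o_def)
  show "inj_on (\<lambda>s. \<phi> (\<zeta> * exp s)) X"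
  proof (rule inj_onI)
    fix s t assume st: "s \<in> X" "t \<in> X" "\<phi> (\<zeta> * exp s) = \<phi> (\<zeta> * exp t)"
    then have "\<zeta> * exp s = \<zeta> * exp t"
      using inj_onD[OF inj] im by blast
    then have "exp s = exp t" using \<zeta> by auto
    moreover have "\<bar>Im s - Im t\<bar> < 2 * pi" using st by (auto simp: X_def)
    ultimately show "s = t" using exp_complex_eqI by blast
  qed
  show "bounded ((\<lambda>s. \<phi> (\<zeta> * exp s)) ` X)"
    by (rule bounded_subset[OF bd]) (use im in blast)
qed

text \<open>The three sides are found one at a time as lines with short image: two radial ones, then
  the circular one. The estimate is scale invariant: in a band of width \<rho> of a region of area
  8\<rho>^2, some line has an image of size at most e as soon as the image area is below a fixed
  multiple of e^2, and that area tends to 0 with \<rho>.\<close>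

lemma short_crosscut_exists:
  assumes hol: "\<phi> holomorphic_on ball 0 1" and inj: "inj_on \<phi> (ball 0 1)" and bd: "bounded (\<phi> ` ball 0 1)"
    and \<zeta>: "norm \<zeta> = 1" and r: "0 < r" and \<epsilon>: "0 < \<epsilon>"
  obtains N c where "crosscut_at \<zeta> r N c" "\<And>z w. z \<in> c \<Longrightarrow> w \<in> c \<Longrightarrow> norm (\<phi> z - \<phi> w) \<le> \<epsilon>"
proof -
  define f where "f = (\<lambda>s. \<phi> (\<zeta> * exp s))"
  define X where "X = {s. Re s < 0 \<and> \<bar>Im s\<bar> < pi}"
  note f = log_polar_map[OF hol inj bd \<zeta>, folded f_def X_def]
  have "continuous (at 0) (\<lambda>s::complex. exp s)" by (intro continuous_intros)
  then obtain R0 where R0: "R0 > 0" "\<And>s::complex. norm s < R0 \<Longrightarrow> norm (exp s - 1) < r"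
    using r unfolding continuous_at_eps_delta by (auto simp: dist_norm)
  define R where "R = min R0 pi"
  have R: "R > 0" "R \<le> pi" "\<And>s::complex. norm s < R \<Longrightarrow> norm (exp s - 1) < r"
    using R0 by (auto simp: R_def)
  define Q where "Q = (\<lambda>\<rho>. box (Complex (-2*\<rho>) (-2*\<rho>)) (Complex 0 (2*\<rho>)))"
  have Qin: "s \<in> Q \<rho> \<longleftrightarrow> -2*\<rho> < Re s \<and> Re s < 0 \<and> \<bar>Im s\<bar> < 2*\<rho>" for s \<rho>
    by (auto simp: Q_def in_box_complex_iff)
  have QX: "Q \<rho> \<subseteq> X" if "\<rho> \<le> 1" for \<rho>
    using that pi_gt3 by (auto simp: Qin X_def)
  have "(\<lambda>n. emeasure lborel (f ` Q (1 / Suc n))) \<longlonglongrightarrow> 0"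
  proof (rule tendsto_emeasure_image_decseq[OF f])
    show "open (Q (1 / Suc n))" for n unfolding Q_def by (rule open_box)
    show "Q (1 / Suc n) \<subseteq> X" for n by (intro QX) simp
    show "decseq (\<lambda>n. Q (1 / Suc n))"
    proof (rule decseq_SucI, rule subsetI)
      fix n s assume "s \<in> Q (1 / Suc (Suc n))"
      moreover have "(1::real) / Suc (Suc n) \<le> 1 / Suc n" by (simp add: frac_le)
      ultimately show "s \<in> Q (1 / Suc n)" unfolding Qin by linarith
    qed
    show "(\<Inter>n. Q (1 / Suc n)) = {}"
    proof (rule ccontr)
      assume "\<not> ?thesis"
      then obtain s where s: "\<And>n. s \<in> Q (1 / Suc n)" by auto
      then have "Re s < 0" by (auto simp: Qin)
      then obtain n where "1 / real (Suc n) < - Re s / 2"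
        using nat_approx_posE[of "- Re s / 2"] by auto
      with s[of n] show False by (auto simp: Qin)
    qed
  qed
  moreover define e where "e = \<epsilon> / 3"
  then have e: "0 < e" using \<epsilon> by simp
  then have "0 < ennreal (e\<^sup>2 / 64)" by simp
  ultimately have "eventually (\<lambda>n. emeasure lborel (f ` Q (1 / Suc n)) < ennreal (e\<^sup>2 / 64)) sequentially"
    by (rule order_tendstoD(2))
  moreover have "eventually (\<lambda>n. 1 / real (Suc n) < R / 4) sequentially"
    by (rule order_tendstoD(2)[OF lim_1_over_n[THEN LIMSEQ_Suc]]) (use R(1) in simp)
  ultimately have "eventually (\<lambda>n. emeasure lborel (f ` Q (1 / Suc n)) < ennreal (e\<^sup>2 / 64) \<and> 1 / real (Suc n) < R / 4) sequentially"
    by (rule eventually_conj)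
  then obtain n where n: "emeasure lborel (f ` Q (1 / Suc n)) < ennreal (e\<^sup>2 / 64)" "1 / real (Suc n) < R / 4"
    using eventually_happens'[OF sequentially_bot] by blast
  define \<rho> where "\<rho> = 1 / real (Suc n)"
  have \<rho>: "0 < \<rho>" "\<rho> \<le> 1" "2 * \<rho> < R / 2" using n(2) by (auto simp: \<rho>_def)
  have n1: "emeasure lborel (f ` Q \<rho>) < ennreal (e\<^sup>2 / 64)" using n(1) by (simp add: \<rho>_def)
  \<comment> \<open>With this weight the two terms are at most \<rho>e/2 and \<rho>e/4, together
    less than the \<rho>e required.\<close>
  define a where "a = 32 * \<rho> / e"
  have a: "0 < a" using \<rho> e by (simp add: a_def)
  have small: "ennreal a * emeasure lborel (f ` Q \<rho>) + ennreal (1/a) * ennreal (8 * \<rho>\<^sup>2) < ennreal (\<rho> * e)"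
  proof -
    have "ennreal a * emeasure lborel (f ` Q \<rho>) \<le> ennreal a * ennreal (e\<^sup>2 / 64)"
      using n1 by (intro mult_left_mono) auto
    then have "ennreal a * emeasure lborel (f ` Q \<rho>) + ennreal (1/a) * ennreal (8 * \<rho>\<^sup>2)
        \<le> ennreal a * ennreal (e\<^sup>2 / 64) + ennreal (1/a) * ennreal (8 * \<rho>\<^sup>2)"
      by (rule add_right_mono)
    also have "\<dots> = ennreal (a * (e\<^sup>2 / 64) + (1/a) * (8 * \<rho>\<^sup>2))"
      by (rule ennreal_linear_combination) (use a in auto)
    also have "a * (e\<^sup>2 / 64) + (1/a) * (8 * \<rho>\<^sup>2) = 3/4 * (\<rho> * e)"
      using e \<rho>(1) by (simp add: a_def power2_eq_square field_simps)
    also have "ennreal (3/4 * (\<rho> * e)) < ennreal (\<rho> * e)"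
      using e \<rho>(1) by (intro ennreal_lessI) auto
    finally show ?thesis .
  qed
  have fQ: "f holomorphic_on Q \<rho>" "inj_on f (Q \<rho>)" "bounded (f ` Q \<rho>)" "open (Q \<rho>)"
    using f QX[OF \<rho>(2)] holomorphic_on_subset inj_on_subset bounded_subset image_mono
    by (blast, blast, metis) (simp only: Q_def open_box)
  have areaQ: "emeasure lborel (Q \<rho>) = ennreal (8 * \<rho>\<^sup>2)"
    using \<rho>(1) unfolding Q_def by (subst emeasure_lborel_complex_box) (auto simp: power2_eq_square)
  have hor: "\<exists>y\<in>{c<..<d}. \<forall>x1\<in>{-2*\<rho><..<0}. \<forall>x2\<in>{-2*\<rho><..<0}. norm (f (Complex x2 y) - f (Complex x1 y)) \<le> e"
    if "d - c = \<rho>" "-2*\<rho> \<le> c" "d \<le> 2*\<rho>" for c d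
    by (rule exists_short_line[where Z = "Q \<rho>" and a = a])
       (use that \<rho> e a small fQ areaQ in \<open>auto simp: Qin is_interval_oo\<close>)
  obtain y1 where y1: "y1 \<in> {-2*\<rho><..<-\<rho>}" 
      "\<And>x1 x2. x1 \<in> {-2*\<rho><..<0} \<Longrightarrow> x2 \<in> {-2*\<rho><..<0} \<Longrightarrow> norm (f (Complex x2 y1) - f (Complex x1 y1)) \<le> e"
    using hor[of "-\<rho>" "-2*\<rho>"] \<rho>(1) by auto
  obtain y2 where y2: "y2 \<in> {\<rho><..<2*\<rho>}" 
      "\<And>x1 x2. x1 \<in> {-2*\<rho><..<0} \<Longrightarrow> x2 \<in> {-2*\<rho><..<0} \<Longrightarrow> norm (f (Complex x2 y2) - f (Complex x1 y2)) \<le> e"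
    using hor[of "2*\<rho>" \<rho>] \<rho>(1) by auto
  \<comment> \<open>A quarter turn makes the vertical lines of \<open>Q \<rho>\<close> horizontal,
    so that the same lemma yields the circular side.\<close>
  have "\<exists>y\<in>{\<rho><..<2*\<rho>}. \<forall>x1\<in>{-2*\<rho><..<2*\<rho>}. \<forall>x2\<in>{-2*\<rho><..<2*\<rho>}.
     norm (f (\<i> * Complex x2 y) - f (\<i> * Complex x1 y)) \<le> e"
  proof -
    define Q' where "Q' = box (Complex (-2*\<rho>) 0) (Complex (2*\<rho>) (2*\<rho>))"
    have iQ: "s \<in> Q' \<longleftrightarrow> \<i> * s \<in> Q \<rho>" for s
      by (auto simp: Q'_def Qin in_box_complex_iff)
    have img: "(\<lambda>s. f (\<i> * s)) ` Q' = f ` Q \<rho>"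
    proof -
      have "t \<in> (\<lambda>s. \<i> * s) ` Q'" if "t \<in> Q \<rho>" for t
        using that by (intro image_eqI[of _ _ "-\<i> * t"]) (auto simp: iQ)
      then show ?thesis using iQ by fastforce
    qed
    have "(f \<circ> (\<lambda>s. \<i> * s)) holomorphic_on Q'"
      by (rule holomorphic_on_compose_gen[OF _ fQ(1)]) (auto simp: iQ intro!: holomorphic_intros)
    then have h: "(\<lambda>s. f (\<i> * s)) holomorphic_on Q'" by (simp add: o_def)
    have i: "inj_on (\<lambda>s. f (\<i> * s)) Q'"
    proof (rule inj_onI)
      fix s t assume "s \<in> Q'" "t \<in> Q'" "f (\<i> * s) = f (\<i> * t)"
      then have "\<i> * s = \<i> * t" using inj_onD[OF fQ(2)] iQ by blast
      then show "s = t" by simp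
    qed
    have areaQ': "emeasure lborel Q' = ennreal (8 * \<rho>\<^sup>2)"
      using \<rho>(1) unfolding Q'_def by (subst emeasure_lborel_complex_box) (auto simp: power2_eq_square)
    have o: "open Q'" unfolding Q'_def by (rule open_box)
    show ?thesis
      by (rule exists_short_line[where Z = Q' and a = a and f = "\<lambda>s. f (\<i> * s)"])
         (use h i o \<rho> e a small fQ(3) areaQ' img in \<open>auto simp: iQ Qin is_interval_oo\<close>)
  qed
  then obtain x0 where x0: "x0 \<in> {\<rho><..<2*\<rho>}"
     "\<And>t1 t2. t1 \<in> {-2*\<rho><..<2*\<rho>} \<Longrightarrow> t2 \<in> {-2*\<rho><..<2*\<rho>} \<Longrightarrow> norm (f (\<i> * Complex t2 x0) - f (\<i> * Complex t1 x0)) \<le> e"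
    by blast
  have iC: "\<i> * Complex t x0 = Complex (-x0) t" for t by (simp add: complex_eq_iff)
  define B where "B = box (Complex (-x0) y1) (Complex 0 y2)"
  define P where "P = {s. -x0 \<le> Re s \<and> Re s < 0 \<and> y1 \<le> Im s \<and> Im s \<le> y2} - B"
  have cc: "crosscut_at \<zeta> r ((\<lambda>s. \<zeta> * exp s) ` B) ((\<lambda>s. \<zeta> * exp s) ` P)"
    unfolding B_def P_def
    by (rule crosscut_at_polar_rectangle[OF \<zeta> _ _ _ R(2,3)]) (use x0 y1 y2 \<rho> in auto)
  \<comment> \<open>The circular side is the hub: each point of \<open>P\<close> reaches it within
    its own side, so two points are joined by three moves of size \<open>e\<close>. Hence
    \<open>e\<close> is a third of \<epsilon>.\<close>
  have near: "\<exists>t\<in>{y1..y2}. norm (f s - f (Complex (-x0) t)) \<le> e" if s: "s \<in> P" for s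
  proof -
    have s1: "-x0 \<le> Re s" "Re s < 0" "y1 \<le> Im s" "Im s \<le> y2" 
      using s by (auto simp: P_def)
    have cs: "s = Complex (Re s) (Im s)" by simp
    consider "Re s = -x0" | "Im s = y1" | "Im s = y2"
      using s by (force simp: P_def B_def in_box_complex_iff)
    then show ?thesis
    proof cases
      case 1 
      then have "s = Complex (-x0) (Im s)" by (simp add: complex_eq_iff)
      then have "norm (f s - f (Complex (-x0) (Im s))) \<le> e" using e by simp
      then show ?thesis using s1 by auto
    next
      case 2 
      then have "s = Complex (Re s) y1" by (simp add: complex_eq_iff)
      then have "norm (f s - f (Complex (-x0) y1)) \<le> e" using y1(2)[of "-x0" "Re s"] s1 x0(1) \<rho>(1) by auto
      then show ?thesis using s1 by auto
    next
      case 3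
      then have "s = Complex (Re s) y2" by (simp add: complex_eq_iff)
      then have "norm (f s - f (Complex (-x0) y2)) \<le> e" using y2(2)[of "-x0" "Re s"] s1 x0(1) \<rho>(1) by auto
      then show ?thesis using s1 by auto
    qed
  qed
  have "norm (f s - f s') \<le> \<epsilon>" if ss: "s \<in> P" "s' \<in> P" for s s'
  proof -
    obtain t t' where t: "t \<in> {y1..y2}" "t' \<in> {y1..y2}"
       "norm (f s - f (Complex (-x0) t)) \<le> e" "norm (f s' - f (Complex (-x0) t')) \<le> e"
      using near ss by blast
    have "norm (f (Complex (-x0) t) - f (Complex (-x0) t')) \<le> e"
      using x0(2)[of t' t] t(1,2) y1(1) y2(1) unfolding iC by auto
    then have "dist (f s) (f s') \<le> 3 * e"
      using t(3,4) dist_triangle[of "f s" "f s'" "f (Complex (-x0) t)"] 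
        dist_triangle[of "f (Complex (-x0) t)" "f s'" "f (Complex (-x0) t')"]
      by (simp add: dist_norm norm_minus_commute)
    then show ?thesis by (simp add: e_def dist_norm)
  qed
  then show ?thesis using that[OF cc] by (auto simp: f_def)
qed

section \<open>Extension to the circle\<close>

text \<open>\<open>x1\<close> is the last parameter with \<open>u\<close> at least \<open>H\<close>,
  and \<open>x2\<close> the first one after it with \<open>u\<close> at most \<open>L\<close>; in
  between \<open>u\<close> is confined to the band.\<close>

lemma downcrossing_interval:
  fixes u :: "real \<Rightarrow> real"
  assumes cont: "continuous_on {a..b} u" and ab: "a \<le> b" and "L < H" "H \<le> u a" "u b \<le> L"
  obtains x1 x2 where "a \<le> x1" "x1 \<le> x2" "x2 \<le> b" "u x1 = H" "u x2 = L" "\<And>x. x \<in> {x1..x2} \<Longrightarrow> u x \<in> {L..H}"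
proof -
  define S1 where "S1 = {x \<in> {a..b}. H \<le> u x}"
  have "closed S1" unfolding S1_def
    by (intro continuous_closed_preimage_constant closed_Collect_le continuous_on_closed_Collect_le cont continuous_on_const) auto
  then have "compact S1" unfolding S1_def
    by (metis (no_types, lifting) bounded_closed_interval bounded_subset compact_eq_bounded_closed mem_Collect_eq subsetI)
  moreover have "a \<in> S1" using assms by (auto simp: S1_def)
  ultimately obtain x1 where x1: "x1 \<in> S1" "\<And>x. x \<in> S1 \<Longrightarrow> x \<le> x1"
    using compact_attains_sup[of S1] by blast
  have x1': "a \<le> x1" "x1 \<le> b" "H \<le> u x1" using x1 by (auto simp: S1_def)
  define S2 where "S2 = {x \<in> {x1..b}. u x \<le> L}"
  have cont1: "continuous_on {x1..b} u" using cont x1' by (auto intro: continuous_on_subset)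
  have "closed S2" unfolding S2_def
    by (intro continuous_on_closed_Collect_le cont1 continuous_on_const) auto
  then have "compact S2" unfolding S2_def
    by (metis (no_types, lifting) bounded_closed_interval bounded_subset compact_eq_bounded_closed mem_Collect_eq subsetI)
  moreover have "b \<in> S2" using assms x1' by (auto simp: S2_def)
  ultimately obtain x2 where x2: "x2 \<in> S2" "\<And>x. x \<in> S2 \<Longrightarrow> x2 \<le> x"
    using compact_attains_inf[of S2] by blast
  have x2': "x1 \<le> x2" "x2 \<le> b" "u x2 \<le> L" using x2 by (auto simp: S2_def)
  have cont2: "continuous_on {x1..x2} u" using cont1 x2' by (auto intro: continuous_on_subset)
  have "\<exists>x\<ge>x1. x \<le> x2 \<and> u x = H" 
    by (rule IVT2') (use x1' x2' assms(3) cont2 in auto)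
  then obtain t where "x1 \<le> t" "t \<le> x2" "u t = H" by blast
  then have uH: "u x1 = H" using x1(2)[of t] x1' x2' by (auto simp: S1_def)
  have "\<exists>x\<ge>x1. x \<le> x2 \<and> u x = L" 
    by (rule IVT2') (use x1' x2' assms(3) cont2 in auto)
  then obtain t where "x1 \<le> t" "t \<le> x2" "u t = L" by blast
  then have uL: "u x2 = L" using x2(2)[of t] x2' by (auto simp: S2_def)
  show ?thesis
  proof (rule that[OF x1'(1) x2'(1,2) uH uL])
    fix x assume x: "x \<in> {x1..x2}"
    have "u x \<le> H"
      using x1(2)[of x] x x1' x2' uH by (cases "u x \<le> H") (auto simp: S1_def)
    moreover have "L \<le> u x"
      using x2(2)[of x] x x1' x2' uL by (cases "L \<le> u x") (auto simp: S2_def)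
    ultimately show "u x \<in> {L..H}" by simp
  qed
qed

lemma exists_small_measure_disjoint:
  assumes A: "\<And>j. j < J \<Longrightarrow> A j \<in> sets M" and disj: "disjoint_family_on A {..<J}"
    and X: "X \<in> sets M" "\<And>j. j < J \<Longrightarrow> A j \<subseteq> X" and e: "emeasure M X < ennreal (real J * q)" and q: "0 \<le> q"
  shows "\<exists>j<J. emeasure M (A j) < ennreal q"
proof (rule ccontr)
  assume "\<not> ?thesis"
  then have "(\<Sum>j<J. ennreal q) \<le> (\<Sum>j<J. emeasure M (A j))"
    by (intro sum_mono) (metis lessThan_iff not_less)
  also have "\<dots> = emeasure M (\<Union>j<J. A j)"
    using A disj by (intro sum_emeasure) auto
  also have "\<dots> \<le> emeasure M X"
    using X by (intro emeasure_mono) auto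
  finally have "ennreal (real J * q) \<le> emeasure M X"
    using q by (simp add: ennreal_mult ennreal_of_nat_eq_real_of_nat)
  then show False using e by simp
qed

text \<open>If all radii with angle in an interval of length \<open>\<delta>\<close> lead from points whose image has distance
  at least \<open>d\<close> from \<open>p\<close> to points with image within \<open>\<epsilon>\<close> of \<open>p\<close>, then their images cross about
  \<open>ln (d/\<epsilon>)\<close> concentric dyadic annuli around \<open>p\<close>. One of these annuli has a preimage of small area,
  and for it the length-area inequality fails.\<close>

lemma radial_crossings_bound:
  assumes hol: "\<phi> holomorphic_on ball 0 1" and inj: "inj_on \<phi> (ball 0 1)" and bd: "bounded (\<phi> ` ball 0 1)"
    and \<delta>: "0 < \<delta>" and d: "0 < d"
  obtains \<epsilon> where "0 < \<epsilon>" "\<And>p v c c'. norm v = 1 \<Longrightarrow> -pi \<le> c \<Longrightarrow> c' \<le> pi \<Longrightarrow> \<delta> \<le> c' - c \<Longrightarrow>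
      (\<And>z. norm z \<le> 1/2 \<Longrightarrow> d \<le> norm (\<phi> z - p)) \<Longrightarrow>
      (\<And>y. y \<in> {c<..<c'} \<Longrightarrow> \<exists>x. - ln 2 < x \<and> x < 0 \<and> norm (\<phi> (v * exp (Complex x y)) - p) \<le> \<epsilon>) \<Longrightarrow> False"
proof -
  \<comment> \<open>Chosen so that with \<open>a = \<delta> / (64 * R)\<close> the two terms of
    \<open>length_area\<close> are \<delta>R/16 and \<delta>R/8, together less than the \<delta>R/4
    forced by the crossings.\<close>
  define q where "q = \<delta>\<^sup>2 / 512"
  have q: "0 < q" using \<delta> by (simp add: q_def)
  \<comment> \<open>2 pi is the area of the rectangle \<open>Y\<close> containing the preimages of
    all annuli, so one of \<open>J\<close> disjoint preimages has area below \<open>q\<close>. The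
    choice of \<epsilon> then makes the radii cross all \<open>J\<close> annuli.\<close>
  obtain J :: nat where J: "2 * pi / q < real J" using reals_Archimedean2 by blast
  define \<epsilon> where "\<epsilon> = d / 2 ^ J"
  have \<epsilon>: "0 < \<epsilon>" using d by (simp add: \<epsilon>_def)
  show ?thesis
  proof (rule that[OF \<epsilon>])
    fix p v :: complex and c c' :: real
    assume v: "norm v = 1" and cc: "-pi \<le> c" "c' \<le> pi" "\<delta> \<le> c' - c"
      and far: "\<And>z. norm z \<le> 1/2 \<Longrightarrow> d \<le> norm (\<phi> z - p)"
      and near: "\<And>y. y \<in> {c<..<c'} \<Longrightarrow> \<exists>x. - ln 2 < x \<and> x < 0 \<and> norm (\<phi> (v * exp (Complex x y)) - p) \<le> \<epsilon>"
    define f where "f = (\<lambda>s. \<phi> (v * exp s))"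
    define X where "X = {s. Re s < 0 \<and> \<bar>Im s\<bar> < pi}"
    note f = log_polar_map[OF hol inj bd v, folded f_def X_def]
    define Y where "Y = box (Complex (-1) (-pi)) (Complex 0 pi)"
    have Yin: "s \<in> Y \<longleftrightarrow> -1 < Re s \<and> Re s < 0 \<and> \<bar>Im s\<bar> < pi" for s
      by (auto simp: Y_def in_box_complex_iff)
    have YX: "Y \<subseteq> X" by (auto simp: Yin X_def)
    have oY: "open Y" unfolding Y_def by (rule open_box)
    define r where "r = (\<lambda>j. d / 2 ^ j)"
    have r: "0 < r j" for j using d by (simp add: r_def)
    define Z where "Z = (\<lambda>j. Y \<inter> f -` {w. r j / 2 < dist p w \<and> dist p w < r j})"
    have oZ: "open (Z j)" for j
      unfolding Z_def
      by (rule continuous_open_preimage[OF holomorphic_on_imp_continuous_on[OF holomorphic_on_subset[OF f(1) YX]] oY])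
         (intro open_Collect_conj open_Collect_less continuous_intros)
    have ZX: "Z j \<subseteq> X" "Z j \<subseteq> Y" for j using YX by (auto simp: Z_def)
    have "\<exists>j<J. emeasure lborel (Z j) < ennreal q"
    proof (rule exists_small_measure_disjoint)
      show "Z j \<in> sets lborel" for j using oZ by simp
      show "disjoint_family_on Z {..<J}"
      proof -
        have "Z i \<inter> Z j = {}" if "i < j" for i j
        proof -
          have "r j \<le> r (Suc i)" using that d power_increasing[of "Suc i" j "2::real"]
            by (auto simp: r_def intro!: divide_left_mono)
          then have "r j \<le> r i / 2" by (simp add: r_def)
          then show ?thesis by (auto simp: Z_def)
        qed
        then show ?thesis unfolding disjoint_family_on_def by (metis inf_commute linorder_neqE_nat)
      qed
      show "Y \<in> sets lborel" using oY by simp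
      show "Z j \<subseteq> Y" for j by (rule ZX)
      have "emeasure lborel Y = ennreal (2 * pi)"
        unfolding Y_def by (subst emeasure_lborel_complex_box) auto
      also have "\<dots> < ennreal (real J * q)"
        using J q by (intro ennreal_lessI) (auto simp: field_simps intro: less_trans[of 0 "2*pi"])
      finally show "emeasure lborel Y < ennreal (real J * q)" .
    qed (use q in simp)
    then obtain j where j: "j < J" "emeasure lborel (Z j) < ennreal q" by blast
    define R where "R = r j"
    have R: "0 < R" using r by (simp add: R_def)
    have e_le: "\<epsilon> \<le> R / 2" 
    proof -
      have "(2::real) ^ Suc j \<le> 2 ^ J" using j(1) by (intro power_increasing) auto
      then have "d / 2 ^ J \<le> d / 2 ^ Suc j" using d by (intro divide_left_mono) auto
      then show ?thesis by (simp add: \<epsilon>_def R_def r_def)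
    qed
    have R_le: "R \<le> d" using d by (simp add: R_def r_def divide_le_eq)
    \<comment> \<open>The levels 7/8 and 5/8 of \<open>R\<close> lie strictly inside the annulus
      from R/2 to R, so the closed piece between them stays in the open set \<open>Z j\<close>,
      while its ends still have images R/4 apart. The start Re s = -ln 2 is the circle of radius
      1/2.\<close>
    have seg: "\<exists>x1 x2. x1 \<le> x2 \<and> (\<forall>x\<in>{x1..x2}. Complex x y \<in> Z j)
                 \<and> R/4 \<le> norm (f (Complex x2 y) - f (Complex x1 y))" if y: "y \<in> {c<..<c'}" for y
    proof -
      obtain x where x: "- ln 2 < x" "x < 0" "norm (\<phi> (v * exp (Complex x y)) - p) \<le> \<epsilon>"
        using near[OF y] by blast
      have inY: "Complex t y \<in> Y" if "t \<in> {-ln 2..x}" for t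
        using that x cc y ln_2_less_1 by (auto simp: Yin)
      define u where "u = (\<lambda>t. dist p (f (Complex t y)))"
      have cont: "continuous_on {-ln 2..x} u"
        unfolding u_def
        by (intro continuous_intros continuous_on_compose2[OF holomorphic_on_imp_continuous_on[OF f(1)], of _ "\<lambda>t. Complex t y"])
           (use inY YX in \<open>auto simp: Complex_eq intro!: continuous_intros\<close>)
      have "norm (v * exp (Complex (-ln 2) y)) = 1/2" 
        by (simp add: norm_mult v exp_minus)
      then have "d \<le> u (-ln 2)" using far[of "v * exp (Complex (-ln 2) y)"] 
        by (simp add: u_def f_def dist_norm norm_minus_commute)
      then have 1: "7/8 * R \<le> u (-ln 2)" using R_le R by simp
      have 2: "u x \<le> 5/8 * R" using x(3) e_le R 
        by (simp add: u_def f_def dist_norm norm_minus_commute)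
      obtain x1 x2 where xx: "- ln 2 \<le> x1" "x1 \<le> x2" "x2 \<le> x" "u x1 = 7/8*R" "u x2 = 5/8*R"
           "\<And>t. t \<in> {x1..x2} \<Longrightarrow> u t \<in> {5/8*R..7/8*R}"
        using downcrossing_interval[OF cont _ _ 1 2] x R by auto
      have "Complex t y \<in> Z j" if "t \<in> {x1..x2}" for t
        using xx(6)[OF that] inY[of t] that xx(1,3) R unfolding Z_def u_def R_def[symmetric] by auto
      moreover have "u x1 \<le> u x2 + norm (f (Complex x2 y) - f (Complex x1 y))"
        unfolding u_def by (metis dist_norm dist_triangle)
      ultimately show ?thesis using xx(2,4,5) R by (intro exI[of _ x1] exI[of _ x2]) auto
    qed
    define a where "a = \<delta> / (64 * R)"
    have a: "0 < a" using \<delta> R by (simp add: a_def)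
    have fZ: "f holomorphic_on Z j" "inj_on f (Z j)" "bounded (f ` Z j)"
      using holomorphic_on_subset[OF f(1) ZX(1)] inj_on_subset[OF f(2) ZX(1)]
        bounded_subset[OF f(3) image_mono[OF ZX(1)]] by blast+
    have "ennreal ((c' - c) * (R/4)) \<le> ennreal a * emeasure lborel (f ` Z j) + ennreal (1/a) * emeasure lborel (Z j)"
      by (rule length_area[OF fZ(1) oZ fZ(2,3) _ _ a seg]) (use cc \<delta> R in auto)
    also have "\<dots> \<le> ennreal a * ennreal (4 * R\<^sup>2) + ennreal (1/a) * ennreal q"
    proof (intro add_mono mult_left_mono)
      have "f ` Z j \<subseteq> ball p R" by (auto simp: Z_def R_def)
      also have "\<dots> \<subseteq> box (p - Complex R R) (p + Complex R R)"
      proof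
        fix w assume "w \<in> ball p R"
        then have "norm (w - p) < R" by (simp add: dist_norm norm_minus_commute)
        then have "\<bar>Re (w - p)\<bar> < R" "\<bar>Im (w - p)\<bar> < R"
          using abs_Re_le_cmod abs_Im_le_cmod le_less_trans by blast+
        then show "w \<in> box (p - Complex R R) (p + Complex R R)" by (auto simp: in_box_complex_iff abs_less_iff)
      qed
      finally have "emeasure lborel (f ` Z j) \<le> emeasure lborel (box (p - Complex R R) (p + Complex R R))"
        by (intro emeasure_mono) auto
      also have "\<dots> = ennreal (4 * R\<^sup>2)"
        using R by (subst emeasure_lborel_complex_box) (auto simp: power2_eq_square)
      finally show "emeasure lborel (f ` Z j) \<le> ennreal (4 * R\<^sup>2)" .
    qed (use j in auto)
    also have "\<dots> = ennreal (a * (4 * R\<^sup>2) + (1/a) * q)"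
      by (rule ennreal_linear_combination) (use a q in auto)
    also have "a * (4 * R\<^sup>2) + (1/a) * q = 3/16 * (\<delta> * R)"
      using \<delta> R by (simp add: a_def q_def power2_eq_square field_simps)
    finally have "(c' - c) * (R/4) \<le> 3/16 * (\<delta> * R)"
      using \<delta> R by (subst (asm) ennreal_le_iff) auto
    moreover have "\<delta> * (R/4) \<le> (c' - c) * (R/4)" using cc(3) R by (intro mult_right_mono) auto
    ultimately show False using mult_pos_pos[OF \<delta> R] by linarith
  qed
qed

lemma norm_cis_diff_le: "norm (cis a - cis b) \<le> \<bar>a - b\<bar>"
proof -
  have "cis a - cis b = cis b * (cis (a - b) - 1)"
    by (simp add: right_diff_distrib cis_mult)
  then have "norm (cis a - cis b) = norm (exp (\<i> * of_real (a - b)) - 1)"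
    by (simp add: norm_mult cis_conv_exp)
  also have "\<dots> = 2 * \<bar>sin ((a - b) / 2)\<bar>" by (rule dist_exp_i_1)
  also have "\<dots> \<le> \<bar>a - b\<bar>" using abs_sin_x_le_abs_x[of "(a - b) / 2"] by simp
  finally show ?thesis .
qed

text \<open>If the set swept an angle \<delta>, every radius in that sector would meet it, which
  \<open>radial_crossings_bound\<close> excludes. It matters that \<epsilon> does not depend on
  \<open>p\<close>.\<close>

lemma small_image_small_angle:
  assumes hol: "\<phi> holomorphic_on ball 0 1" and inj: "inj_on \<phi> (ball 0 1)" and bd: "bounded (\<phi> ` ball 0 1)"
    and \<delta>: "0 < \<delta>" and d: "0 < d"
  obtains \<epsilon> where "0 < \<epsilon>" "\<And>S p z w. connected S \<Longrightarrow> S \<subseteq> ball 0 1 - cball 0 (1/2) \<Longrightarrow> (\<And>z. z \<in> S \<Longrightarrow> norm (\<phi> z - p) \<le> \<epsilon>)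
     \<Longrightarrow> (\<And>z. norm z \<le> 1/2 \<Longrightarrow> d \<le> norm (\<phi> z - p)) \<Longrightarrow> z \<in> S \<Longrightarrow> w \<in> S \<Longrightarrow> norm (sgn z - sgn w) \<le> \<delta>"
proof -
  \<comment> \<open>The cap 1 makes the angles from 0 to 1 a long enough interval for the case in
    which \<open>S\<close> meets every direction.\<close>
  define \<delta>' where "\<delta>' = min \<delta> 1"
  have \<delta>': "0 < \<delta>'" "\<delta>' \<le> \<delta>" "\<delta>' \<le> 1" using \<delta> by (auto simp: \<delta>'_def)
  obtain \<epsilon> where \<epsilon>: "0 < \<epsilon>" "\<And>p v c c'. norm v = 1 \<Longrightarrow> -pi \<le> c \<Longrightarrow> c' \<le> pi \<Longrightarrow> \<delta>' \<le> c' - c \<Longrightarrow>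
      (\<And>z. norm z \<le> 1/2 \<Longrightarrow> d \<le> norm (\<phi> z - p)) \<Longrightarrow>
      (\<And>y. y \<in> {c<..<c'} \<Longrightarrow> \<exists>x. - ln 2 < x \<and> x < 0 \<and> norm (\<phi> (v * exp (Complex x y)) - p) \<le> \<epsilon>) \<Longrightarrow> False"
    by (rule radial_crossings_bound[OF hol inj bd \<delta>'(1) d]) blast
  show ?thesis
  proof (rule that[OF \<epsilon>(1)], rule ccontr)
    fix S p z0 w0
    assume S: "connected S" "S \<subseteq> ball 0 1 - cball 0 (1/2)" and near: "\<And>z. z \<in> S \<Longrightarrow> norm (\<phi> z - p) \<le> \<epsilon>"
      and far: "\<And>z. norm z \<le> 1/2 \<Longrightarrow> d \<le> norm (\<phi> z - p)" and zw: "z0 \<in> S" "w0 \<in> S" and bad: "\<not> norm (sgn z0 - sgn w0) \<le> \<delta>"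
    have lnS: "- ln 2 < ln (norm z)" "ln (norm z) < 0" "z \<noteq> 0" if "z \<in> S" for z
    proof -
      have z: "1/2 < norm z" "norm z < 1" using S(2) that by auto
      then have "ln (1/2) < ln (norm z)" by (subst ln_less_cancel_iff) auto
      then show "- ln 2 < ln (norm z)" by (simp add: ln_div)
      show nz: "z \<noteq> 0" using z by auto
      show "ln (norm z) < 0" using z nz by simp
    qed
    show False
    proof (cases "\<exists>u. norm u = 1 \<and> (\<forall>z\<in>S. sgn z \<noteq> u)")
      case True
      then obtain u where u: "norm u = 1" "\<And>z. z \<in> S \<Longrightarrow> sgn z \<noteq> u" by blast
      define v where "v = -u"
      have v: "norm v = 1" "v \<noteq> 0" using u(1) by (auto simp: v_def)
      define L where "L = (\<lambda>z. Ln (z / v))"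
      have slit: "z / v \<notin> \<real>\<^sub>\<le>\<^sub>0" if "z \<in> S" for z
      proof
        assume "z / v \<in> \<real>\<^sub>\<le>\<^sub>0"
        then obtain t where t: "t \<le> 0" "z / v = of_real t" by (auto elim: nonpos_Reals_cases)
        then have "z = of_real t * v" using v(2) by (simp add: field_simps)
        then have zt: "z = of_real (-t) * u" by (simp add: v_def)
        have "t \<noteq> 0" using zt lnS(3)[OF that] by auto
        then have "sgn (-t) = 1" using t(1) by simp
        moreover have "sgn u = u" using u(1) by (simp add: sgn_div_norm)
        moreover have "z = (-t) *\<^sub>R u" using zt by (simp add: scaleR_conv_of_real)
        ultimately have "sgn z = u" by (metis scaleR_one sgn_scaleR)
        then show False using u(2)[OF that] by simp
      qed
      have zE: "z = v * exp (L z)" if "z \<in> S" for z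
        using lnS(3)[OF that] v by (simp add: L_def)
      have ReL: "Re (L z) = ln (norm z)" if "z \<in> S" for z
        using lnS(3)[OF that] v by (simp add: L_def norm_divide)
      have ImL: "-pi < Im (L z)" "Im (L z) \<le> pi" if "z \<in> S" for z
        using lnS(3)[OF that] v by (simp_all add: L_def mpi_less_Im_Ln Im_Ln_le_pi)
      define T where "T = (\<lambda>z. Im (L z)) ` S"
      have "continuous_on S (\<lambda>z. Im (L z))"
        unfolding L_def using slit v by (intro continuous_intros) auto
      then have T: "connected T" unfolding T_def using S(1) connected_continuous_image by blast
      define c where "c = min (Im (L z0)) (Im (L w0))"
      define c' where "c' = max (Im (L z0)) (Im (L w0))"
      have cT: "c \<in> T" "c' \<in> T" using zw by (auto simp: c_def c'_def T_def min_def max_def)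
      have sgnE: "sgn z = v * cis (Im (L z))" if "z \<in> S" for z
      proof -
        have "z = v * (of_real (norm z) * cis (Im (L z)))"
          using zE[OF that] lnS(3)[OF that] by (metis ReL exp_eq_polar exp_ln norm_exp_eq_Re norm_mult v(1) mult_1 that)
        then have "sgn z * of_real (norm z) = v * cis (Im (L z)) * of_real (norm z)"
          by (simp add: sgn_div_norm scaleR_conv_of_real field_simps lnS(3)[OF that])
        then show ?thesis using lnS(3)[OF that] by simp
      qed
      have "norm (sgn z0 - sgn w0) = norm (cis (Im (L z0)) - cis (Im (L w0)))"
        using sgnE zw v(1) by (simp add: norm_mult flip: right_diff_distrib)
      also have "\<dots> \<le> \<bar>Im (L z0) - Im (L w0)\<bar>"
        by (rule norm_cis_diff_le)
      finally have "\<delta>' \<le> c' - c" using bad \<delta>'(2) by (auto simp: c_def c'_def)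
      moreover have "\<exists>x. - ln 2 < x \<and> x < 0 \<and> norm (\<phi> (v * exp (Complex x y)) - p) \<le> \<epsilon>" if y: "y \<in> {c<..<c'}" for y
      proof -
        have "y \<in> T" using connectedD_interval[OF T cT] y by auto
        then obtain z where z: "z \<in> S" "y = Im (L z)" by (auto simp: T_def)
        then have "Complex (Re (L z)) y = L z" by simp
        then show ?thesis using z near[OF z(1)] zE[OF z(1)] lnS[OF z(1)] ReL[OF z(1)] by metis
      qed
      ultimately show False
        using \<epsilon>(2)[OF v(1) _ _ _ far, of c c'] cT ImL by (force simp: T_def)
    next
      case False
      have "\<exists>x. - ln 2 < x \<and> x < 0 \<and> norm (\<phi> (1 * exp (Complex x y)) - p) \<le> \<epsilon>" for y
      proof -
        obtain z where z: "z \<in> S" "sgn z = cis y" using False by (metis norm_cis)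
        have "z = of_real (norm z) * cis y"
          using z lnS(3)[OF z(1)] by (metis mult.commute scaleR_conv_of_real sgn_div_norm scaleR_scaleR right_inverse norm_eq_zero scaleR_one)
        then have "z = exp (Complex (ln (norm z)) y)" 
          using lnS(3)[OF z(1)] by (simp add: exp_eq_polar exp_of_real flip: of_real_exp)
        then show ?thesis using near[OF z(1)] lnS[OF z(1)] by (metis mult_1)
      qed
      then show False
        using \<epsilon>(2)[of 1 0 1 p] far \<delta>'(3) pi_gt3 by auto
    qed
  qed
qed

section \<open>Oscillation of the conjugated maps near the circle\<close>

lemma connected_ball_minus_polar_rectangle:
  fixes u :: complex
  assumes "0 \<le> t0"
  shows "connected (ball 0 1 - {z. t0 < norm z \<and> norm (sgn z - u) \<le> \<delta>})"
proof (rule starlike_imp_connected)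
  let ?\<Omega> = "{z. t0 < norm z \<and> norm (sgn z - u) \<le> \<delta>}"
  have "closed_segment 0 z \<subseteq> ball 0 1 - ?\<Omega>" if z: "z \<in> ball 0 1 - ?\<Omega>" for z
  proof
    fix w assume "w \<in> closed_segment 0 z"
    then obtain t where t: "0 \<le> t" "t \<le> 1" "w = t *\<^sub>R z"
      by (auto simp: closed_segment_def)
    have nw: "norm w \<le> norm z"
      using t mult_left_le_one_le[of "norm z" t] by simp
    have "sgn w = sgn z" if "t \<noteq> 0" using that t by (simp add: sgn_scaleR)
    then show "w \<in> ball 0 1 - ?\<Omega>"
      using z nw t(3) assms by (cases "t = 0") auto
  qed
  moreover have "0 \<in> ball 0 1 - ?\<Omega>" using assms by simp
  ultimately show "starlike (ball 0 1 - ?\<Omega>)" unfolding starlike_def by blast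
qed

lemma open_image_homeomorphism:
  assumes h: "homeomorphism S T h h'" and T: "open T" and A: "open A" "A \<subseteq> S"
  shows "open (h ` A)"
proof -
  have inv: "h z \<in> T" "h' (h z) = z" if "z \<in> S" for z
    using h that by (auto simp: homeomorphism_def)
  have "h ` A = T \<inter> h' -` A"
  proof (intro equalityI subsetI)
    fix z assume "z \<in> h ` A" then show "z \<in> T \<inter> h' -` A" using A(2) inv by auto
  next
    fix z assume z: "z \<in> T \<inter> h' -` A"
    then have "z = h (h' z)" using h by (simp add: homeomorphism_def)
    then show "z \<in> h ` A" using z by blast
  qed
  moreover have "continuous_on T h'" using h by (simp add: homeomorphism_def)
  ultimately show ?thesis using continuous_open_preimage[OF _ T A(1)] by simp
qed

text \<open>A crosscut \<open>c\<close> near \<zeta> can be taken with so short an image under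
  \<phi> that, by uniform continuity of \<open>g\<close>, the image of h(c) is short as well. Then
  h(c) lies in a small polar rectangle \<Omega>, and the side \<open>N\<close> of \<open>c\<close>
  is dragged into \<Omega> along with it.\<close>

lemma conformal_conjugate_small_oscillation:
  assumes hol: "\<phi> holomorphic_on ball 0 1" and inj: "inj_on \<phi> (ball 0 1)" and bd: "bounded (\<phi> ` ball 0 1)"
    and h: "homeomorphism (ball 0 1) (ball 0 1) h h'"
    and uc: "uniformly_continuous_on (\<phi> ` ball 0 1) g"
    and conj: "\<And>z. z \<in> ball 0 1 \<Longrightarrow> \<phi> (h z) = g (\<phi> z)"
    and \<zeta>: "norm \<zeta> = 1" and \<eta>: "0 < \<eta>"
  shows "\<exists>\<rho>>0. \<forall>z\<in>ball 0 1 \<inter> ball \<zeta> \<rho>. \<forall>w\<in>ball 0 1 \<inter> ball \<zeta> \<rho>. dist (h z) (h w) < \<eta>"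
proof -
  \<comment> \<open>Points of \<Omega> in the disc are within 2\<delta> of \<open>u\<close>, so two
    of them differ by at most 4\<delta> < \<eta>. The bound 1/4 keeps h(c) outside the disc of
    radius 3/4.\<close>
  define \<delta> where "\<delta> = min (\<eta>/8) (1/4)"
  have \<delta>: "0 < \<delta>" "\<delta> \<le> 1/4" "8 * \<delta> \<le> \<eta>" using \<eta> by (auto simp: \<delta>_def)
  have hD: "h z \<in> ball 0 1" "h' z \<in> ball 0 1" "h' (h z) = z" "h (h' z) = z" if "z \<in> ball 0 1" for z
    using h that by (auto simp: homeomorphism_def)
  have conth: "continuous_on (ball 0 1) h" "continuous_on (ball 0 1) h'"
    using h by (auto simp: homeomorphism_def)
  \<comment> \<open>A distance fixed before the crosscut is chosen; later \<phi>(h z0), with h z0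
    outside the disc of radius 3/4, serves as the point \<open>p\<close>.\<close>
  obtain d where d: "0 < d" "\<And>z p. norm z \<le> 1/2 \<Longrightarrow> p \<notin> \<phi> ` ball 0 (3/4) \<Longrightarrow> d \<le> norm (\<phi> z - p)"
  proof -
    have "open (\<phi> ` ball 0 (3/4))"
      by (rule open_mapping_thm3[OF holomorphic_on_subset[OF hol] _ inj_on_subset[OF inj]]) auto
    then have "closed (- \<phi> ` ball 0 (3/4))" by (simp add: closed_Compl)
    moreover have "compact (\<phi> ` cball 0 (1/2))"
      by (intro compact_continuous_image compact_cball continuous_on_subset[OF holomorphic_on_imp_continuous_on[OF hol]]) auto
    moreover have "\<phi> ` cball 0 (1/2) \<inter> - \<phi> ` ball 0 (3/4) = {}" by (force simp: image_iff)
    ultimately obtain d where "d > 0" "\<And>x y. x \<in> \<phi> ` cball 0 (1/2) \<Longrightarrow> y \<in> - \<phi> ` ball 0 (3/4) \<Longrightarrow> d \<le> dist x y"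
      using separate_compact_closed by metis
    then show ?thesis by (intro that[of d]) (auto simp: dist_norm)
  qed
  obtain \<epsilon> where \<epsilon>: "0 < \<epsilon>" "\<And>S p z w. connected S \<Longrightarrow> S \<subseteq> ball 0 1 - cball 0 (1/2) \<Longrightarrow> (\<And>z. z \<in> S \<Longrightarrow> norm (\<phi> z - p) \<le> \<epsilon>)
     \<Longrightarrow> (\<And>z. norm z \<le> 1/2 \<Longrightarrow> d \<le> norm (\<phi> z - p)) \<Longrightarrow> z \<in> S \<Longrightarrow> w \<in> S \<Longrightarrow> norm (sgn z - sgn w) \<le> \<delta>"
    by (rule small_image_small_angle[OF hol inj bd \<delta>(1) d(1)]) blast
  obtain \<epsilon>1 where \<epsilon>1: "0 < \<epsilon>1" "\<And>a b. a \<in> \<phi> ` ball 0 1 \<Longrightarrow> b \<in> \<phi> ` ball 0 1 \<Longrightarrow> dist b a < \<epsilon>1 \<Longrightarrow> dist (g b) (g a) < \<epsilon>"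
    using uc \<epsilon>(1) unfolding uniformly_continuous_on_def by metis
  \<comment> \<open>The points that \<open>h\<close> sends into the disc of radius 1 - \<delta>.
    They form a compact set, so crosscuts close to \<zeta> avoid it and have their images in the
    outer annulus.\<close>
  define K where "K = h' ` cball 0 (1 - \<delta>)"
  have "compact K" unfolding K_def
    by (intro compact_continuous_image compact_cball continuous_on_subset[OF conth(2)]) (use \<delta> in auto)
  moreover have "\<zeta> \<notin> K"
  proof
    assume "\<zeta> \<in> K"
    then obtain z where "z \<in> cball 0 (1 - \<delta>)" "\<zeta> = h' z" by (auto simp: K_def)
    then have "\<zeta> \<in> ball 0 1" using hD(2)[of z] \<delta> by auto
    then show False using \<zeta> by simp
  qed
  ultimately obtain r where r: "0 < r" "ball \<zeta> r \<subseteq> - K"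
    using compact_imp_closed[of K] open_contains_ball[of "- K"] by (auto simp: open_Compl)
  obtain N c where Nc: "crosscut_at \<zeta> r N c" "\<And>z w. z \<in> c \<Longrightarrow> w \<in> c \<Longrightarrow> norm (\<phi> z - \<phi> w) \<le> \<epsilon>1/2"
    by (rule short_crosscut_exists[OF hol inj bd \<zeta> r(1), of "\<epsilon>1/2"]) (use \<epsilon>1(1) in auto)
  define M where "M = ball 0 1 - (N \<union> c)"
  have N: "open N" "N \<subseteq> ball 0 1" "N \<inter> K = {}" and c: "connected c" "c \<noteq> {}" "c \<subseteq> ball 0 1" "c \<inter> K = {}" "N \<inter> c = {}"
    and M: "open M" "M \<subseteq> ball 0 1"
    using Nc(1) r(2) by (auto simp: crosscut_at_def M_def)
  have part: "z \<in> N \<or> z \<in> c \<or> z \<in> M" if "z \<in> ball 0 1" for z using that by (auto simp: M_def)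
  obtain z0 where z0: "z0 \<in> c" using c(2) by blast
  define S where "S = h ` c"
  have Sfar: "1 - \<delta> < norm z" if zS: "z \<in> S" for z
  proof (rule ccontr)
    assume "\<not> 1 - \<delta> < norm z"
    obtain w where w: "w \<in> c" "z = h w" using zS unfolding S_def by blast
    then have "w = h' z" using hD(3) c(3) by auto
    then have "w \<in> K" using \<open>\<not> 1 - \<delta> < norm z\<close> by (auto simp: K_def)
    then show False using w c(4) by blast
  qed
  have SD: "S \<subseteq> ball 0 1" using hD(1) c(3) by (auto simp: S_def)
  have angle: "norm (sgn z - sgn (h z0)) \<le> \<delta>" if "z \<in> S" for z
  proof (rule \<epsilon>(2)[where S = S and p = "\<phi> (h z0)"])
    show "connected S" unfolding S_def
      using c(1,3) connected_continuous_image continuous_on_subset[OF conth(1)] by blast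
    show "S \<subseteq> ball 0 1 - cball 0 (1/2)"
      using SD Sfar \<delta>(2) by fastforce
    show "norm (\<phi> z - \<phi> (h z0)) \<le> \<epsilon>" if zS: "z \<in> S" for z
    proof -
      obtain w where w: "w \<in> c" "z = h w" using zS unfolding S_def by blast
      have "dist (\<phi> w) (\<phi> z0) < \<epsilon>1" using Nc(2)[OF w(1) z0] \<epsilon>1(1) by (simp add: dist_norm)
      then have "dist (g (\<phi> w)) (g (\<phi> z0)) < \<epsilon>"
        using \<epsilon>1(2) w z0 c(3) by blast
      then show ?thesis using conj w z0 c(3) by (simp add: dist_norm subset_iff)
    qed
    have "\<phi> (h z0) \<notin> \<phi> ` ball 0 (3/4)"
    proof
      assume "\<phi> (h z0) \<in> \<phi> ` ball 0 (3/4)"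
      then obtain w where w: "norm w < 3/4" "\<phi> (h z0) = \<phi> w" by auto
      have "h z0 \<in> S" using z0 by (simp add: S_def)
      then have "h z0 = w" using inj_onD[OF inj w(2)] SD w(1) by auto
      then show False using Sfar[OF \<open>h z0 \<in> S\<close>] w(1) \<delta>(2) by simp
    qed
    then show "d \<le> norm (\<phi> z - \<phi> (h z0))" if "norm z \<le> 1/2" for z
      using d(2) that by blast
    show "z \<in> S" by fact
    show "h z0 \<in> S" using z0 by (simp add: S_def)
  qed
  define u where "u = sgn (h z0)"
  define \<Omega> where "\<Omega> = {z. 1 - \<delta> < norm z \<and> norm (sgn z - u) \<le> \<delta>}"
  have con: "connected (ball 0 1 - \<Omega>)" unfolding \<Omega>_def
    by (rule connected_ball_minus_polar_rectangle) (use \<delta>(2) in simp)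
  note open_img = open_image_homeomorphism[OF h open_ball]
  \<comment> \<open>The complement of \<Omega> in the disc is connected, contains the point 0 of
    h(M), and misses h(c). It is therefore covered by the disjoint open sets h(N) and h(M), and
    misses h(N).\<close>
  have hN: "h ` N \<subseteq> \<Omega>"
  proof (rule ccontr)
    assume "\<not> h ` N \<subseteq> \<Omega>"
    then have n1: "h ` N \<inter> (ball 0 1 - \<Omega>) \<noteq> {}" using hD(1) N(2) by blast
    have "0 \<in> h ` M"
    proof -
      have "h' 0 \<in> K" using \<delta>(2) by (auto simp: K_def)
      then have "h' 0 \<in> M" using part[of "h' 0"] hD(2)[of 0] N(3) c(4) by auto
      then show ?thesis using hD(4)[of 0] by (metis centre_in_ball image_eqI zero_less_one)
    qed
    then have n2: "h ` M \<inter> (ball 0 1 - \<Omega>) \<noteq> {}" using \<delta>(2) by (auto simp: \<Omega>_def)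
    have n3: "ball 0 1 - \<Omega> \<subseteq> h ` N \<union> h ` M"
    proof
      fix z assume z: "z \<in> ball 0 1 - \<Omega>"
      then have "z \<notin> S" using Sfar angle by (auto simp: \<Omega>_def u_def)
      have zb: "z \<in> ball 0 1" using z by blast
      then have "z = h (h' z)" using hD(4) by simp
      then show "z \<in> h ` N \<union> h ` M"
        using part[OF hD(2)[OF zb]] \<open>z \<notin> S\<close> unfolding S_def by (metis UnCI image_eqI)
    qed
    have n4: "h ` N \<inter> h ` M \<inter> (ball 0 1 - \<Omega>) = {}"
    proof -
      have "N \<inter> M = {}" by (auto simp: M_def)
      moreover have "inj_on h (ball 0 1)" using hD(3) by (metis inj_on_inverseI)
      ultimately have "h ` N \<inter> h ` M = {}" using inj_on_image_Int[OF _ N(2) M(2), of h] by simp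
      then show ?thesis by simp
    qed
    show False
      using connectedD[OF con open_img[OF N(1,2)] open_img[OF M] n4 n3] n1 n2 by simp
  qed
  obtain \<rho> where rho: "0 < \<rho>" "ball 0 1 \<inter> ball \<zeta> \<rho> \<subseteq> N" using Nc(1) by (auto simp: crosscut_at_def)
  show ?thesis
  proof (intro exI[of _ \<rho>] conjI rho(1) ballI)
    fix z w assume zw: "z \<in> ball 0 1 \<inter> ball \<zeta> \<rho>" "w \<in> ball 0 1 \<inter> ball \<zeta> \<rho>"
    have near: "dist (h z) u \<le> 2 * \<delta>" if "z \<in> ball 0 1 \<inter> ball \<zeta> \<rho>" for z
    proof -
      have "z \<in> N" using that rho(2) by blast
      then have 1: "h z \<in> \<Omega>" "norm (h z) < 1" using that hN hD(1)[of z] by auto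
      have "0 < norm (h z)" using 1(1) \<delta>(2) by (auto simp: \<Omega>_def)
      then have "h z - sgn (h z) = (norm (h z) - 1) *\<^sub>R sgn (h z)" "norm (sgn (h z)) = 1"
        by (auto simp: sgn_div_norm algebra_simps)
      then have "norm (h z - sgn (h z)) = \<bar>norm (h z) - 1\<bar>" by (simp del: norm_sgn)
      also have "\<dots> \<le> \<delta>" using 1 by (auto simp: \<Omega>_def)
      finally have "dist (h z) (sgn (h z)) \<le> \<delta>" by (simp add: dist_norm)
      moreover have "dist (sgn (h z)) u \<le> \<delta>" using 1 by (simp add: \<Omega>_def dist_norm)
      ultimately show ?thesis using dist_triangle[of "h z" u "sgn (h z)"] by linarith
    qed
    have "dist (h z) (h w) \<le> 4 * \<delta>"
      using near[OF zw(1)] near[OF zw(2)] dist_triangle2[of "h z" "h w" u] by linarith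
    then show "dist (h z) (h w) < \<eta>" using \<delta>(1,3) by linarith
  qed
qed

text \<open>\<open>e\<close> is a Lebesgue number for the cover of the compact closure by balls of
  small oscillation.\<close>

lemma uniformly_continuous_on_if_small_oscillation:
  fixes h :: "'a::heine_borel \<Rightarrow> 'b::metric_space"
  assumes "compact (closure S)"
    and osc: "\<And>\<zeta> \<eta>. \<zeta> \<in> closure S \<Longrightarrow> 0 < \<eta> \<Longrightarrow> \<exists>\<rho>>0. \<forall>z\<in>S \<inter> ball \<zeta> \<rho>. \<forall>w\<in>S \<inter> ball \<zeta> \<rho>. dist (h z) (h w) < \<eta>"
  shows "uniformly_continuous_on S h"
  unfolding uniformly_continuous_on_def
proof (intro allI impI)
  fix \<eta> :: real assume \<eta>: "0 < \<eta>"
  define \<C> where "\<C> = {ball \<zeta> \<rho> | \<zeta> \<rho>. \<zeta> \<in> closure S \<and> 0 < \<rho> \<and> (\<forall>z\<in>S \<inter> ball \<zeta> \<rho>. \<forall>w\<in>S \<inter> ball \<zeta> \<rho>. dist (h z) (h w) < \<eta>)}"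
  have "closure S \<subseteq> \<Union>\<C>"
  proof
    fix \<zeta> assume z: "\<zeta> \<in> closure S"
    then obtain \<rho> where "\<rho> > 0" "\<forall>z\<in>S \<inter> ball \<zeta> \<rho>. \<forall>w\<in>S \<inter> ball \<zeta> \<rho>. dist (h z) (h w) < \<eta>"
      using osc \<eta> by blast
    then show "\<zeta> \<in> \<Union>\<C>" using z unfolding \<C>_def by (force intro!: exI[of _ "ball \<zeta> \<rho>"])
  qed
  moreover have "\<And>B. B \<in> \<C> \<Longrightarrow> open B" by (auto simp: \<C>_def)
  ultimately obtain e where e: "0 < e" "\<And>x. x \<in> closure S \<Longrightarrow> \<exists>B\<in>\<C>. ball x e \<subseteq> B"
    using Heine_Borel_lemma[OF assms(1)] by metis
  show "\<exists>d>0. \<forall>x\<in>S. \<forall>x'\<in>S. dist x' x < d \<longrightarrow> dist (h x') (h x) < \<eta>"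
  proof (intro exI[of _ e] conjI e(1) ballI impI)
    fix x x' assume x: "x \<in> S" "x' \<in> S" "dist x' x < e"
    obtain B where B: "B \<in> \<C>" "ball x e \<subseteq> B" using e(2) x(1) closure_subset by blast
    moreover have "x \<in> ball x e" "x' \<in> ball x e" using x e(1) by (auto simp: dist_commute)
    ultimately show "dist (h x') (h x) < \<eta>" using x(1,2) unfolding \<C>_def by blast
  qed
qed

text \<open>This stands in for a boundary extension of \<phi>, which need not exist: applied to
  \<open>h\<close> and to its inverse, it lets both extend to the closed disc.\<close>

lemma conformal_conjugate_uniformly_continuous:
  assumes hol: "\<phi> holomorphic_on ball 0 1" and inj: "inj_on \<phi> (ball 0 1)" and bd: "bounded (\<phi> ` ball 0 1)"
    and h: "homeomorphism (ball 0 1) (ball 0 1) h h'"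
    and uc: "uniformly_continuous_on (\<phi> ` ball 0 1) g"
    and conj: "\<And>z. z \<in> ball 0 1 \<Longrightarrow> \<phi> (h z) = g (\<phi> z)"
  shows "uniformly_continuous_on (ball 0 1) h"
proof (rule uniformly_continuous_on_if_small_oscillation)
  show "compact (closure (ball 0 1 :: complex set))" by simp
  fix \<zeta> :: complex and \<eta> :: real assume z: "\<zeta> \<in> closure (ball 0 1)" and \<eta>: "0 < \<eta>"
  show "\<exists>\<rho>>0. \<forall>z\<in>ball 0 1 \<inter> ball \<zeta> \<rho>. \<forall>w\<in>ball 0 1 \<inter> ball \<zeta> \<rho>. dist (h z) (h w) < \<eta>"
  proof (cases "norm \<zeta> = 1")
    case True
    show ?thesis by (rule conformal_conjugate_small_oscillation[OF hol inj bd h uc conj True \<eta>])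
  next
    case False
    then have "\<zeta> \<in> ball 0 1" using z by simp
    moreover have "continuous_on (ball 0 1) h" using h by (simp add: homeomorphism_def)
    ultimately obtain \<rho> where rho: "\<rho> > 0" "\<And>z. z \<in> ball 0 1 \<Longrightarrow> dist z \<zeta> < \<rho> \<Longrightarrow> dist (h z) (h \<zeta>) < \<eta>/2"
      unfolding continuous_on_iff using \<eta> by (metis half_gt_zero)
    have "dist (h z) (h w) < \<eta>" if "z \<in> ball 0 1 \<inter> ball \<zeta> \<rho>" "w \<in> ball 0 1 \<inter> ball \<zeta> \<rho>" for z w
      using rho(2)[of z] rho(2)[of w] that dist_triangle_half_r[of "h \<zeta>" "h z" \<eta> "h w"]
      by (auto simp: dist_commute)
    then show ?thesis using rho(1) by blast
  qed
qed

text \<open>The identities between \<open>H\<close> and \<open>H'\<close> pass from the dense open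
  disc to its closure. The circle is invariant, since a boundary point sent inside would be kept
  inside by the inverse.\<close>

lemma homeomorphism_disc_extends:
  fixes h :: "complex \<Rightarrow> complex"
  assumes h: "homeomorphism (ball 0 1) (ball 0 1) h h'"
    and uc: "uniformly_continuous_on (ball 0 1) h" "uniformly_continuous_on (ball 0 1) h'"
  obtains H H' where "homeomorphism (cball 0 1) (cball 0 1) H H'" "homeomorphism (sphere 0 1) (sphere 0 1) H H'"
    "\<And>z. z \<in> ball 0 1 \<Longrightarrow> H z = h z" "\<And>z. z \<in> ball 0 1 \<Longrightarrow> H' z = h' z"
proof -
  have cl: "closure (ball 0 1) = (cball 0 1 :: complex set)" by simp
  obtain H where H: "uniformly_continuous_on (cball 0 1) H" "\<And>z. z \<in> ball 0 1 \<Longrightarrow> h z = H z"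
    using uniformly_continuous_on_extension_on_closure[OF uc(1)] cl by metis
  obtain H' where H': "uniformly_continuous_on (cball 0 1) H'" "\<And>z. z \<in> ball 0 1 \<Longrightarrow> h' z = H' z"
    using uniformly_continuous_on_extension_on_closure[OF uc(2)] cl by metis
  have c: "continuous_on (cball 0 1) H" "continuous_on (cball 0 1) H'"
    using H(1) H'(1) uniformly_continuous_imp_continuous by blast+
  have hD: "h z \<in> ball 0 1" "h' z \<in> ball 0 1" "h' (h z) = z" "h (h' z) = z" if "z \<in> ball 0 1" for z
    using h that by (auto simp: homeomorphism_def)
  have im: "H ` cball 0 1 \<subseteq> cball 0 1" "H' ` cball 0 1 \<subseteq> cball 0 1"
  proof -
    have "H ` closure (ball 0 1) \<subseteq> cball 0 1"
      by (rule image_closure_subset) (use c cl hD(1) H(2) in \<open>fastforce+\<close>)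
    then show "H ` cball 0 1 \<subseteq> cball 0 1" by (simp only: cl)
    have "H' ` closure (ball 0 1) \<subseteq> cball 0 1"
      by (rule image_closure_subset) (use c cl hD(2) H'(2) in \<open>fastforce+\<close>)
    then show "H' ` cball 0 1 \<subseteq> cball 0 1" by (simp only: cl)
  qed
  have inv: "H' (H z) = z \<and> H (H' z) = z" if "z \<in> cball 0 1" for z
  proof -
    have z: "z \<in> closure (ball 0 1)" using that cl by simp
    have cc: "continuous_on (closure (ball 0 1)) (\<lambda>z. H' (H z) - z)" "continuous_on (closure (ball 0 1)) (\<lambda>z. H (H' z) - z)"
      unfolding cl using c im
      by (auto intro!: continuous_intros continuous_on_compose2[OF c(1)] continuous_on_compose2[OF c(2)])
    have e: "H' (H z) - z = 0" "H (H' z) - z = 0" if "z \<in> ball 0 1" for z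
      using hD[OF that] H(2)[OF that] H'(2)[OF that] H(2)[OF hD(2)[OF that]] H'(2)[OF hD(1)[OF that]] by simp_all
    show ?thesis
      using continuous_constant_on_closure[OF cc(1) e(1) z] continuous_constant_on_closure[OF cc(2) e(2) z] by simp
  qed
  have hom: "homeomorphism (cball 0 1) (cball 0 1) H H'"
    using c im inv by (intro homeomorphismI) auto
  have sph: "H z \<in> sphere 0 1" "H' z \<in> sphere 0 1" if z: "z \<in> sphere 0 1" for z
  proof -
    have zc: "z \<in> cball 0 1" "z \<notin> ball 0 1" using z by auto
    have "H z \<notin> ball 0 1" using hD(2)[of "H z"] H'(2)[of "H z"] inv[OF zc(1)] zc(2) by auto
    then show "H z \<in> sphere 0 1" using im(1) zc(1) by force
    have "H' z \<notin> ball 0 1" using hD(1)[of "H' z"] H(2)[of "H' z"] inv[OF zc(1)] zc(2) by auto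
    then show "H' z \<in> sphere 0 1" using im(2) zc(1) by force
  qed
  have "homeomorphism (sphere 0 1) (sphere 0 1) H H'"
    using sph inv by (intro homeomorphismI continuous_on_subset[OF c(1)] continuous_on_subset[OF c(2)]) auto
  with hom show ?thesis by (rule that) (use H(2) H'(2) in auto)
qed

section \<open>Unlinked sets on the circle\<close>

text \<open>Im (C z) = (1 - |z|^2) / |q - z|^2, so the disc goes to the upper half-plane and the
  circle without the pole \<open>q\<close> to the real line. The half-angle form in the last claim
  makes the order of angles visible there.\<close>

lemma cayley_transform:
  fixes q :: complex
  assumes q: "norm q = 1"
  defines "C \<equiv> \<lambda>z. \<i> * (q + z) / (q - z)"
  shows "z \<noteq> q \<Longrightarrow> norm z \<le> 1 \<Longrightarrow> 0 \<le> Im (C z)"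
    and "z \<noteq> q \<Longrightarrow> norm z = 1 \<Longrightarrow> Im (C z) = 0"
    and "inj_on C (- {q})"
    and "a \<in> {-pi<..<0} \<Longrightarrow> C (q * cis (2 * a)) = - of_real (cot a)"
proof -
  have "Im (C z) = (1 - (norm z)\<^sup>2) / (norm (q - z))\<^sup>2" if "z \<noteq> q" for z
  proof -
    have "C z = \<i> * (q + z) * cnj (q - z) / of_real ((norm (q - z))\<^sup>2)"
      unfolding C_def by (subst complex_div_cnj) simp
    then have "Im (C z) = Im (\<i> * (q + z) * cnj (q - z)) / (norm (q - z))\<^sup>2"
      by (simp only: Im_divide_of_real)
    also have "Im (\<i> * (q + z) * cnj (q - z)) = (norm q)\<^sup>2 - (norm z)\<^sup>2"
      unfolding cmod_power2 by (simp add: algebra_simps power2_eq_square)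
    finally show ?thesis using q by simp
  qed
  then show "z \<noteq> q \<Longrightarrow> norm z \<le> 1 \<Longrightarrow> 0 \<le> Im (C z)" "z \<noteq> q \<Longrightarrow> norm z = 1 \<Longrightarrow> Im (C z) = 0"
    by (simp_all add: power_le_one)
  show "inj_on C (- {q})"
  proof (rule inj_onI)
    fix z w assume zw: "z \<in> - {q}" "w \<in> - {q}" "C z = C w"
    then have "(q + z) * (q - w) = (q + w) * (q - z)"
      by (simp add: C_def frac_eq_eq)
    then have "2 * q * (z - w) = 0" by (simp add: algebra_simps)
    then show "z = w" using q by auto
  qed
  assume a: "a \<in> {-pi<..<0}"
  have s: "sin a < 0" using sin_gt_zero[of "-a"] a by simp
  have "cis (2 * a) = cis a * cis a" by (simp add: cis_mult)
  moreover have "1 = cis a * cis (-a)" by (simp add: cis_mult)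
  ultimately have "C (q * cis (2 * a)) = \<i> * (q * cis a * (cis (-a) + cis a)) / (q * cis a * (cis (-a) - cis a))"
    unfolding C_def by (simp add: algebra_simps)
  also have "\<dots> = \<i> * (cis (-a) + cis a) / (cis (-a) - cis a)"
    using q by (subst mult.assoc[symmetric], subst mult.left_commute) (auto simp: mult.assoc)
  also have "cis (-a) + cis a = 2 * of_real (cos a)" by (simp add: complex_eq_iff)
  also have "cis (-a) - cis a = - (2 * \<i> * of_real (sin a))" by (simp add: complex_eq_iff)
  also have "\<i> * (2 * of_real (cos a)) / - (2 * \<i> * of_real (sin a)) = - of_real (cot a)"
    using s by (simp add: cot_def)
  finally show "C (q * cis (2 * a)) = - of_real (cot a)" .
qed

lemma cot_strict_antimono_neg:
  fixes a b :: real
  assumes "-pi < a" "a < b" "b < 0"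
  shows "cot b < cot a"
proof -
  have s: "sin a < 0" "sin b < 0" using sin_gt_zero[of "-a"] sin_gt_zero[of "-b"] assms by auto
  have "cot a - cot b = sin (b - a) / (sin a * sin b)"
    using s by (simp add: cot_def sin_diff field_simps)
  also have "\<dots> > 0" using s assms by (intro divide_pos_pos sin_gt_zero mult_neg_neg) auto
  finally show ?thesis by simp
qed

text \<open>An adherent point on the circle need not be accessible from \<open>A\<close>; a short
  segment in the convex disc replaces the missing access path.\<close>

lemma path_in_disc_joining_adherent_points:
  assumes A: "path_connected A" "A \<subseteq> ball 0 1" and ab: "a \<in> closure A" "b \<in> closure A" and e: "0 < e"
  obtains g :: "real \<Rightarrow> complex" where "path g" "pathstart g = a" "pathfinish g = b" "path_image g \<subseteq> cball 0 1"
    "path_image g \<subseteq> A \<union> ball a e \<union> ball b e"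
proof -
  obtain z w where zw: "z \<in> A" "dist z a < e" "w \<in> A" "dist w b < e"
    using ab e by (meson closure_approachable)
  obtain p where p: "path p" "path_image p \<subseteq> A" "pathstart p = z" "pathfinish p = w"
    using A(1) zw unfolding path_connected_def by blast
  define g where "g = linepath a z +++ p +++ linepath w b"
  have "closure A \<subseteq> cball 0 1" using closure_mono[OF A(2)] by simp
  then have abD: "a \<in> cball 0 1" "b \<in> cball 0 1" using ab by auto
  have zwD: "z \<in> cball 0 1" "w \<in> cball 0 1" using zw A(2) by force+
  have im: "path_image g = closed_segment a z \<union> path_image p \<union> closed_segment w b"
    using p by (simp add: g_def path_image_join Un_assoc)
  have 1: "closed_segment a z \<subseteq> ball a e" "closed_segment w b \<subseteq> ball b e"
    by (intro closed_segment_subset convex_ball; use zw e in \<open>simp add: dist_commute\<close>)+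
  have 2: "closed_segment a z \<subseteq> cball 0 1" "closed_segment w b \<subseteq> cball 0 1"
    by (intro closed_segment_subset convex_cball abD zwD)+
  show ?thesis
  proof (rule that[of g])
    show "path g" "pathstart g = a" "pathfinish g = b" using p by (auto simp: g_def)
    show "path_image g \<subseteq> cball 0 1" unfolding im using 2 p(2) A(2) ball_subset_cball by blast
    show "path_image g \<subseteq> A \<union> ball a e \<union> ball b e" unfolding im using 1 p(2) by blast
  qed
qed

text \<open>The Cayley transform with a pole outside the two arcs turns this into the statement that
  two arcs in a rectangle with interlaced end points on the bottom side intersect.\<close>

lemma disjoint_in_disc_not_interlaced:
  assumes A: "path_connected A" "A \<subseteq> ball 0 1" and B: "path_connected B" "B \<subseteq> ball 0 1"
    and disj: "A \<inter> B = {}" and ang: "0 < s" "s < t" "t < u" "u < 2 * pi"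
    and cA: "cis s \<in> closure A" "cis u \<in> closure A" "1 \<notin> closure A" "cis t \<notin> closure A"
    and cB: "1 \<in> closure B" "cis t \<in> closure B" "cis s \<notin> closure B" "cis u \<notin> closure B"
  shows False
proof -
  \<comment> \<open>The pole lies on the free arc from cis u back to 1, and \<alpha> is half the
    angle measured from it; thus the four points keep their order on the real line.\<close>
  define \<tau> where "\<tau> = (u + 2 * pi) / 2"
  define q where "q = cis \<tau>"
  define \<alpha> where "\<alpha> = (\<lambda>\<theta>. (\<theta> - \<tau>) / 2)"
  have \<alpha>: "\<alpha> \<theta> \<in> {-pi<..<0}" "cis \<theta> = q * cis (2 * \<alpha> \<theta>)" if "\<theta> \<in> {0..u}" for \<theta>
    using that ang by (auto simp: \<alpha>_def \<tau>_def q_def cis_mult field_simps)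
  have q: "norm q = 1" by (simp add: q_def)
  have cisq: "cis \<theta> \<noteq> q" if "\<theta> \<in> {0..u}" for \<theta>
  proof
    assume "cis \<theta> = q"
    then have "cis (2 * \<alpha> \<theta>) = 1" using \<alpha>(2)[OF that] q by auto
    then have "sin (\<alpha> \<theta>) = 0" using cos_double_sin[of "\<alpha> \<theta>"] by (simp add: complex_eq_iff)
    then show False using \<alpha>(1)[OF that] sin_gt_zero[of "- \<alpha> \<theta>"] by auto
  qed
  have inA: "{0, s, t, u} \<subseteq> {0..u}" using ang by auto
  define C where "C = (\<lambda>z. \<i> * (q + z) / (q - z))"
  note C = cayley_transform[OF q, folded C_def]
  \<comment> \<open>Only within \<open>e\<close> of its end points may a path leave its set. The
    bounds keep these end balls away from the other set, from the pole and from the end balls of the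
    other path.\<close>
  obtain e where e: "0 < e" "ball 1 e \<inter> A = {}" "ball (cis t) e \<inter> A = {}" "ball (cis s) e \<inter> B = {}" "ball (cis u) e \<inter> B = {}"
     "e \<le> dist 1 q" "e \<le> dist (cis t) q" "e \<le> dist (cis s) q" "e \<le> dist (cis u) q"
     "2 * e \<le> dist 1 (cis s)" "2 * e \<le> dist 1 (cis u)" "2 * e \<le> dist (cis t) (cis s)" "2 * e \<le> dist (cis t) (cis u)"
  proof -
    have ex: "\<exists>e>0. ball x e \<inter> S = {}" if "x \<notin> closure S" for x :: complex and S
      using that unfolding closure_approachable by (metis disjoint_iff dist_commute mem_ball)
    obtain e1 e2 e3 e4 where ee: "e1 > 0" "ball 1 e1 \<inter> A = {}" "e2 > 0" "ball (cis t) e2 \<inter> A = {}" 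
       "e3 > 0" "ball (cis s) e3 \<inter> B = {}" "e4 > 0" "ball (cis u) e4 \<inter> B = {}"
      using ex cA(3,4) cB(3,4) by metis
    define D where "D = {dist 1 q, dist (cis t) q, dist (cis s) q, dist (cis u) q,
       dist 1 (cis s) / 2, dist 1 (cis u) / 2, dist (cis t) (cis s) / 2, dist (cis t) (cis u) / 2, e1, e2, e3, e4}"
    have "1 \<noteq> q" using cisq[of 0] inA by simp
    moreover have "1 \<noteq> cis s" "1 \<noteq> cis u" "cis t \<noteq> cis s" "cis t \<noteq> cis u" using cA cB by metis+
    moreover have "cis t \<noteq> q" "cis s \<noteq> q" "cis u \<noteq> q" using cisq inA by simp_all
    ultimately have "\<forall>x\<in>D. 0 < x" using ee unfolding D_def by simp
    then have pos: "\<And>x. x \<in> D \<Longrightarrow> 0 < x" by blast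
    have fin: "finite D" "D \<noteq> {}" by (auto simp: D_def)
    define e where "e = Min D"
    have e0: "0 < e" using pos fin by (simp add: e_def)
    have le: "e \<le> x" if "x \<in> D" for x using that fin by (simp add: e_def)
    have "ball 1 e \<subseteq> ball 1 e1" "ball (cis t) e \<subseteq> ball (cis t) e2" "ball (cis s) e \<subseteq> ball (cis s) e3" "ball (cis u) e \<subseteq> ball (cis u) e4"
      by (intro subset_ball le; simp add: D_def)+
    then have "ball 1 e \<inter> A = {}" "ball (cis t) e \<inter> A = {}" "ball (cis s) e \<inter> B = {}" "ball (cis u) e \<inter> B = {}"
      using ee by blast+
    moreover have "2 * e \<le> x" if "x / 2 \<in> D" for x using le[OF that] by simp
    then have "2 * e \<le> dist 1 (cis s)" "2 * e \<le> dist 1 (cis u)" "2 * e \<le> dist (cis t) (cis s)" "2 * e \<le> dist (cis t) (cis u)"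
      by (simp_all add: D_def)
    moreover have "e \<le> dist 1 q" "e \<le> dist (cis t) q" "e \<le> dist (cis s) q" "e \<le> dist (cis u) q"
      by (simp_all add: le D_def)
    ultimately show ?thesis using e0 by (intro that[of e])
  qed
  obtain f where f: "path f" "pathstart f = 1" "pathfinish f = cis t" "path_image f \<subseteq> cball 0 1"
      "path_image f \<subseteq> B \<union> ball 1 e \<union> ball (cis t) e"
    using path_in_disc_joining_adherent_points[OF B cB(1,2) e(1)] .
  obtain g where g: "path g" "pathstart g = cis s" "pathfinish g = cis u" "path_image g \<subseteq> cball 0 1"
      "path_image g \<subseteq> A \<union> ball (cis s) e \<union> ball (cis u) e"
    using path_in_disc_joining_adherent_points[OF A cA(1,2) e(1)] .
  have nq: "q \<notin> path_image f" "q \<notin> path_image g"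
  proof -
    have "q \<notin> A" "q \<notin> B" using A(2) B(2) q by auto
    moreover have "q \<notin> ball 1 e" "q \<notin> ball (cis t) e" "q \<notin> ball (cis s) e" "q \<notin> ball (cis u) e"
      using e(6-9) by auto
    ultimately show "q \<notin> path_image f" "q \<notin> path_image g" using f(5) g(5) by blast+
  qed
  have dd: "ball x e \<inter> ball y e = {}" if "2 * e \<le> dist x y" for x y :: complex
    using that by (intro disjoint_ballI) simp
  have fg: "path_image f \<inter> path_image g = {}"
  proof -
    have gen: "F \<inter> G = {}" if "F \<subseteq> B \<union> B1 \<union> B2" "G \<subseteq> A \<union> A1 \<union> A2" "A \<inter> B = {}" "B1 \<inter> A = {}" "B2 \<inter> A = {}"
      "A1 \<inter> B = {}" "A2 \<inter> B = {}" "B1 \<inter> A1 = {}" "B1 \<inter> A2 = {}" "B2 \<inter> A1 = {}" "B2 \<inter> A2 = {}"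
      for F G A1 A2 B1 B2 :: "complex set"
    proof -
      have "(B \<union> B1 \<union> B2) \<inter> (A \<union> A1 \<union> A2) = {}"
        using that(3-11) by (simp add: Int_Un_distrib Int_Un_distrib2 Int_commute)
      then show ?thesis using that(1,2) by blast
    qed
    show ?thesis
      by (rule gen[OF f(5) g(5) disj e(2-5) dd dd dd dd]) (rule e(10-13))+
  qed
  define F where "F = plane_of_complex \<circ> C"
  have contF: "continuous_on (- {q}) F"
    unfolding F_def C_def o_def by (intro continuous_intros) auto
  have pF: "path (F \<circ> f)" "path (F \<circ> g)"
    using nq by (auto intro!: path_continuous_image f g continuous_on_subset[OF contF])
  have "bounded (path_image (F \<circ> f) \<union> path_image (F \<circ> g))"
    using pF by (simp add: bounded_path_image)
  then obtain K where K: "\<And>v. v \<in> path_image (F \<circ> f) \<union> path_image (F \<circ> g) \<Longrightarrow> norm v \<le> K"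
    unfolding bounded_iff by blast
  define lo :: "real^2" where "lo = plane_of_complex (Complex (-K) 0)"
  define hi :: "real^2" where "hi = plane_of_complex (Complex K K)"
  have box: "F z \<in> cbox lo hi" if z: "z \<in> path_image f \<union> path_image g" for z
  proof -
    have zq: "z \<noteq> q" "norm z \<le> 1" using z nq f(4) g(4) by auto
    have "norm (F z) \<le> K" using K z by (auto simp: path_image_compose)
    then have "\<bar>F z $ 1\<bar> \<le> K" "\<bar>F z $ 2\<bar> \<le> K"
      using component_le_norm_cart order_trans by blast+
    moreover have "0 \<le> F z $ 2" using C(1)[OF zq] by (simp add: F_def C_def)
    ultimately show ?thesis
      by (auto simp: mem_box_cart forall_2 lo_def hi_def)
  qed
  have F2: "F (cis \<theta>) $ 2 = lo $ 2" if "\<theta> \<in> {0..u}" for \<theta>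
    using C(2)[OF cisq[OF that]] by (simp add: F_def lo_def C_def)
  have F1: "F (cis \<theta>) $ 1 = - cot (\<alpha> \<theta>)" if "\<theta> \<in> {0..u}" for \<theta>
    unfolding \<alpha>(2)[OF that] F_def o_def using C(4)[OF \<alpha>(1)[OF that]] by (simp add: C_def)
  have mono: "F (cis \<theta>) $ 1 < F (cis \<theta>') $ 1" if "\<theta> \<in> {0..u}" "\<theta>' \<in> {0..u}" "\<theta> < \<theta>'" for \<theta> \<theta>'
    using F1[OF that(1)] F1[OF that(2)] \<alpha>(1)[OF that(1)] \<alpha>(1)[OF that(2)] that(3)
      cot_strict_antimono_neg[of "\<alpha> \<theta>" "\<alpha> \<theta>'"] by (simp add: \<alpha>_def)
  obtain v where v: "v \<in> path_image (F \<circ> f)" "v \<in> path_image (F \<circ> g)"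
  proof (rule fashoda_interlace[OF pF, of lo hi])
    show "path_image (F \<circ> f) \<subseteq> cbox lo hi" "path_image (F \<circ> g) \<subseteq> cbox lo hi"
      using box by (auto simp: path_image_compose)
    show "pathstart (F \<circ> f) $ 2 = lo $ 2" "pathfinish (F \<circ> f) $ 2 = lo $ 2"
       "pathstart (F \<circ> g) $ 2 = lo $ 2" "pathfinish (F \<circ> g) $ 2 = lo $ 2"
      using inA F2 F2[of 0] by (simp_all add: pathstart_compose pathfinish_compose f g)
    show "pathstart (F \<circ> f) $ 1 < pathstart (F \<circ> g) $ 1" "pathstart (F \<circ> g) $ 1 < pathfinish (F \<circ> f) $ 1"
      "pathfinish (F \<circ> f) $ 1 < pathfinish (F \<circ> g) $ 1"
      using inA ang mono[of 0 s] mono[of s t] mono[of t u] by (simp_all add: pathstart_compose pathfinish_compose f g)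
  qed
  then obtain z w where zw: "z \<in> path_image f" "w \<in> path_image g" "F z = F w"
    by (auto simp: path_image_compose)
  then have "C z = C w" by (metis F_def comp_apply complex_of_plane_of_complex)
  then have "z = w" using inj_onD[OF C(3)] zw nq by blast
  then show False using fg zw by blast
qed

text \<open>No two points of \<open>X\<close> separate two points of \<open>Y\<close> on the unit circle; the first point of \<open>Y\<close>
  serves as the origin of the angle.\<close>

definition unlinked :: "complex set \<Rightarrow> complex set \<Rightarrow> bool" where
  "unlinked X Y \<longleftrightarrow> (\<forall>b s t u. b \<in> Y \<and> 0 < s \<and> s < t \<and> t < u \<and> u < 2 * pi \<and>
      b * cis s \<in> X \<and> b * cis u \<in> X \<longrightarrow> b * cis t \<notin> Y)"

lemma unlinkedD:
  "unlinked X Y \<Longrightarrow> b \<in> Y \<Longrightarrow> 0 < s \<Longrightarrow> s < t \<Longrightarrow> t < u \<Longrightarrow> u < 2 * pi \<Longrightarrow>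
    b * cis s \<in> X \<Longrightarrow> b * cis u \<in> X \<Longrightarrow> b * cis t \<notin> Y"
  unfolding unlinked_def by blast

text \<open>A rotation takes \<open>b\<close> to 1, and interlaced pairs would contradict
  \<open>disjoint_in_disc_not_interlaced\<close>. Disjointness on the circle ensures that no end
  point of one pair adheres to the other set.\<close>

lemma unlinked_adherent_points:
  assumes A: "path_connected A" "A \<subseteq> ball 0 1" and B: "path_connected B" "B \<subseteq> ball 0 1"
    and disj: "A \<inter> B = {}" "closure A \<inter> closure B \<inter> sphere 0 1 = {}"
  shows "unlinked (closure A \<inter> sphere 0 1) (closure B \<inter> sphere 0 1)"
  unfolding unlinked_def
proof (intro allI impI notI)
  fix b s t u
  assume as: "b \<in> closure B \<inter> sphere 0 1 \<and> 0 < s \<and> s < t \<and> t < u \<and> u < 2 * pi \<and>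
       b * cis s \<in> closure A \<inter> sphere 0 1 \<and> b * cis u \<in> closure A \<inter> sphere 0 1"
    and bt: "b * cis t \<in> closure B \<inter> sphere 0 1"
  have b: "norm b = 1" "b \<noteq> 0" using as by auto
  define R where "R = (\<lambda>z. inverse b * z)"
  have cl: "closure (R ` S) = R ` closure S" for S
  proof -
    have "linear R" unfolding R_def by (simp add: bounded_linear.linear bounded_linear_mult_right)
    moreover have "inj R" using b by (auto simp: inj_on_def R_def)
    ultimately show ?thesis by (rule closure_injective_linear_image[symmetric])
  qed
  have inR: "z \<in> R ` S \<longleftrightarrow> b * z \<in> S" for z S
  proof
    assume "z \<in> R ` S" then show "b * z \<in> S" using b by (auto simp: R_def mult.assoc[symmetric])
  next
    assume "b * z \<in> S"
    moreover have "z = R (b * z)" using b by (simp add: R_def)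
    ultimately show "z \<in> R ` S" by (rule image_eqI[rotated])
  qed
  have ball: "R ` S \<subseteq> ball 0 1" if "S \<subseteq> ball 0 1" for S
    using that b by (auto simp: R_def norm_mult norm_inverse)
  have pc: "path_connected (R ` S)" if "path_connected S" for S
    using that unfolding R_def by (intro path_connected_continuous_image continuous_intros)
  have cis1: "norm (b * cis \<theta>) = 1" for \<theta> using b by (simp add: norm_mult)
  show False
  proof (rule disjoint_in_disc_not_interlaced[of "R ` A" "R ` B" s t u])
    show "R ` A \<inter> R ` B = {}" using disj(1) b by (auto simp: R_def)
  qed (use A B pc ball as bt disj(2) cis1 b(1) in \<open>auto simp: cl inR disjoint_iff\<close>)
qed

text \<open>Cut open at \<open>b\<close>, the circle becomes an interval of angles in which
  \<alpha>1 lies before \<alpha>2. The image of the gap between them avoids \<open>b\<close>, so its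
  angle runs continuously from at most \<open>e\<close> to more than \<open>e\<close> and takes the
  value \<open>e\<close>. The point mapped there lies in \<alpha>1 and in the closed gap, so it is
  the end point itself.\<close>

lemma circle_common_fixed_point_ordered:
  assumes cpt: "compact \<alpha>1" "compact \<alpha>2"
    and sub: "\<alpha>1 \<subseteq> sphere 0 1" "\<alpha>2 \<subseteq> sphere 0 1" "\<alpha>3 \<subseteq> sphere 0 1"
    and disj: "\<alpha>1 \<inter> \<alpha>2 = {}" "\<alpha>1 \<inter> \<alpha>3 = {}" "\<alpha>2 \<inter> \<alpha>3 = {}"
    and unl: "unlinked \<alpha>1 (\<alpha>2 \<union> \<alpha>3)" "unlinked \<alpha>2 (\<alpha>1 \<union> \<alpha>3)" "unlinked (\<alpha>1 \<union> \<alpha>2) \<alpha>3"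
    and b: "b \<in> \<alpha>3" and ord: "0 \<le> s0" "s0 < t0" "t0 < 2 * pi" "b * cis s0 \<in> \<alpha>1" "b * cis t0 \<in> \<alpha>2"
  obtains e where "e \<in> \<alpha>1" "\<And>H H'. homeomorphism (sphere 0 1) (sphere 0 1) H H' \<Longrightarrow> H ` \<alpha>1 \<subseteq> \<alpha>1 \<Longrightarrow> H ` \<alpha>2 \<subseteq> \<alpha>2
      \<Longrightarrow> H' ` \<alpha>1 \<subseteq> \<alpha>1 \<Longrightarrow> H' ` \<alpha>3 \<subseteq> \<alpha>3 \<Longrightarrow> H e = e"
proof -
  have nb: "norm b = 1" "b \<noteq> 0" using b sub(3) by auto
  define ang where "ang = (\<lambda>z. Arg2pi (z / b))"
  have angE: "z = b * cis (ang z)" if "norm z = 1" for z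
    using Arg2pi_eq[of "z / b"] nb that by (simp add: ang_def cis_conv_exp norm_divide field_simps)
  have ang_range: "0 \<le> ang z" "ang z < 2 * pi" for z
    by (simp_all add: ang_def Arg2pi_ge_0 Arg2pi_lt_2pi)
  have ang_cis: "ang (b * cis \<theta>) = \<theta>" if "0 \<le> \<theta>" "\<theta> < 2 * pi" for \<theta>
    using nb that by (simp add: ang_def cis_conv_exp Arg2pi_unique[of 1])
  have ang_pos: "0 < ang z" if "norm z = 1" "z \<noteq> b" for z
    using angE[OF that(1)] ang_range(1)[of z] that(2) by (cases "ang z = 0") auto
  have cont: "continuous_on (sphere 0 1 - {b}) ang"
  proof (rule continuous_at_imp_continuous_on, rule ballI)
    fix z assume z: "z \<in> sphere 0 1 - {b}"
    have "z / b \<notin> \<real>\<^sub>\<ge>\<^sub>0"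
    proof
      assume "z / b \<in> \<real>\<^sub>\<ge>\<^sub>0"
      then obtain r where r: "0 \<le> r" "z / b = of_real r" by (auto elim: nonneg_Reals_cases)
      have "norm (z / b) = 1" using z nb by (simp add: norm_divide)
      then have "r = 1" using r by simp
      then show False using r(2) z nb by simp
    qed
    then have c: "isCont Arg2pi (z / b)" by (rule continuous_at_Arg2pi)
    have "isCont (\<lambda>z. z / b) z" using nb by (intro continuous_intros) auto
    from isCont_o2[OF this c] show "isCont ang z" unfolding ang_def .
  qed
  have sub': "\<alpha>1 \<subseteq> sphere 0 1 - {b}" "\<alpha>2 \<subseteq> sphere 0 1 - {b}" using sub disj b by blast+
  define T1 where "T1 = ang ` \<alpha>1"
  define T2 where "T2 = ang ` \<alpha>2"
  have cT: "compact T1" "compact T2" unfolding T1_def T2_def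
    using cpt cont sub' by (auto intro!: compact_continuous_image intro: continuous_on_subset)
  have T1: "x \<in> T1 \<longleftrightarrow> 0 < x \<and> x < 2 * pi \<and> b * cis x \<in> \<alpha>1" for x
  proof
    assume "x \<in> T1" 
    then obtain z where z: "z \<in> \<alpha>1" "x = ang z" by (auto simp: T1_def)
    then have "norm z = 1" "z \<noteq> b" using sub' by auto
    then show "0 < x \<and> x < 2 * pi \<and> b * cis x \<in> \<alpha>1" using angE ang_pos ang_range z by metis
  next
    assume "0 < x \<and> x < 2 * pi \<and> b * cis x \<in> \<alpha>1"
    then show "x \<in> T1" unfolding T1_def by (metis ang_cis image_eqI less_imp_le)
  qed
  have T2: "x \<in> T2 \<longleftrightarrow> 0 < x \<and> x < 2 * pi \<and> b * cis x \<in> \<alpha>2" for x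
  proof
    assume "x \<in> T2" 
    then obtain z where z: "z \<in> \<alpha>2" "x = ang z" by (auto simp: T2_def)
    then have "norm z = 1" "z \<noteq> b" using sub' by auto
    then show "0 < x \<and> x < 2 * pi \<and> b * cis x \<in> \<alpha>2" using angE ang_pos ang_range z by metis
  next
    assume "0 < x \<and> x < 2 * pi \<and> b * cis x \<in> \<alpha>2"
    then show "x \<in> T2" unfolding T2_def by (metis ang_cis image_eqI less_imp_le)
  qed
  have s0: "s0 \<in> T1" "t0 \<in> T2" 
  proof -
    have "s0 \<noteq> 0" using ord(4) disj(2) b by auto
    then show "s0 \<in> T1" "t0 \<in> T2" using ord T1 T2 by auto
  qed
  have T12: "x \<noteq> y" if "x \<in> T1" "y \<in> T2" for x y using that T1 T2 disj(1) by blast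
  \<comment> \<open>With \<open>y\<close> before \<open>x\<close>, either s0, t0, x or y, x, t0
    would be a triple whose outer members separate the middle one from \<open>b\<close>, against one
    of the first two unlinkedness assumptions.\<close>
  have sep: "x < y" if x: "x \<in> T1" and y: "y \<in> T2" for x y
  proof (rule ccontr)
    assume "\<not> x < y"
    then have yx: "y < x" using T12[OF x y] by simp
    consider "t0 < x" | "x < t0" using T12[OF x s0(2)] by linarith
    then show False
    proof cases
      case 1
      have "b * cis t0 \<notin> \<alpha>2 \<union> \<alpha>3"
        by (rule unlinkedD[OF unl(1), of b s0 t0 x]) (use 1 b ord s0 x T1 in auto)
      then show False using ord by blast
    next
      case 2
      have "b * cis x \<notin> \<alpha>1 \<union> \<alpha>3"
        by (rule unlinkedD[OF unl(2), of b y x t0]) (use 2 b ord s0 y yx T2 in auto)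
      then show False using x T1 by blast
    qed
  qed
  obtain e where e: "e \<in> T1" "\<And>x. x \<in> T1 \<Longrightarrow> x \<le> e" using compact_attains_sup[OF cT(1)] s0 by blast
  obtain f where f: "f \<in> T2" "\<And>x. x \<in> T2 \<Longrightarrow> f \<le> x" using compact_attains_inf[OF cT(2)] s0 by blast
  have ef: "e < f" "0 < e" "f < 2 * pi" using sep[OF e(1) f(1)] e(1)[unfolded T1] f(1)[unfolded T2] by auto
  \<comment> \<open>The points at \<open>e\<close> and \<open>f\<close> would separate a point of
    \<alpha>3 inside the gap from \<open>b\<close>, against the third unlinkedness
    assumption.\<close>
  have arc3: "b * cis x \<notin> \<alpha>3" if "x \<in> {e..f}" for x
  proof -
    have "x = e \<or> x = f \<or> e < x \<and> x < f" using that by auto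
    then consider "x = e" | "x = f" | "e < x" "x < f" by blast
    then show ?thesis
    proof cases
      case 1 then show ?thesis using e T1 disj(2) by blast
    next
      case 2 then show ?thesis using f T2 disj(3) by blast
    next
      case 3
      moreover have "b * cis e \<in> \<alpha>1 \<union> \<alpha>2" "b * cis f \<in> \<alpha>1 \<union> \<alpha>2" using e(1) f(1) T1 T2 by blast+
      ultimately show ?thesis
        by (intro unlinkedD[OF unl(3) b, of e x f]) (use ef(2,3) in auto)
    qed
  qed
  show ?thesis
  proof (rule that[of "b * cis e"])
    show "b * cis e \<in> \<alpha>1" using e T1 by blast
    fix H H' assume hom: "homeomorphism (sphere 0 1) (sphere 0 1) H H'" and inv: "H ` \<alpha>1 \<subseteq> \<alpha>1" "H ` \<alpha>2 \<subseteq> \<alpha>2" "H' ` \<alpha>1 \<subseteq> \<alpha>1" "H' ` \<alpha>3 \<subseteq> \<alpha>3"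
    have cS: "b * cis x \<in> sphere 0 1" for x using nb by (simp add: norm_mult)
    define k where "k = (\<lambda>x. H (b * cis x))"
    have kS: "k x \<in> sphere 0 1" "H' (k x) = b * cis x" for x
      using hom cS[of x] by (auto simp: homeomorphism_def k_def)
    \<comment> \<open>\<open>H'\<close> maps \<alpha>3 into itself, so a point of the gap mapped to
      \<open>b\<close> would belong to \<alpha>3.\<close>
    have kb: "k x \<in> sphere 0 1 - {b}" if "x \<in> {e..f}" for x
      using kS[of x] arc3[OF that] inv(4) b by auto
    have contH: "continuous_on (sphere 0 1) H" using hom by (simp add: homeomorphism_def)
    have ck: "continuous_on {e..f} k" unfolding k_def
      by (rule continuous_on_compose2[OF contH]) (use cS in \<open>auto simp: cis_conv_exp intro!: continuous_intros\<close>)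
    have "continuous_on {e..f} (\<lambda>x. ang (k x))"
      by (rule continuous_on_compose2[OF cont ck]) (use kb in blast)
    then have con: "connected ((\<lambda>x. ang (k x)) ` {e..f})"
      by (rule connected_continuous_image) simp
    have "k e \<in> \<alpha>1" "k f \<in> \<alpha>2" using e f T1 T2 inv by (auto simp: k_def)
    then have "ang (k e) \<le> e" "e \<le> ang (k f)" using e(2) f(2) ef by (force simp: T1_def T2_def)+
    then have "e \<in> (\<lambda>x. ang (k x)) ` {e..f}"
      using connectedD_interval[OF con, of "ang (k e)" "ang (k f)" e] ef by auto
    then obtain x where x: "x \<in> {e..f}" "ang (k x) = e" by auto
    then have kx: "k x = b * cis e" using angE[of "k x"] kS(1)[of x] by simp
    then have "b * cis x \<in> \<alpha>1" using kS(2)[of x] inv(3) \<open>b * cis e \<in> \<alpha>1\<close> by auto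
    then have "x \<in> T1" using T1 x(1) ef by auto
    then have "x = e" using e(2) x(1) by force
    then show "H (b * cis e) = b * cis e" using kx by (simp add: k_def)
  qed
qed

lemma circle_common_fixed_point:
  assumes cpt: "compact \<alpha>1" "compact \<alpha>2"
    and sub: "\<alpha>1 \<subseteq> sphere 0 1" "\<alpha>2 \<subseteq> sphere 0 1" "\<alpha>3 \<subseteq> sphere 0 1"
    and ne: "\<alpha>1 \<noteq> {}" "\<alpha>2 \<noteq> {}" "\<alpha>3 \<noteq> {}"
    and disj: "\<alpha>1 \<inter> \<alpha>2 = {}" "\<alpha>1 \<inter> \<alpha>3 = {}" "\<alpha>2 \<inter> \<alpha>3 = {}"
    and unl: "unlinked \<alpha>1 (\<alpha>2 \<union> \<alpha>3)" "unlinked \<alpha>2 (\<alpha>1 \<union> \<alpha>3)" "unlinked (\<alpha>1 \<union> \<alpha>2) \<alpha>3"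
  obtains e where "e \<in> sphere 0 1" "\<And>H H'. homeomorphism (sphere 0 1) (sphere 0 1) H H' \<Longrightarrow>
      H ` \<alpha>1 \<subseteq> \<alpha>1 \<Longrightarrow> H ` \<alpha>2 \<subseteq> \<alpha>2 \<Longrightarrow> H' ` \<alpha>1 \<subseteq> \<alpha>1 \<Longrightarrow> H' ` \<alpha>2 \<subseteq> \<alpha>2 \<Longrightarrow> H' ` \<alpha>3 \<subseteq> \<alpha>3 \<Longrightarrow> H e = e"
proof -
  obtain b a1 a2 where ab: "b \<in> \<alpha>3" "a1 \<in> \<alpha>1" "a2 \<in> \<alpha>2" using ne by blast
  then have n: "norm b = 1" "norm a1 = 1" "norm a2 = 1" using sub by auto
  define s where "s = Arg2pi (a1 / b)"
  define t where "t = Arg2pi (a2 / b)"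
  have "b \<noteq> 0" using n by auto
  then have st: "a1 = b * cis s" "a2 = b * cis t"
    using Arg2pi_eq[of "a1 / b"] Arg2pi_eq[of "a2 / b"] n
    by (auto simp: s_def t_def cis_conv_exp norm_divide field_simps)
  have st': "0 \<le> s" "0 \<le> t" "s < 2 * pi" "t < 2 * pi"
    by (simp_all add: s_def t_def Arg2pi_ge_0 Arg2pi_lt_2pi)
  have "s \<noteq> t" using st ab disj(1) by auto
  then consider "s < t" | "t < s" by linarith
  then show ?thesis
  proof cases
    case 1
    obtain e where e: "e \<in> \<alpha>1" "\<And>H H'. homeomorphism (sphere 0 1) (sphere 0 1) H H' \<Longrightarrow> H ` \<alpha>1 \<subseteq> \<alpha>1 \<Longrightarrow> H ` \<alpha>2 \<subseteq> \<alpha>2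
      \<Longrightarrow> H' ` \<alpha>1 \<subseteq> \<alpha>1 \<Longrightarrow> H' ` \<alpha>3 \<subseteq> \<alpha>3 \<Longrightarrow> H e = e"
      by (rule circle_common_fixed_point_ordered[OF cpt sub disj unl ab(1) st'(1) 1 st'(4) ab(2)[unfolded st(1)] ab(3)[unfolded st(2)]]) blast
    have "e \<in> sphere 0 1" using e(1) sub by blast
    then show ?thesis by (rule that) (rule e(2); assumption)
  next
    case 2
    have disj': "\<alpha>2 \<inter> \<alpha>1 = {}" using disj by blast
    have unl': "unlinked (\<alpha>2 \<union> \<alpha>1) \<alpha>3" using unl(3) by (simp add: Un_commute)
    obtain e where e: "e \<in> \<alpha>2" "\<And>H H'. homeomorphism (sphere 0 1) (sphere 0 1) H H' \<Longrightarrow> H ` \<alpha>2 \<subseteq> \<alpha>2 \<Longrightarrow> H ` \<alpha>1 \<subseteq> \<alpha>1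
      \<Longrightarrow> H' ` \<alpha>2 \<subseteq> \<alpha>2 \<Longrightarrow> H' ` \<alpha>3 \<subseteq> \<alpha>3 \<Longrightarrow> H e = e"
      by (rule circle_common_fixed_point_ordered[OF cpt(2,1) sub(2,1,3) disj' disj(3,2) unl(2,1) unl' ab(1) st'(2) 2 st'(3) ab(3)[unfolded st(2)] ab(2)[unfolded st(1)]]) blast
    have "e \<in> sphere 0 1" using e(1) sub by blast
    then show ?thesis by (rule that) (rule e(2); assumption)
  qed
qed

section \<open>Crosscuts and nested images\<close>

text \<open>A common adherent point \<zeta> would make both sets cross any small crosscut there,
  since each has points near \<zeta> and a point outside the ball of radius \<open>r\<close>. But
  the crosscut can be chosen with an image too short for the separation \<epsilon>.\<close>

lemma adherent_points_disjoint:
  assumes hol: "\<phi> holomorphic_on ball 0 1" and inj: "inj_on \<phi> (ball 0 1)" and bd: "bounded (\<phi> ` ball 0 1)"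
    and A: "connected A" "A \<subseteq> ball 0 1" and B: "connected B" "B \<subseteq> ball 0 1"
    and \<epsilon>: "0 < \<epsilon>" and sep: "\<And>a b. a \<in> A \<Longrightarrow> b \<in> B \<Longrightarrow> \<epsilon> < norm (\<phi> a - \<phi> b)"
  shows "closure A \<inter> closure B \<inter> sphere 0 1 = {}"
proof (rule ccontr)
  assume "\<not> ?thesis"
  then obtain \<zeta> where z: "\<zeta> \<in> closure A" "\<zeta> \<in> closure B" "norm \<zeta> = 1" by auto
  obtain a b where ab: "a \<in> A" "b \<in> B" using z by (metis closure_empty empty_iff ex_in_conv)
  define r where "r = min (dist \<zeta> a) (dist \<zeta> b)"
  have "a \<noteq> \<zeta>" "b \<noteq> \<zeta>" using ab A(2) B(2) z(3) by auto
  then have r: "0 < r" by (simp add: r_def)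
  obtain N c where Nc: "crosscut_at \<zeta> r N c" "\<And>z w. z \<in> c \<Longrightarrow> w \<in> c \<Longrightarrow> norm (\<phi> z - \<phi> w) \<le> \<epsilon>"
    by (rule short_crosscut_exists[OF hol inj bd z(3) r \<epsilon>]) blast
  have meet: "S \<inter> c \<noteq> {}" if S: "connected S" "S \<subseteq> ball 0 1" "\<zeta> \<in> closure S" "x \<in> S" "x \<notin> ball \<zeta> r" for S x
  proof
    assume Sc: "S \<inter> c = {}"
    define M where "M = ball 0 1 - (N \<union> c)"
    have o: "open N" "open M" using Nc(1) by (auto simp: crosscut_at_def M_def)
    have "S \<subseteq> N \<union> M" using Sc S(2) by (auto simp: M_def)
    moreover have "N \<inter> M \<inter> S = {}" by (auto simp: M_def)
    moreover have "x \<in> M" using S Nc(1) unfolding M_def crosscut_at_def by blast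
    moreover have "N \<inter> S \<noteq> {}"
    proof -
      obtain \<rho> where rho: "0 < \<rho>" "ball 0 1 \<inter> ball \<zeta> \<rho> \<subseteq> N" using Nc(1) by (auto simp: crosscut_at_def)
      obtain y where "y \<in> S" "dist y \<zeta> < \<rho>" using S(3) rho(1) closure_approachable by blast
      then show ?thesis using rho(2) S(2) by (auto simp: dist_commute)
    qed
    ultimately show False using connectedD[OF S(1) o] S(4) by blast
  qed
  obtain x y where "x \<in> A" "x \<in> c" "y \<in> B" "y \<in> c"
    using meet[OF A z(1) ab(1)] meet[OF B z(2) ab(2)] by (auto simp: r_def)
  then show False using sep[of x y] Nc(2)[of x y] by linarith
qed

text \<open>\<open>nw\<close> is what remains of the invariant measure. If h(c) lay in
  \<open>N\<close>, the rest of the disc, being connected and containing 0 outside h(N), would miss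
  h(N). So h(N) would lie in \<open>N\<close>, and by \<open>nw\<close> the open set h(M) could not
  meet \<open>N\<close>; but h(M) accumulates at h(c), inside \<open>N\<close>.\<close>

lemma crosscut_image_not_in_neighbourhood:
  assumes cc: "crosscut_at \<zeta> r N c"
    and h: "homeomorphism (ball 0 1) (ball 0 1) h h'"
    and far: "0 \<notin> N" "h' 0 \<notin> N" 
    and nw: "\<And>U V. open U \<Longrightarrow> U \<subseteq> ball 0 1 \<Longrightarrow> open V \<Longrightarrow> V \<subseteq> U \<Longrightarrow> h ` U \<subseteq> U \<Longrightarrow> V \<inter> h ` U = {} \<Longrightarrow> V = {}"
  shows "\<not> h ` c \<subseteq> N"
proof
  assume hc: "h ` c \<subseteq> N"
  define M where "M = ball 0 1 - (N \<union> c)"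
  have o: "open N" "open M" and s: "N \<subseteq> ball 0 1" "M \<subseteq> ball 0 1" "c \<subseteq> ball 0 1" and Nc: "N \<inter> c = {}"
    and con: "connected (ball 0 1 - N)" and cM: "c \<subseteq> closure M" and c0: "c \<noteq> {}"
    using cc by (auto simp: crosscut_at_def M_def)
  have hD: "h z \<in> ball 0 1" "h' z \<in> ball 0 1" "h' (h z) = z" "h (h' z) = z" if "z \<in> ball 0 1" for z
    using h that by (auto simp: homeomorphism_def)
  have oh: "open (h ` N)" "open (h ` M)" using open_image_homeomorphism[OF h open_ball] o s by blast+
  have inj: "inj_on h (ball 0 1)" using hD(3) by (metis inj_on_inverseI)
  have dNM: "h ` N \<inter> h ` M = {}" using inj_on_image_Int[OF inj s(1,2)] by (auto simp: M_def)
  have part: "z \<in> h ` N \<or> z \<in> h ` c \<or> z \<in> h ` M" if "z \<in> ball 0 1" for z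
  proof -
    have "h' z \<in> N \<or> h' z \<in> c \<or> h' z \<in> M" using hD(2)[OF that] by (auto simp: M_def)
    then show ?thesis using hD(4)[OF that] by (metis imageI)
  qed
  have "0 \<notin> h ` N" using far(2) hD(3) s(1) by (metis imageE subsetD)
  moreover have "ball 0 1 - N \<subseteq> h ` N \<union> h ` M" using part hc by blast
  moreover have "h ` N \<inter> h ` M \<inter> (ball 0 1 - N) = {}" using dNM by blast
  moreover have "0 \<in> ball 0 1 - N" using far(1) by simp
  ultimately have "h ` N \<inter> (ball 0 1 - N) = {}"
    using connectedD[OF con oh] by blast
  then have hNN: "h ` N \<subseteq> N" using hD(1) s(1) by blast
  have "N \<inter> h ` M = {}"
    by (rule nw[OF o(1) s(1) _ _ hNN]) (use o oh dNM in auto)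
  obtain x where x: "x \<in> c" using c0 by blast
  have "open (ball 0 1 \<inter> h -` N)"
    using h o(1) by (intro continuous_open_preimage) (auto simp: homeomorphism_def)
  moreover have "x \<in> ball 0 1 \<inter> h -` N" using x s(3) hc by auto
  ultimately have "(ball 0 1 \<inter> h -` N) \<inter> M \<noteq> {}"
    using x cM open_Int_closure_eq_empty[of "ball 0 1 \<inter> h -` N" M] by blast
  then show False using \<open>N \<inter> h ` M = {}\<close> by blast
qed

text \<open>If the crosscuts are disjoint, the preceding lemma for \<open>h\<close> and
  \<open>h'\<close> leaves h(c) and h'(c) on the far side \<open>M\<close>. Then \<open>N\<close>
  misses h(c) and meets h(N), so it lies in h(N). Yet \<open>c\<close>, which borders
  \<open>N\<close>, lies in the open set h(M).\<close>

lemma crosscut_meets_image: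
  assumes cc: "crosscut_at \<zeta> r N c"
    and h: "homeomorphism (ball 0 1) (ball 0 1) h h'"
    and far: "0 \<notin> N" "h 0 \<notin> N" "h' 0 \<notin> N" 
    and nw: "\<And>U V. open U \<Longrightarrow> U \<subseteq> ball 0 1 \<Longrightarrow> open V \<Longrightarrow> V \<subseteq> U \<Longrightarrow> h ` U \<subseteq> U \<Longrightarrow> V \<inter> h ` U = {} \<Longrightarrow> V = {}"
    and nw': "\<And>U V. open U \<Longrightarrow> U \<subseteq> ball 0 1 \<Longrightarrow> open V \<Longrightarrow> V \<subseteq> U \<Longrightarrow> h' ` U \<subseteq> U \<Longrightarrow> V \<inter> h' ` U = {} \<Longrightarrow> V = {}"
    and meet: "N \<inter> h ` N \<noteq> {}"
  shows "h ` c \<inter> c \<noteq> {}"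
proof
  assume disj: "h ` c \<inter> c = {}"
  define M where "M = ball 0 1 - (N \<union> c)"
  have o: "open N" "open M" and s: "N \<subseteq> ball 0 1" "M \<subseteq> ball 0 1" "c \<subseteq> ball 0 1" and Nc: "N \<inter> c = {}"
    and con: "connected c" "connected N" and cN: "c \<subseteq> closure N" and c0: "c \<noteq> {}"
    using cc by (auto simp: crosscut_at_def M_def)
  have hD: "h z \<in> ball 0 1" "h' z \<in> ball 0 1" "h' (h z) = z" "h (h' z) = z" if "z \<in> ball 0 1" for z
    using h that by (auto simp: homeomorphism_def)
  have oh: "open (h ` N)" "open (h ` M)" using open_image_homeomorphism[OF h open_ball] o s by blast+
  have h': "homeomorphism (ball 0 1) (ball 0 1) h' h" using h by (rule homeomorphism_symD)
  have conth: "continuous_on (ball 0 1) h" "continuous_on (ball 0 1) h'"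
    using h by (auto simp: homeomorphism_def)
  have inj: "inj_on h (ball 0 1)" using hD(3) by (metis inj_on_inverseI)
  have dNM: "h ` N \<inter> h ` M = {}" using inj_on_image_Int[OF inj s(1,2)] by (auto simp: M_def)
  have side: "S \<subseteq> N \<or> S \<subseteq> M" if "connected S" "S \<subseteq> ball 0 1" "S \<inter> c = {}" for S
  proof -
    have "S \<subseteq> N \<union> M" using that by (auto simp: M_def)
    moreover have "N \<inter> M \<inter> S = {}" by (auto simp: M_def)
    ultimately show ?thesis using connectedD[OF that(1) o] by blast
  qed
  have "h' x \<notin> c" if x: "x \<in> c" for x
  proof
    assume "h' x \<in> c"
    then have "h (h' x) \<in> h ` c" by (rule imageI)
    moreover have "h (h' x) = x" using hD(4) s(3) x by blast
    ultimately show False using disj x by auto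
  qed
  then have "h' ` c \<inter> c = {}" by blast
  moreover have "\<not> h' ` c \<subseteq> N"
    by (rule crosscut_image_not_in_neighbourhood[OF cc h' far(1,2) nw'])
  moreover have "connected (h' ` c)" "h' ` c \<subseteq> ball 0 1"
    using con(1) s(3) hD(2) connected_continuous_image continuous_on_subset[OF conth(2)] by blast+
  ultimately have "h' ` c \<subseteq> M"
    using side by blast
  then have chM: "c \<subseteq> h ` M" using hD(4) s(3) by force
  have "connected (h ` c)" "h ` c \<subseteq> ball 0 1"
    using con(1) s(3) hD(1) connected_continuous_image continuous_on_subset[OF conth(1)] by blast+
  moreover have "\<not> h ` c \<subseteq> N"
    by (rule crosscut_image_not_in_neighbourhood[OF cc h far(1,3) nw])
  ultimately have hcM: "h ` c \<subseteq> M"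
    using side disj by blast
  have cover: "N \<subseteq> h ` N \<union> h ` M"
  proof
    fix z assume z: "z \<in> N"
    then have zD: "z \<in> ball 0 1" using s(1) by blast
    have "z \<notin> h ` c" using hcM z by (auto simp: M_def)
    then have "h' z \<notin> c" using hD(4)[OF zD] by (metis imageI)
    then have "h' z \<in> N \<union> M" using hD(2)[OF zD] by (auto simp: M_def)
    then show "z \<in> h ` N \<union> h ` M" using hD(4)[OF zD] by (metis UnE UnI1 UnI2 imageI)
  qed
  have "h ` N \<inter> h ` M \<inter> N = {}" using dNM by simp
  then have "h ` M \<inter> N = {}" using connectedD[OF con(2) oh _ cover] meet by (auto simp: Int_commute)
  then have "h ` M \<inter> closure N = {}" by (simp add: open_Int_closure_eq_empty[OF oh(2)])
  moreover obtain x where x: "x \<in> c" using c0 by blast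
  ultimately show False using cN chM by auto
qed

section \<open>The invariant domain and its tentacles\<close>

locale bounded_plane_action =
  fixes G :: "(complex \<Rightarrow> complex) set" and k :: real
  assumes k_pos: "0 < k"
    and id_in: "id \<in> G"
    and inverse_in: "g \<in> G \<Longrightarrow> \<exists>g'\<in>G. homeomorphism UNIV UNIV g g'"
    and comp_in: "g \<in> G \<Longrightarrow> h \<in> G \<Longrightarrow> g \<circ> h \<in> G"
    and displacement: "g \<in> G \<Longrightarrow> norm (g x - x) \<le> k"
begin

text \<open>Complement of the intersection of the images of the disc; the complement of its closure
  is then the interior of that intersection.\<close>

definition exterior :: "complex set" where
  "exterior = (\<Union>g\<in>G. g ` (- cball 0 (100 * k)))"

definition domain :: "complex set" where
  "domain = connected_component_set (- closure exterior) 0"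

lemma continuous_action: "g \<in> G \<Longrightarrow> continuous_on S g"
  using inverse_in by (metis continuous_on_subset homeomorphism_def subset_UNIV)

lemma norm_image_bounds:
  assumes "g \<in> G"
  shows "norm (g x) \<le> norm x + k" "norm x \<le> norm (g x) + k"
  using displacement[OF assms, of x] norm_triangle_sub[of "g x" x] norm_triangle_sub[of x "g x"]
  by (simp_all add: norm_minus_commute)

lemma connected_exterior: "connected exterior"
  unfolding exterior_def
proof (rule connected_Union)
  have "connected (- cball 0 (100 * k) :: complex set)"
    by (rule connected_complement_bounded_convex) auto
  then show "connected S" if "S \<in> (\<lambda>g. g ` (- cball 0 (100 * k))) ` G" for S
    using that continuous_action connected_continuous_image by blast
  \<comment> \<open>So far out, the point stays outside the disc under every inverse and is
    therefore common to all the images.\<close>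
  have "of_real (200 * k) \<in> g ` (- cball 0 (100 * k))" if g: "g \<in> G" for g
  proof -
    obtain g' where g': "g' \<in> G" "homeomorphism UNIV UNIV g g'" using inverse_in[OF g] by blast
    have "norm (of_real (200 * k) :: complex) \<le> norm (g' (of_real (200 * k))) + k"
      by (rule norm_image_bounds(2)[OF g'(1)])
    then have "g' (of_real (200 * k)) \<in> - cball 0 (100 * k)" using k_pos by simp
    moreover have "of_real (200 * k) = g (g' (of_real (200 * k)))" using g'(2) by (simp add: homeomorphism_def)
    ultimately show ?thesis by blast
  qed
  then show "\<Inter> ((\<lambda>g. g ` (- cball 0 (100 * k))) ` G) \<noteq> {}" by blast
qed

lemma exterior_supset: "- cball 0 (100 * k) \<subseteq> exterior"
  unfolding exterior_def by (rule subset_trans[OF _ UN_upper[OF id_in]]) simp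

lemma exterior_disjoint_ball: "closure exterior \<inter> ball 0 (99 * k) = {}"
proof -
  have "exterior \<inter> ball 0 (99 * k) = {}"
  proof (rule ccontr)
    assume "\<not> ?thesis"
    then obtain y where y: "y \<in> exterior" "norm y < 99 * k" by auto
    then obtain g x where gx: "g \<in> G" "x \<in> - cball 0 (100 * k)" "y = g x" unfolding exterior_def by blast
    then show False using norm_image_bounds(2)[OF gx(1), of x] y(2) by simp
  qed
  then have "ball 0 (99 * k) \<inter> closure exterior = {}"
    by (subst open_Int_closure_eq_empty) (auto simp: Int_commute)
  then show ?thesis by blast
qed

lemma image_UN_action_subset:
  assumes g: "g \<in> G" shows "g ` (\<Union>h\<in>G. h ` S) \<subseteq> (\<Union>h\<in>G. h ` S)"
proof -
  have "g ` h ` S \<subseteq> (\<Union>h\<in>G. h ` S)" if "h \<in> G" for h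
    using comp_in[OF g that] by (metis UN_upper image_comp)
  then show ?thesis by blast
qed

lemma image_exterior: "g \<in> G \<Longrightarrow> g ` exterior \<subseteq> exterior"
  unfolding exterior_def by (rule image_UN_action_subset)

lemma open_domain: "open domain"
  unfolding domain_def by (rule open_connected_component) (simp add: open_Compl)

lemma connected_domain: "connected domain"
  unfolding domain_def by (rule connected_connected_component)

lemma ball_subset_domain: "ball 0 (99 * k) \<subseteq> domain"
  unfolding domain_def
  by (rule connected_component_maximal) (use k_pos exterior_disjoint_ball in auto)

lemma domain_subset: "domain \<subseteq> - closure exterior"
  unfolding domain_def by (rule connected_component_subset)

lemma domain_subset_cball: "domain \<subseteq> cball 0 (100 * k)"
  using domain_subset closure_subset[of exterior] exterior_supset by blast

lemma bounded_domain: "bounded domain"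
  using domain_subset_cball bounded_subset bounded_cball by blast

text \<open>A group element permutes the components of the complement of the closed exterior, and it
  keeps the one of 0 because it moves 0 by at most \<open>k\<close>.\<close>

lemma image_domain_subset:
  assumes g: "g \<in> G" shows "g ` domain \<subseteq> domain"
proof -
  obtain g' where g': "g' \<in> G" "homeomorphism UNIV UNIV g g'" using inverse_in[OF g] by blast
  have inv: "g' (g x) = x" for x using g'(2) by (simp add: homeomorphism_def)
  have "g' ` closure exterior \<subseteq> closure exterior"
    using image_closure_subset[OF continuous_action[OF g'(1)] closed_closure, of exterior] 
      image_exterior[OF g'(1)] closure_subset[of exterior] by blast
  then have "g ` (- closure exterior) \<subseteq> - closure exterior" using inv by (metis (no_types, lifting) ComplD ComplI image_subset_iff)
  then have "g ` domain \<subseteq> - closure exterior" using domain_subset by blast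
  moreover have "connected (g ` domain)"
    using connected_domain continuous_action[OF g] connected_continuous_image by blast
  moreover have "0 \<in> domain" using ball_subset_domain k_pos by (simp add: subset_iff)
  then have "g 0 \<in> g ` domain" by (rule imageI)
  ultimately have "g ` domain \<subseteq> connected_component_set (- closure exterior) (g 0)"
    by (intro connected_component_maximal)
  also have "\<dots> = domain"
  proof -
    have "g 0 \<in> domain" using norm_image_bounds(1)[OF g, of 0] ball_subset_domain k_pos by auto
    then show ?thesis unfolding domain_def by (metis connected_component_eq)
  qed
  finally show ?thesis .
qed

text \<open>A component of the complement of a connected set has connected complement, and for
  bounded open connected plane sets this means simple connectivity.\<close>

lemma simply_connected_domain: "simply_connected domain"
proof -
  have "domain \<in> components (- closure exterior)"
    unfolding domain_def components_def using exterior_disjoint_ball k_pos by auto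
  then have "connected (- domain)"
    using component_complement_connected[OF connected_imp_connected_closure[OF connected_exterior]] by blast
  then show ?thesis
    using simply_connected_iff_simple[OF open_domain bounded_domain] connected_domain by blast
qed

lemma domain_riemann_map:
  obtains \<phi> \<psi> where "\<phi> holomorphic_on ball 0 1" "homeomorphism (ball 0 1) domain \<phi> \<psi>"
proof -
  have "domain \<noteq> UNIV" using bounded_domain by auto
  moreover have "domain \<noteq> {}" using ball_subset_domain k_pos by fastforce
  ultimately obtain f g where fg: "f holomorphic_on domain" "g holomorphic_on ball 0 1"
    "\<forall>z\<in>domain. f z \<in> ball 0 1 \<and> g (f z) = z" "\<forall>z\<in>ball 0 1. g z \<in> domain \<and> f (g z) = z"
    using Riemann_mapping_theorem[of domain] open_domain simply_connected_domain by metis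
  have "homeomorphism (ball 0 1) domain g f"
    using fg by (intro homeomorphismI holomorphic_on_imp_continuous_on) auto
  then show ?thesis using that fg by blast
qed

text \<open>The ray may leave the domain and return; only its first stretch is kept, which is
  connected and runs up to the boundary.\<close>

definition arm :: "complex \<Rightarrow> complex set" where
  "arm u = {of_real t * u | t. 50 * k \<le> t \<and> (\<forall>s\<in>{50 * k..t}. of_real s * u \<in> domain)}"

text \<open>Every translate of the foot is within \<open>k\<close> of it, hence in the ball of
  radius 2k; through this ball all translates are connected with each other.\<close>

definition tentacle :: "complex \<Rightarrow> complex set" where
  "tentacle u = (\<Union>g\<in>G. g ` (arm u \<union> ball (of_real (50 * k) * u) (2 * k)))"

lemma arm_union_ball_subset_domain:
  assumes "norm u = 1"
  shows "arm u \<union> ball (of_real (50 * k) * u) (2 * k) \<subseteq> domain"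
proof -
  have "x \<in> ball 0 (99 * k)" if "x \<in> ball (of_real (50 * k) * u) (2 * k)" for x
    using norm_triangle_sub[of x "of_real (50 * k) * u"] that assms k_pos
    by (simp add: norm_mult dist_norm norm_minus_commute)
  then show ?thesis using ball_subset_domain by (auto simp: arm_def)
qed

lemma tentacle_subset_domain: "norm u = 1 \<Longrightarrow> tentacle u \<subseteq> domain"
  unfolding tentacle_def using arm_union_ball_subset_domain image_domain_subset by blast

lemma image_tentacle: "g \<in> G \<Longrightarrow> g ` tentacle u \<subseteq> tentacle u"
  unfolding tentacle_def by (rule image_UN_action_subset)

lemma arm_union_ball_subset_tentacle: "arm u \<union> ball (of_real (50 * k) * u) (2 * k) \<subseteq> tentacle u"
  unfolding tentacle_def using id_in by (intro subset_trans[OF _ UN_upper[OF id_in]]) simp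

lemma foot_in_tentacle: "of_real (50 * k) * u \<in> tentacle u"
  using arm_union_ball_subset_tentacle[of u] k_pos by auto

lemma path_connected_tentacle:
  assumes u: "norm u = 1"
  shows "path_connected (tentacle u)"
proof -
  define q where "q = of_real (50 * k) * u"
  define L where "L = arm u \<union> ball q (2 * k)"
  have qL: "q \<in> L" using k_pos by (simp add: L_def)
  have "closed_segment q x \<subseteq> L" if "x \<in> L" for x
  proof (cases "x \<in> ball q (2 * k)")
    case True
    then have "closed_segment q x \<subseteq> ball q (2 * k)"
      using k_pos by (intro closed_segment_subset) auto
    then show ?thesis by (auto simp: L_def)
  next
    case False
    then have "x \<in> arm u" using that by (simp add: L_def)
    then obtain t where t: "50 * k \<le> t" "\<And>s. s \<in> {50 * k..t} \<Longrightarrow> of_real s * u \<in> domain" "x = of_real t * u"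
      by (auto simp: arm_def)
    have "y \<in> arm u" if "y \<in> closed_segment q x" for y
    proof -
      obtain l where l: "0 \<le> l" "l \<le> 1" "y = (1 - l) *\<^sub>R q + l *\<^sub>R x"
        using \<open>y \<in> closed_segment q x\<close> by (auto simp: closed_segment_def)
      define s where "s = (1 - l) * (50 * k) + l * t"
      have "y = of_real s * u"
        by (simp add: l(3) q_def t(3) s_def scaleR_conv_of_real algebra_simps)
      moreover have "50 * k \<le> s"
        using mult_left_mono[OF t(1) l(1)] by (simp add: s_def algebra_simps)
      moreover have "s \<le> t"
        using mult_left_mono[OF t(1), of "1 - l"] l(2) by (simp add: s_def algebra_simps)
      ultimately show ?thesis using t(2) by (auto simp: arm_def)
    qed
    then show ?thesis by (auto simp: L_def)
  qed
  then have "starlike L" unfolding starlike_def using qL by blast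
  then have L: "path_connected L" by (rule starlike_imp_path_connected)
  have T: "tentacle u = (\<Union>g\<in>G. g ` L)" by (simp add: tentacle_def L_def q_def)
  have to_q: "path_component (tentacle u) x q" if x: "x \<in> tentacle u" for x
  proof -
    obtain g where g: "g \<in> G" "x \<in> g ` L" using x unfolding T by blast
    have "path_connected (g ` L)"
      using L continuous_action[OF g(1)] path_connected_continuous_image by blast
    then have "path_component (g ` L) x (g q)"
      using g(2) imageI[OF qL, of g] unfolding path_connected_component by blast
    then have 1: "path_component (tentacle u) x (g q)"
      by (rule path_component_of_subset[rotated]) (use g(1) in \<open>auto simp: T\<close>)
    have "g q \<in> L" using displacement[OF g(1), of q] k_pos
      by (simp add: L_def dist_norm norm_minus_commute)
    then have "path_component L (g q) q"
      using L qL by (simp add: path_connected_component)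
    then have 2: "path_component (tentacle u) (g q) q"
      by (rule path_component_of_subset[rotated]) (use arm_union_ball_subset_tentacle[of u] in \<open>simp add: L_def q_def\<close>)
    show ?thesis by (rule path_component_trans[OF 1 2])
  qed
  show ?thesis
    unfolding path_connected_component
  proof (intro ballI)
    fix x y assume "x \<in> tentacle u" "y \<in> tentacle u"
    then show "path_component (tentacle u) x y"
      by (intro path_component_trans[OF to_q path_component_sym[OF to_q]])
  qed
qed

text \<open>A point of the tentacle is within 3k of a point of the ray: 2k from the ball and
  \<open>k\<close> from the displacement. This gives 50k - 3k = 47k and -25k + 3k = -22k in the two
  estimates that follow.\<close>

lemma tentacle_halfplane:
  assumes u: "norm u = 1" and v: "norm v = 1" and x: "x \<in> tentacle u"
  shows "\<exists>t\<ge>50 * k. \<bar>inner v x - inner v u * t\<bar> \<le> 3 * k"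
proof -
  obtain g y where gy: "g \<in> G" "x = g y" "y \<in> arm u \<union> ball (of_real (50 * k) * u) (2 * k)"
    using x unfolding tentacle_def by blast
  have "\<exists>t\<ge>50 * k. norm (y - of_real t * u) \<le> 2 * k"
  proof (cases "y \<in> arm u")
    case True
    then obtain t where "50 * k \<le> t" "y = of_real t * u" by (auto simp: arm_def)
    then show ?thesis using k_pos by (intro exI[of _ t]) simp
  next
    case False
    then show ?thesis using gy(3) by (intro exI[of _ "50 * k"]) (auto simp: dist_norm norm_minus_commute)
  qed
  then obtain t where t: "50 * k \<le> t" "norm (y - of_real t * u) \<le> 2 * k" by blast
  have "norm (x - of_real t * u) \<le> 3 * k"
    using displacement[OF gy(1), of y] t(2) norm_triangle_ineq[of "g y - y" "y - of_real t * u"]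
    unfolding gy(2) by simp
  then have "\<bar>inner v (x - of_real t * u)\<bar> \<le> 3 * k"
    using Cauchy_Schwarz_ineq2[of v "x - of_real t * u"] v by simp
  moreover have "inner v (x - of_real t * u) = inner v x - inner v u * t"
    by (simp add: inner_diff_right flip: scaleR_conv_of_real)
  ultimately show "\<exists>t\<ge>50 * k. \<bar>inner v x - inner v u * t\<bar> \<le> 3 * k" using t(1) by auto
qed

lemma tentacle_own_halfplane:
  assumes "norm u = 1" "x \<in> tentacle u"
  shows "47 * k \<le> inner u x"
  using tentacle_halfplane[OF assms(1,1,2)] assms(1) by (auto simp: dot_square_norm abs_le_iff)

lemma tentacle_other_halfplane:
  assumes "norm u = 1" "norm v = 1" "inner v u = -1/2" "x \<in> tentacle u"
  shows "inner v x \<le> - 22 * k"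
  using tentacle_halfplane[OF assms(1,2,4)] assms(3) by (auto simp: abs_le_iff)

text \<open>The domain is bounded, so the parameters have a supremum \<open>b\<close>. If the point
  at \<open>b\<close> belonged to the open domain, the arm could be prolonged.\<close>

lemma closure_arm_not_subset_domain:
  assumes u: "norm u = 1"
  shows "\<not> closure (arm u) \<subseteq> domain"
proof
  assume sub: "closure (arm u) \<subseteq> domain"
  define A where "A = {t. 50 * k \<le> t \<and> (\<forall>s\<in>{50 * k..t}. of_real s * u \<in> domain)}"
  have armA: "arm u = (\<lambda>t. of_real t * u) ` A" by (auto simp: arm_def A_def)
  have "of_real (50 * k) * u \<in> domain"
    using arm_union_ball_subset_domain[OF u] k_pos by auto
  then have A0: "50 * k \<in> A" by (simp add: A_def)
  have "t \<le> 100 * k" if "t \<in> A" for t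
  proof -
    have "of_real t * u \<in> domain" using that by (simp add: A_def)
    then have "of_real t * u \<in> cball 0 (100 * k)" using domain_subset_cball by blast
    then show ?thesis using u by (simp add: norm_mult)
  qed
  then have bdd: "bdd_above A" by (rule bdd_aboveI)
  define b where "b = Sup A"
  have "b \<in> closure A" unfolding b_def using A0 bdd by (intro closure_contains_Sup) auto
  then have "of_real b * u \<in> (\<lambda>t. of_real t * u) ` closure A" by blast
  also have "\<dots> \<subseteq> closure (arm u)" unfolding armA
    by (rule image_closure_subset) (auto intro!: continuous_intros closure_subset[THEN subsetD])
  finally have bd: "of_real b * u \<in> domain" using sub by blast
  then obtain e where e: "0 < e" "ball (of_real b * u) e \<subseteq> domain"
    using open_domain open_contains_ball by blast
  have "b + e/2 \<in> A"
    unfolding A_def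
  proof (intro CollectI conjI ballI)
    show "50 * k \<le> b + e/2" using cSup_upper[OF A0 bdd] e(1) by (simp add: b_def)
    fix s assume s: "s \<in> {50 * k..b + e/2}"
    show "of_real s * u \<in> domain"
    proof (cases "s < b")
      case True
      then obtain a where "a \<in> A" "s < a" using A0 less_cSupD[of A s] unfolding b_def by blast
      then show ?thesis using s by (auto simp: A_def)
    next
      case False
      have "dist (of_real b * u) (of_real s * u) = \<bar>b - s\<bar>"
        using u by (simp add: dist_norm norm_mult flip: left_diff_distrib of_real_diff)
      then have "of_real s * u \<in> ball (of_real b * u) e" using False s e(1) by simp
      then show ?thesis using e(2) by blast
    qed
  qed
  then have "b + e/2 \<le> b" unfolding b_def using bdd by (rule cSup_upper)
  then show False using e(1) by simp
qed

text \<open>Otherwise the preimage of the tentacle has compact closure in the open disc, and \<phi>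
  carries that closure to a compact subset of the domain containing the closure of the arm.\<close>

lemma tentacle_reaches_circle:
  fixes \<phi> \<psi> :: "complex \<Rightarrow> complex"
  assumes \<phi>: "homeomorphism (ball 0 1) domain \<phi> \<psi>" and u: "norm u = 1"
  shows "closure (\<psi> ` tentacle u) \<inter> sphere 0 1 \<noteq> {}"
proof
  assume e: "closure (\<psi> ` tentacle u) \<inter> sphere 0 1 = {}"
  have \<psi>: "\<psi> z \<in> ball 0 1" "\<phi> (\<psi> z) = z" if "z \<in> domain" for z
    using \<phi> that by (auto simp: homeomorphism_def)
  have sub: "\<psi> ` tentacle u \<subseteq> ball 0 1" using \<psi>(1) tentacle_subset_domain[OF u] by blast
  define K where "K = closure (\<psi> ` tentacle u)"
  have KC: "K \<subseteq> cball 0 1" unfolding K_def using closure_mono[OF sub] by simp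
  have K: "compact K" "K \<subseteq> ball 0 1"
  proof -
    show "compact K" using bounded_subset[OF bounded_cball KC] by (simp add: K_def compact_eq_bounded_closed)
    have "x \<in> ball 0 1" if x: "x \<in> K" for x
    proof -
      have "x \<notin> sphere 0 1" "x \<in> cball 0 1" using e x KC unfolding K_def by blast+
      then show ?thesis by simp
    qed
    then show "K \<subseteq> ball 0 1" by blast
  qed
  have "compact (\<phi> ` K)"
    by (rule compact_continuous_image[OF continuous_on_subset[OF homeomorphism_cont1[OF \<phi>] K(2)] K(1)])
  moreover have "arm u \<subseteq> \<phi> ` K"
  proof
    fix x assume "x \<in> arm u"
    then have x: "x \<in> tentacle u" using arm_union_ball_subset_tentacle by blast
    have xK: "\<psi> x \<in> K" unfolding K_def by (rule subsetD[OF closure_subset imageI[OF x]])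
    have "x \<in> domain" using tentacle_subset_domain[OF u] x by blast
    then have "x = \<phi> (\<psi> x)" by (rule \<psi>(2)[symmetric])
    then show "x \<in> \<phi> ` K" using xK by (rule image_eqI)
  qed
  ultimately have "closure (arm u) \<subseteq> \<phi> ` K" by (simp add: closure_minimal compact_imp_closed)
  also have "\<dots> \<subseteq> domain" using \<phi> K(2) by (auto simp: homeomorphism_def)
  finally show False using closure_arm_not_subset_domain[OF u] by blast
qed

text \<open>The segment \<open>I\<close> between the feet of the other two tentacles lies, like
  these, in the half-plane \<open>inner u x \<le> - 22 * k\<close>, while the tentacle of
  \<open>u\<close> has \<open>47 * k \<le> inner u x\<close>. So the results on separated connected
  sets apply to that tentacle and to \<open>C\<close>.\<close>

lemma adherent_sets_of_tentacles:
  assumes hol: "\<phi> holomorphic_on ball 0 1" and \<phi>: "homeomorphism (ball 0 1) domain \<phi> \<psi>"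
    and unit: "norm u = 1" "norm v = 1" "norm w = 1" 
    and angle: "inner u v = -1/2" "inner u w = -1/2"
  defines "\<alpha> \<equiv> \<lambda>u. closure (\<psi> ` tentacle u) \<inter> sphere 0 1"
  shows "\<alpha> u \<inter> (\<alpha> v \<union> \<alpha> w) = {}" "unlinked (\<alpha> u) (\<alpha> v \<union> \<alpha> w)" "unlinked (\<alpha> v \<union> \<alpha> w) (\<alpha> u)"
proof -
  have inj: "inj_on \<phi> (ball 0 1)" using \<phi> by (metis homeomorphism_def inj_on_inverseI)
  have im: "\<phi> ` ball 0 1 = domain" using \<phi> by (simp add: homeomorphism_def)
  have \<psi>: "\<psi> z \<in> ball 0 1" "\<phi> (\<psi> z) = z" if "z \<in> domain" for z
    using \<phi> that by (auto simp: homeomorphism_def)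
  have cont: "continuous_on domain \<psi>" using \<phi> by (simp add: homeomorphism_def)
  define q where "q = (\<lambda>u. of_real (50 * k) * u :: complex)"
  define I where "I = closed_segment (q v) (q w)"
  define C where "C = tentacle v \<union> I \<union> tentacle w"
  have inner_q: "inner u (q v) = -25 * k" "inner u (q w) = -25 * k"
  proof -
    have "q x = (50 * k) *\<^sub>R x" for x by (simp add: q_def scaleR_conv_of_real)
    then show "inner u (q v) = -25 * k" "inner u (q w) = -25 * k" using angle by simp_all
  qed
  have I: "I \<subseteq> domain" "\<And>x. x \<in> I \<Longrightarrow> inner u x \<le> - 22 * k"
  proof -
    have "I \<subseteq> ball 0 (99 * k)" unfolding I_def
      by (rule closed_segment_subset) (use unit k_pos in \<open>auto simp: q_def norm_mult\<close>)
    then show "I \<subseteq> domain" using ball_subset_domain by blast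
    have "I \<subseteq> {x. inner u x \<le> - 22 * k}" unfolding I_def
      by (intro closed_segment_subset convex_halfspace_le) (use inner_q k_pos in auto)
    then show "\<And>x. x \<in> I \<Longrightarrow> inner u x \<le> - 22 * k" by blast
  qed
  have qI: "q v \<in> I" "q w \<in> I" by (auto simp: I_def)
  have qt: "q v \<in> tentacle v" "q w \<in> tentacle w" unfolding q_def by (rule foot_in_tentacle)+
  have CD: "C \<subseteq> domain" using I(1) tentacle_subset_domain unit by (auto simp: C_def)
  have TD: "tentacle u \<subseteq> domain" using tentacle_subset_domain unit by blast
  have pcC: "path_connected C" unfolding C_def
    by (intro path_connected_Un path_connected_tentacle unit) (use qI qt in \<open>auto simp: I_def\<close>)
  have sep: "2 * k < norm (x - y)" if "x \<in> tentacle u" "y \<in> C" for x y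
  proof -
    have "inner u y \<le> - 22 * k"
      using that(2) I(2) tentacle_other_halfplane[of v u y] tentacle_other_halfplane[of w u y] unit angle
      by (auto simp: C_def)
    then have "69 * k \<le> inner u (x - y)"
      using tentacle_own_halfplane[OF unit(1) that(1)] by (simp add: inner_diff_right)
    also have "\<dots> \<le> norm (x - y)" using norm_cauchy_schwarz[of u "x - y"] unit by simp
    finally show ?thesis using k_pos by linarith
  qed
  have pcT: "path_connected (tentacle u)" by (rule path_connected_tentacle[OF unit(1)])
  have pc: "path_connected (\<psi> ` tentacle u)" "path_connected (\<psi> ` C)"
    using pcT pcC path_connected_continuous_image continuous_on_subset[OF cont] TD CD by blast+
  have sub: "\<psi> ` tentacle u \<subseteq> ball 0 1" "\<psi> ` C \<subseteq> ball 0 1" using \<psi>(1) TD CD by blast+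
  have sep': "k < norm (\<phi> a - \<phi> b)" if "a \<in> \<psi> ` tentacle u" "b \<in> \<psi> ` C" for a b
    using that sep \<psi>(2) TD CD k_pos by force
  have disj: "closure (\<psi> ` tentacle u) \<inter> closure (\<psi> ` C) \<inter> sphere 0 1 = {}"
    by (rule adherent_points_disjoint[OF hol inj _ path_connected_imp_connected[OF pc(1)] sub(1)
          path_connected_imp_connected[OF pc(2)] sub(2) k_pos sep'])
       (use bounded_domain im in auto)
  \<comment> \<open>The segment is compact in the domain, so its preimage stays away from the circle
    and adds no adherent points.\<close>
  have clC: "closure (\<psi> ` C) \<inter> sphere 0 1 = \<alpha> v \<union> \<alpha> w"
  proof -
    have "compact (\<psi> ` I)" 
      using continuous_on_subset[OF cont I(1)] by (intro compact_continuous_image) (auto simp: I_def)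
    then have "closure (\<psi> ` I) = \<psi> ` I" by (simp add: compact_imp_closed closure_closed)
    moreover have "\<psi> ` I \<inter> sphere 0 1 = {}" using \<psi>(1) I(1) by force
    ultimately show ?thesis unfolding C_def \<alpha>_def by (auto simp: image_Un)
  qed
  have "\<psi> ` tentacle u \<inter> \<psi> ` C = {}" using sep' k_pos by fastforce
  then show "unlinked (\<alpha> u) (\<alpha> v \<union> \<alpha> w)" "unlinked (\<alpha> v \<union> \<alpha> w) (\<alpha> u)"
    using unlinked_adherent_points[OF pc(1) sub(1) pc(2) sub(2) _ disj]
      unlinked_adherent_points[OF pc(2) sub(2) pc(1) sub(1)] disj clC by (auto simp: \<alpha>_def Int_commute)
  show "\<alpha> u \<inter> (\<alpha> v \<union> \<alpha> w) = {}" using disj unfolding clC[symmetric] by (auto simp: \<alpha>_def)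
qed

section \<open>The common fixed prime end and the limit of its crosscuts\<close>

lemma conjugate_homeomorphism:
  assumes \<phi>: "homeomorphism (ball 0 1) domain \<phi> \<psi>"
    and g: "g \<in> G" "g' \<in> G" "homeomorphism UNIV UNIV g g'"
  shows "homeomorphism (ball 0 1) (ball 0 1) (\<psi> \<circ> g \<circ> \<phi>) (\<psi> \<circ> g' \<circ> \<phi>)"
proof -
  have "homeomorphism domain domain g g'"
    using g image_domain_subset by (intro homeomorphismI continuous_action) (auto simp: homeomorphism_def)
  then have "homeomorphism (ball 0 1) domain (g \<circ> \<phi>) (\<psi> \<circ> g')"
    by (rule homeomorphism_compose[OF \<phi>])
  from homeomorphism_compose[OF this homeomorphism_symD[OF \<phi>]] show ?thesis by (simp add: o_assoc)
qed

text \<open>\<open>nw\<close> forbids strict nesting of bounded open sets. It passes to the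
  conjugated maps on the disc because \<phi> is injective and maps open sets to bounded open
  sets.\<close>

theorem common_fixed_point:
  assumes nw: "\<And>g U V. g \<in> G \<Longrightarrow> open U \<Longrightarrow> bounded U \<Longrightarrow> open V \<Longrightarrow> V \<subseteq> U \<Longrightarrow> g ` U \<subseteq> U \<Longrightarrow> V \<inter> g ` U = {} \<Longrightarrow> V = {}"
  shows "\<exists>p. \<forall>g\<in>G. g p = p"
proof -
  obtain \<phi> \<psi> where hol: "\<phi> holomorphic_on ball 0 1" and \<phi>: "homeomorphism (ball 0 1) domain \<phi> \<psi>"
    using domain_riemann_map .
  have inj: "inj_on \<phi> (ball 0 1)" using \<phi> by (metis homeomorphism_def inj_on_inverseI)
  have im: "\<phi> ` ball 0 1 = domain" using \<phi> by (simp add: homeomorphism_def)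
  have bd: "bounded (\<phi> ` ball 0 1)" using bounded_domain im by simp
  have \<psi>: "\<psi> z \<in> ball 0 1" "\<phi> (\<psi> z) = z" if "z \<in> domain" for z
    using \<phi> that by (auto simp: homeomorphism_def)
  have \<phi>D: "\<phi> z \<in> domain" "\<psi> (\<phi> z) = z" if "z \<in> ball 0 1" for z
    using \<phi> that by (auto simp: homeomorphism_def)
  define h where "h = (\<lambda>g. \<psi> \<circ> g \<circ> \<phi>)"
  have conj: "\<phi> (h g z) = g (\<phi> z)" if "g \<in> G" "z \<in> ball 0 1" for g z
    using \<psi>(2) image_domain_subset[OF that(1)] \<phi>D(1)[OF that(2)] by (auto simp: h_def)
  have uc: "uniformly_continuous_on (\<phi> ` ball 0 1) g" if "g \<in> G" for g
  proof -
    have "uniformly_continuous_on (closure domain) g"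
      using bounded_domain by (intro compact_uniformly_continuous continuous_action that) simp
    then show ?thesis unfolding im uniformly_continuous_on_def using closure_subset[of domain] by (meson subsetD)
  qed
  define \<alpha> where "\<alpha> = (\<lambda>u. closure (\<psi> ` tentacle u) \<inter> sphere 0 1)"
  \<comment> \<open>The cube roots of unity; any two have inner product -1/2.\<close>
  define u1 where "u1 = (1 :: complex)"
  define u2 where "u2 = Complex (-1/2) (sqrt 3 / 2)"
  define u3 where "u3 = Complex (-1/2) (- sqrt 3 / 2)"
  have unit: "norm u1 = 1" "norm u2 = 1" "norm u3 = 1"
    by (simp_all add: u1_def u2_def u3_def cmod_def power2_eq_square)
  have angle: "inner u1 u2 = -1/2" "inner u1 u3 = -1/2" "inner u2 u1 = -1/2" "inner u2 u3 = -1/2"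
     "inner u3 u1 = -1/2" "inner u3 u2 = -1/2"
    by (simp_all add: u1_def u2_def u3_def inner_complex_def)
  have \<alpha>: "closure (\<psi> ` tentacle u) \<inter> sphere 0 1 = \<alpha> u" for u by (simp add: \<alpha>_def)
  note tent = adherent_sets_of_tentacles[OF hol \<phi>, unfolded \<alpha>]
  \<comment> \<open>Tentacles are invariant under \<open>g\<close> and its inverse, so both
    extensions preserve every \<alpha> u; the result on the circle needs both directions.\<close>
  have ext: "\<exists>H H'. continuous_on (cball 0 1) H \<and> (\<forall>z\<in>ball 0 1. H z = h g z) \<and>
      homeomorphism (sphere 0 1) (sphere 0 1) H H' \<and> (\<forall>u. norm u = 1 \<longrightarrow> H ` \<alpha> u \<subseteq> \<alpha> u \<and> H' ` \<alpha> u \<subseteq> \<alpha> u)" if g: "g \<in> G" for g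
  proof -
    obtain g' where g': "g' \<in> G" "homeomorphism UNIV UNIV g g'" using inverse_in[OF g] by blast
    have hh: "homeomorphism (ball 0 1) (ball 0 1) (h g) (h g')"
      unfolding h_def by (rule conjugate_homeomorphism[OF \<phi> g g'])
    obtain H H' where H: "homeomorphism (cball 0 1) (cball 0 1) H H'" "homeomorphism (sphere 0 1) (sphere 0 1) H H'"
        "\<And>z. z \<in> ball 0 1 \<Longrightarrow> H z = h g z" "\<And>z. z \<in> ball 0 1 \<Longrightarrow> H' z = h g' z"
      using homeomorphism_disc_extends[OF hh
          conformal_conjugate_uniformly_continuous[OF hol inj bd hh uc[OF g] conj[OF g]]
          conformal_conjugate_uniformly_continuous[OF hol inj bd homeomorphism_symD[OF hh] uc[OF g'(1)] conj[OF g'(1)]]]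
      by blast
    have cH: "continuous_on (cball 0 1) H" "continuous_on (cball 0 1) H'"
      using H(1) by (auto simp: homeomorphism_def)
    have inv: "K ` \<alpha> u \<subseteq> \<alpha> u"
      if u: "norm u = 1" and K: "continuous_on (cball 0 1) K" "K ` sphere 0 1 \<subseteq> sphere 0 1" 
        "\<And>z. z \<in> ball 0 1 \<Longrightarrow> K z = h f z" and f: "f \<in> G" for u K f
    proof -
      have sub: "\<psi> ` tentacle u \<subseteq> ball 0 1" using \<psi>(1) tentacle_subset_domain[OF u] by blast
      have "K ` closure (\<psi> ` tentacle u) \<subseteq> closure (\<psi> ` tentacle u)"
      proof (rule image_closure_subset[OF _ closed_closure])
        have "closure (\<psi> ` tentacle u) \<subseteq> cball 0 1" using closure_mono[OF sub] by simp
        then show "continuous_on (closure (\<psi> ` tentacle u)) K" using K(1) continuous_on_subset by blast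
        have "K z \<in> \<psi> ` tentacle u" if z: "z \<in> \<psi> ` tentacle u" for z
        proof -
          obtain x where x: "x \<in> tentacle u" "z = \<psi> x" using z by blast
          then have "x \<in> domain" using tentacle_subset_domain[OF u] by blast
          then have "K z = \<psi> (f x)" using K(3) \<psi> x by (simp add: h_def)
          then show ?thesis using image_tentacle[OF f, of u] x(1) by blast
        qed
        then show "K ` \<psi> ` tentacle u \<subseteq> closure (\<psi> ` tentacle u)" using closure_subset by blast
      qed
      then show ?thesis using K(2) unfolding \<alpha>_def by blast
    qed
    have sph: "H ` sphere 0 1 \<subseteq> sphere 0 1" "H' ` sphere 0 1 \<subseteq> sphere 0 1"
      using H(2) by (auto simp: homeomorphism_def)
    have "H ` \<alpha> u \<subseteq> \<alpha> u" "H' ` \<alpha> u \<subseteq> \<alpha> u" if "norm u = 1" for u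
      using inv[OF that cH(1) sph(1) H(3) g] inv[OF that cH(2) sph(2) H(4) g'(1)] by blast+
    then show ?thesis using cH(1) H(2,3) by blast
  qed
  obtain e where e: "e \<in> sphere 0 1" and fix_e: "\<And>H H'. homeomorphism (sphere 0 1) (sphere 0 1) H H' \<Longrightarrow>
      H ` \<alpha> u1 \<subseteq> \<alpha> u1 \<Longrightarrow> H ` \<alpha> u2 \<subseteq> \<alpha> u2 \<Longrightarrow> H' ` \<alpha> u1 \<subseteq> \<alpha> u1 \<Longrightarrow> H' ` \<alpha> u2 \<subseteq> \<alpha> u2 \<Longrightarrow> H' ` \<alpha> u3 \<subseteq> \<alpha> u3 \<Longrightarrow> H e = e"
  proof (rule circle_common_fixed_point[of "\<alpha> u1" "\<alpha> u2" "\<alpha> u3"])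
    have sub: "\<alpha> u \<subseteq> sphere 0 1" for u by (simp add: \<alpha>_def)
    then show "\<alpha> u1 \<subseteq> sphere 0 1" "\<alpha> u2 \<subseteq> sphere 0 1" "\<alpha> u3 \<subseteq> sphere 0 1" by blast+
    have "compact (\<alpha> u)" for u unfolding \<alpha>_def by (simp add: closed_Int_compact)
    then show "compact (\<alpha> u1)" "compact (\<alpha> u2)" by blast+
    show "\<alpha> u1 \<noteq> {}" "\<alpha> u2 \<noteq> {}" "\<alpha> u3 \<noteq> {}"
      unfolding \<alpha>_def by (intro tentacle_reaches_circle[OF \<phi>] unit)+
    have "\<alpha> u1 \<inter> (\<alpha> u2 \<union> \<alpha> u3) = {}"
      by (rule tent(1)) (simp_all add: unit angle)
    moreover have "\<alpha> u2 \<inter> (\<alpha> u1 \<union> \<alpha> u3) = {}"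
      by (rule tent(1)) (simp_all add: unit angle)
    ultimately show "\<alpha> u1 \<inter> \<alpha> u2 = {}" "\<alpha> u1 \<inter> \<alpha> u3 = {}" "\<alpha> u2 \<inter> \<alpha> u3 = {}" by blast+
    show "unlinked (\<alpha> u1) (\<alpha> u2 \<union> \<alpha> u3)"
      by (rule tent(2)) (simp_all add: unit angle)
    show "unlinked (\<alpha> u2) (\<alpha> u1 \<union> \<alpha> u3)"
      by (rule tent(2)) (simp_all add: unit angle)
    show "unlinked (\<alpha> u1 \<union> \<alpha> u2) (\<alpha> u3)"
      by (rule tent(3)) (simp_all add: unit angle)
  qed blast
  have ne: "norm e = 1" using e by simp
  have "\<exists>N c. crosscut_at e (1 / real (Suc n)) N c \<and> (\<forall>z\<in>c. \<forall>w\<in>c. norm (\<phi> z - \<phi> w) \<le> 1 / real (Suc n))" for n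
  proof -
    obtain N c where "crosscut_at e (1 / real (Suc n)) N c" "\<And>z w. z \<in> c \<Longrightarrow> w \<in> c \<Longrightarrow> norm (\<phi> z - \<phi> w) \<le> 1 / real (Suc n)"
      by (rule short_crosscut_exists[OF hol inj bd ne, of "1 / real (Suc n)" "1 / real (Suc n)"]) auto
    then show ?thesis by blast
  qed
  then obtain N c where cc: "\<And>n. crosscut_at e (1 / real (Suc n)) (N n) (c n)"
     and short: "\<And>n z w. z \<in> c n \<Longrightarrow> w \<in> c n \<Longrightarrow> norm (\<phi> z - \<phi> w) \<le> 1 / real (Suc n)" by metis
  have cD: "c n \<subseteq> ball 0 1" and Ne: "N n \<subseteq> ball e (1 / real (Suc n))" for n using cc[of n] by (auto simp: crosscut_at_def)
  have "\<exists>z. z \<in> c n" for n using cc[of n] by (auto simp: crosscut_at_def)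
  then obtain z where z: "\<And>n. z n \<in> c n" by metis
  have "\<phi> (z n) \<in> domain" for n by (rule \<phi>D(1)[OF subsetD[OF cD z]])
  then have "bounded (range (\<lambda>n. \<phi> (z n)))" by (intro bounded_subset[OF bounded_domain]) auto
  \<comment> \<open>\<open>p\<close> and the subsequence are chosen before any group element, so one
    point serves all of \<open>G\<close>.\<close>
  then obtain p r where r: "strict_mono r" "((\<lambda>n. \<phi> (z n)) \<circ> r) \<longlonglongrightarrow> p"
    using bounded_imp_convergent_subsequence by blast
  have "g p = p" if g: "g \<in> G" for g
  proof -
    obtain g' where g': "g' \<in> G" "homeomorphism UNIV UNIV g g'" using inverse_in[OF g] by blast
    have hh: "homeomorphism (ball 0 1) (ball 0 1) (h g) (h g')"
      unfolding h_def by (rule conjugate_homeomorphism[OF \<phi> g g'])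
    have hD: "h f x \<in> ball 0 1" if "f \<in> {g, g'}" "x \<in> ball 0 1" for f x
      using hh that by (auto simp: homeomorphism_def)
    obtain H H' where H: "continuous_on (cball 0 1) H" "\<forall>z\<in>ball 0 1. H z = h g z" "homeomorphism (sphere 0 1) (sphere 0 1) H H'"
      "\<forall>u. norm u = 1 \<longrightarrow> H ` \<alpha> u \<subseteq> \<alpha> u \<and> H' ` \<alpha> u \<subseteq> \<alpha> u" using ext[OF g] by blast
    have He: "H e = e" by (rule fix_e[OF H(3)]) (use H(4) unit in auto)
    have nwh: "V = {}" if f: "f \<in> {g, g'}" and UV: "open U" "U \<subseteq> ball 0 1" "open V" "V \<subseteq> U" "h f ` U \<subseteq> U" "V \<inter> h f ` U = {}" for f U V
    proof -
      have fG: "f \<in> G" using f g g'(1) by blast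
      have op: "open (\<phi> ` A)" if "open A" "A \<subseteq> ball 0 1" for A
        using open_image_homeomorphism[OF \<phi> open_domain that] .
      have im_f: "f ` \<phi> ` U = \<phi> ` h f ` U"
        using conj[OF fG] UV(2) by (force simp: image_iff subset_iff)
      have "\<phi> ` V = {}"
      proof (rule nw[OF fG])
        show "open (\<phi> ` U)" "open (\<phi> ` V)" using op UV by blast+
        show "bounded (\<phi> ` U)" using bounded_subset[OF bd] UV(2) by blast
        show "\<phi> ` V \<subseteq> \<phi> ` U" "f ` \<phi> ` U \<subseteq> \<phi> ` U" unfolding im_f using UV by blast+
        have "h f ` U \<subseteq> ball 0 1" "V \<subseteq> ball 0 1" using UV by blast+
        then show "\<phi> ` V \<inter> f ` \<phi> ` U = {}"
          unfolding im_f using inj_on_image_Int[OF inj, of V "h f ` U"] UV(6) by simp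
      qed
      then show ?thesis by simp
    qed
    \<comment> \<open>The extension fixes \<open>e\<close>, so a point close enough to
      \<open>e\<close> and its image both lie in \<open>N n\<close>.\<close>
    have meet: "N n \<inter> h g ` N n \<noteq> {}" for n
    proof -
      obtain \<rho> where rho: "0 < \<rho>" "ball 0 1 \<inter> ball e \<rho> \<subseteq> N n" using cc[of n] by (auto simp: crosscut_at_def)
      have ec: "e \<in> cball 0 1" using ne by simp
      obtain \<delta> where \<delta>: "0 < \<delta>" "\<And>x. x \<in> cball 0 1 \<Longrightarrow> dist x e < \<delta> \<Longrightarrow> dist (H x) e < \<rho>"
        using H(1) rho(1) ec He unfolding continuous_on_iff by metis
      have "e \<in> closure (ball 0 1)" using ec by simp
      then obtain x where x: "x \<in> ball 0 1" "dist x e < min \<delta> \<rho>"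
        using \<delta>(1) rho(1) closure_approachable[of e "ball 0 1"] by (metis min_less_iff_conj)
      have "x \<in> cball 0 1" using x(1) by simp
      then have "dist (H x) e < \<rho>" using \<delta>(2) x(2) by simp
      moreover have "H x = h g x" using H(2) x(1) by blast
      ultimately have "dist (h g x) e < \<rho>" by simp
      then have "h g x \<in> N n" using hD[of g x] x(1) rho(2) by (auto simp: dist_commute)
      moreover have "x \<in> N n" using x rho(2) by (auto simp: dist_commute)
      ultimately show ?thesis by blast
    qed
    have "\<exists>n0. \<forall>n\<ge>n0. h g ` c n \<inter> c n \<noteq> {}"
    proof -
      define d where "d = min (dist e (h g 0)) (dist e (h g' 0))"
      have "h g 0 \<noteq> e" "h g' 0 \<noteq> e" using hD[of g 0] hD[of g' 0] ne by auto
      then have "0 < d" by (simp add: d_def)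
      then obtain n0 where n0: "1 / real (Suc n0) < d" using nat_approx_posE by blast
      have "h g ` c n \<inter> c n \<noteq> {}" if n: "n \<ge> n0" for n
      proof (rule crosscut_meets_image[OF cc hh])
        have "1 / real (Suc n) \<le> 1 / real (Suc n0)" using n by (simp add: frac_le)
        then have "1 / real (Suc n) < d" using n0 by linarith
        then show "h g 0 \<notin> N n" "h g' 0 \<notin> N n" using Ne[of n] by (auto simp: d_def)
        have "1 / real (Suc n) \<le> dist e 0" using ne by simp
        then show "0 \<notin> N n" using Ne[of n] by auto
        show "N n \<inter> h g ` N n \<noteq> {}" by (rule meet)
      qed (rule nwh; (assumption | simp))+
      then show ?thesis by blast
    qed
    then obtain n0 where n0: "\<And>n. n \<ge> n0 \<Longrightarrow> \<exists>x. x \<in> c n \<and> h g x \<in> c n" by blast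
    then obtain x where x: "\<And>n. n \<ge> n0 \<Longrightarrow> x n \<in> c n \<and> h g (x n) \<in> c n" by metis
    \<comment> \<open>The images of the crosscuts shrink in diameter, so any choice of points on
      them has the limit \<open>p\<close>; this is used for \<open>x n\<close> and for
      \<open>h g (x n)\<close>.\<close>
    have lim: "(\<lambda>n. \<phi> (y (r n))) \<longlonglongrightarrow> p" if y: "\<And>n. n \<ge> n0 \<Longrightarrow> y n \<in> c n" for y
    proof -
      have "(\<lambda>n. \<phi> (y (r n)) - \<phi> (z (r n))) \<longlonglongrightarrow> 0"
      proof (rule Lim_null_comparison)
        show "eventually (\<lambda>n. norm (\<phi> (y (r n)) - \<phi> (z (r n))) \<le> 1 / real (Suc n)) sequentially"
          unfolding eventually_sequentially
        proof (intro exI[of _ n0] allI impI)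
          fix n assume "n0 \<le> n"
          then have rn: "n \<le> r n" "n0 \<le> r n" using seq_suble[OF r(1), of n] by auto
          have "norm (\<phi> (y (r n)) - \<phi> (z (r n))) \<le> 1 / real (Suc (r n))"
            by (rule short[OF y[OF rn(2)] z])
          also have "\<dots> \<le> 1 / real (Suc n)" using rn(1) by (simp add: frac_le)
          finally show "norm (\<phi> (y (r n)) - \<phi> (z (r n))) \<le> 1 / real (Suc n)" .
        qed
        show "(\<lambda>n. 1 / real (Suc n)) \<longlonglongrightarrow> 0" by (rule LIMSEQ_Suc[OF lim_1_over_n])
      qed
      from tendsto_add[OF this r(2)[unfolded o_def]] show ?thesis by simp
    qed
    have "isCont g p" using continuous_action[OF g, of UNIV] by (simp add: continuous_on_eq_continuous_at)
    then have "(\<lambda>n. g (\<phi> (x (r n)))) \<longlonglongrightarrow> g p"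
      using lim[of x] x isCont_tendsto_compose by blast
    moreover have "(\<lambda>n. \<phi> (h g (x (r n)))) \<longlonglongrightarrow> p"
      using lim[of "\<lambda>n. h g (x n)"] x by blast
    moreover have "eventually (\<lambda>n. \<phi> (h g (x (r n))) = g (\<phi> (x (r n)))) sequentially"
      unfolding eventually_sequentially
    proof (intro exI[of _ n0] allI impI)
      fix n assume "n0 \<le> n"
      then have "n0 \<le> r n" using seq_suble[OF r(1), of n] by auto
      then show "\<phi> (h g (x (r n))) = g (\<phi> (x (r n)))" using conj[OF g] x cD by blast
    qed
    ultimately show "g p = p"
      using tendsto_cong LIMSEQ_unique by metis
  qed
  then show ?thesis by blast
qed

end

section \<open>Invariant measures\<close>

text \<open>\<open>U\<close> contains the disjoint sets \<open>V\<close> and g(U), and g(U) has the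
  measure of \<open>U\<close>. That measure is finite, since finitely many open sets of finite
  measure cover the compact closure; so a nonempty \<open>V\<close> leaves no room.\<close>

lemma measure_preserving_no_nested_image:
  fixes \<mu> :: "(real^2) measure" and g :: "complex \<Rightarrow> complex"
  assumes sets: "sets \<mu> = sets borel" and lf: "locally_finite_measure \<mu>" and fs: "full_support \<mu>"
    and pres: "emeasure \<mu> (plane_of_complex ` g ` U) = emeasure \<mu> (plane_of_complex ` U)"
    and U: "open U" "bounded U" and V: "open V" "V \<subseteq> U" and gU: "open (g ` U)" "g ` U \<subseteq> U" and disj: "V \<inter> g ` U = {}"
  shows "V = {}"
proof (rule ccontr)
  assume "V \<noteq> {}"
  have op: "open (plane_of_complex ` A)" if "open A" for A
    unfolding plane_of_complex_image by (intro open_vimage that continuous_intros)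
  then have meas: "plane_of_complex ` A \<in> sets \<mu>" if "open A" for A
    using that sets by simp
  define K where "K = closure (plane_of_complex ` U)"
  have cK: "compact K" unfolding K_def
    using bounded_linear_image[OF U(2) bounded_linear_plane_of_complex] by simp
  have "\<forall>x. \<exists>W. open W \<and> x \<in> W \<and> emeasure \<mu> W < \<infinity>"
    using lf by (simp add: locally_finite_measure_def)
  then obtain W where W: "\<And>x. open (W x)" "\<And>x. x \<in> W x" "\<And>x. emeasure \<mu> (W x) < \<infinity>"
    by metis
  obtain F where F: "finite F" "K \<subseteq> (\<Union>x\<in>F. W x)"
    by (rule compactE_image[OF cK, of K W]) (use W in auto)
  have "emeasure \<mu> (plane_of_complex ` U) \<le> emeasure \<mu> (\<Union>x\<in>F. W x)"
    using F closure_subset[of "plane_of_complex ` U"] W(1) sets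
    by (intro emeasure_mono) (auto simp: K_def)
  also have "\<dots> \<le> (\<Sum>x\<in>F. emeasure \<mu> (W x))"
    using F(1) W(1) sets by (intro emeasure_subadditive_finite) auto
  also have "\<dots> < \<infinity>" using F(1) W(3) by (simp add: less_top)
  finally have fin: "emeasure \<mu> (plane_of_complex ` U) < \<infinity>" .
  have "0 < emeasure \<mu> (plane_of_complex ` V)"
    using fs op[OF V(1)] \<open>V \<noteq> {}\<close> by (simp add: full_support_def)
  then have "emeasure \<mu> (plane_of_complex ` U) < emeasure \<mu> (plane_of_complex ` V) + emeasure \<mu> (plane_of_complex ` U)"
    using fin by (metis add.commute add.right_neutral ennreal_add_left_cancel_less infinity_ennreal_def less_top)
  also have "\<dots> = emeasure \<mu> (plane_of_complex ` V) + emeasure \<mu> (plane_of_complex ` g ` U)" by (simp only: pres)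
  also have "\<dots> = emeasure \<mu> (plane_of_complex ` V \<union> plane_of_complex ` g ` U)"
    using disj by (intro plus_emeasure meas V gU) (auto simp: plane_of_complex_image)
  also have "\<dots> \<le> emeasure \<mu> (plane_of_complex ` U)"
    using V(2) gU(2) by (intro emeasure_mono meas U) auto
  finally show False by simp
qed

theorem mainTheorem3:
  fixes \<mu> :: "(real^2) measure" and G :: "(real^2 \<Rightarrow> real^2) set"
  assumes "sets \<mu> = sets borel"
    and "locally_finite_measure \<mu>"
    and "full_support \<mu>"
    and "subgroup G (BijGroup UNIV)"
    and "\<And>g. g \<in> G \<Longrightarrow> orientation_preserving_homeo g"
    and "\<And>g. g \<in> G \<Longrightarrow> preserves_measure \<mu> g"
    and "\<exists>k::real. \<forall>g\<in>G. \<forall>h\<in>G. \<forall>x. norm (g x - h x) \<le> k"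
  shows "\<exists>x. \<forall>g\<in>G. g x = x"
proof -
  obtain k0 :: real where k0: "\<And>g h x. g \<in> G \<Longrightarrow> h \<in> G \<Longrightarrow> norm (g x - h x) \<le> k0" using assms(7) by blast
  have id: "id \<in> G"
    using subgroup.one_closed[OF assms(4)] by (simp add: BijGroup_def id_def restrict_def)
  have comp: "g \<circ> h \<in> G" if "g \<in> G" "h \<in> G" for g h
  proof -
    have "g \<otimes>\<^bsub>BijGroup UNIV\<^esub> h \<in> G" using subgroup.m_closed[OF assms(4) that] .
    moreover have "g \<in> Bij UNIV" "h \<in> Bij UNIV"
      using that subgroup.subset[OF assms(4)] by (auto simp: BijGroup_def)
    ultimately show ?thesis by (simp add: BijGroup_def compose_def o_def restrict_def)
  qed
  have hom: "\<exists>g'\<in>G. homeomorphism UNIV UNIV g g'" if g: "g \<in> G" for g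
  proof -
    obtain f where f: "homeomorphism UNIV UNIV g f"
      using assms(5)[OF g] by (auto simp: orientation_preserving_homeo_def)
    have gB: "g \<in> Bij UNIV" using g subgroup.subset[OF assms(4)] by (auto simp: BijGroup_def)
    then have "inv\<^bsub>BijGroup UNIV\<^esub> g = inv_into UNIV g" by (simp add: inv_BijGroup restrict_def)
    also have "\<dots> = f" using f by (intro inv_equality) (auto simp: homeomorphism_def)
    finally have "f \<in> G" using subgroup.m_inv_closed[OF assms(4) g] by simp
    then show ?thesis using f by blast
  qed
  define conj where "conj = (\<lambda>g. complex_of_plane \<circ> g \<circ> plane_of_complex)"
  have conj_comp: "conj g \<circ> conj h = conj (g \<circ> h)" for g h by (auto simp: conj_def)
  have hom': "homeomorphism UNIV UNIV (conj g) (conj f)" if "homeomorphism UNIV UNIV g f" for g f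
    using that
    by (intro homeomorphismI)
       (auto simp: conj_def homeomorphism_def o_def
         intro!: continuous_intros continuous_on_compose2[of UNIV g] continuous_on_compose2[of UNIV f])
  interpret bounded_plane_action "conj ` G" "max k0 1"
  proof
    show "id \<in> conj ` G" using id by (intro image_eqI[of _ _ id]) (auto simp: conj_def)
    show "\<exists>g'\<in>conj ` G. homeomorphism UNIV UNIV g g'" if "g \<in> conj ` G" for g
      using that hom hom' by blast
    show "g \<circ> h \<in> conj ` G" if "g \<in> conj ` G" "h \<in> conj ` G" for g h
      using that comp conj_comp by (metis (no_types, lifting) imageE image_eqI)
    show "norm (g x - x) \<le> max k0 1" if "g \<in> conj ` G" for g x
    proof -
      obtain f where f: "f \<in> G" "g = conj f" using \<open>g \<in> conj ` G\<close> by blast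
      have "g x - x = complex_of_plane (f (plane_of_complex x) - id (plane_of_complex x))"
        by (simp add: f(2) conj_def complex_eq_iff)
      then show ?thesis using k0[OF f(1) id, of "plane_of_complex x"] by simp
    qed
  qed simp
  have "V = {}" if "g \<in> conj ` G" "open U" "bounded U" "open V" "V \<subseteq> U" "g ` U \<subseteq> U" "V \<inter> g ` U = {}" for g U V
  proof -
    obtain f where f: "f \<in> G" "g = conj f" using \<open>g \<in> conj ` G\<close> by blast
    obtain f' where f': "f' \<in> G" "homeomorphism UNIV UNIV f f'" using hom[OF f(1)] by blast
    have gU: "open (g ` U)"
      using open_image_homeomorphism[OF hom'[OF f'(2)] open_UNIV that(2)] f(2) by simp
    define A where "A = plane_of_complex ` U"
    have oA: "open A"
      unfolding A_def plane_of_complex_image by (intro open_vimage that continuous_intros)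
    have img: "plane_of_complex ` g ` U = f ` A"
      by (auto simp: A_def f(2) conj_def image_iff)
    \<comment> \<open>Invariance speaks of preimages, so the image under \<open>f\<close> is read as
      a preimage under the inverse, which also belongs to \<open>G\<close>.\<close>
    have "f ` A = f' -` A"
    proof -
      have "f' (f x) = x" "f (f' x) = x" for x using f'(2) by (auto simp: homeomorphism_def)
      then show ?thesis by (auto simp: image_iff) metis
    qed
    then have "emeasure \<mu> (f ` A) = emeasure (distr \<mu> \<mu> f') A"
      using assms(1) assms(6)[OF f'(1)] oA sets_eq_imp_space_eq[OF assms(1)]
      by (subst emeasure_distr) (auto simp: preserves_measure_def)
    also have "\<dots> = emeasure \<mu> A" using assms(6)[OF f'(1)] by (simp add: preserves_measure_def)
    finally show ?thesis
      by (intro measure_preserving_no_nested_image[OF assms(1-3), of g U V])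
         (use that gU img A_def in auto)
  qed
  then obtain p where p: "\<forall>g\<in>conj ` G. g p = p" using common_fixed_point by blast
  have "g (plane_of_complex p) = plane_of_complex p" if "g \<in> G" for g
    using p that by (metis comp_apply conj_def imageI plane_of_complex_of_plane)
  then show ?thesis by blast
qed

end
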